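(* Let $u(\sigma,t)$ be a sufficiently smooth real function on $\mathbb{R}\times[0,T]$, $2\pi$-periodic in $\sigma$, satisfying $$\frac{\partial u}{\partial t}+\frac{\delta}{R^4}\frac{\partial^4u}{\partial\sigma^4}+\frac1{R^2}\Big(\alpha-1+\frac{\delta}{R^2}\Big)\frac{\partial^2u}{\partial\sigma^2}+\frac{\alpha-1}{R^2}u-\frac{v_c}{2R^2}\Big(\frac{\partial u}{\partial\sigma}\Big)^2=0,\qquad R=R(t).$$ Let $v=\partial u/\partial\sigma$, assumed sufficiently smooth, and let $M>0$ be a constant with $\sup_{0\le t\le T}\|\partial v/\partial\sigma(\cdot,t)\|_\infty\le M$. Let $\boldsymbol u^n\in\mathbb{R}^J_{\mathrm{per}}$, $u^n_i=u(\sigma_i,t^n)$. Let $(\boldsymbol V^n)_{0\le n\le N}$ be either the Crank--Nicolson approximation or the Newton approximation of $v$ (both defined in the context). Let $\boldsymbol U^0=\boldsymbol u^0$ and, for $n=1,\dots,N$, let $\boldsymbol U^n\in\mathbb{R}^J_{\mathrm{per}}$ be the vector reconstructed from $(\boldsymbol V^n)$ as in the context. Then, for a sufficiently small $k$, $$\max_{0\le n\le N}\|\boldsymbol u^n-\boldsymbol U^n\|_h\le c\,(k^2+h^2),$$ where $c$ is a constant independent of $k$ and $h$.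
   Context: Constants and radius: $\delta>0$, $\alpha>0$, $v_c\in\mathbb{R}$, $T>0$ are fixed. $R:[0,T]\to(0,\infty)$ is a given solution of $\dot R=v_c+(\alpha-1)/R$, $R(0)=R_0>0$, which is expanding ($\dot R>0$). Grid: $J,N\in\mathbb{N}$, $h=2\pi/J$, $\sigma_i=ih$ ($i\in\mathbb{Z}$), $k=T/N$, $t^n=nk$; $R_m=R(mk)$ for integer or half-integer $m$. $\mathbb{R}^J_{\mathrm{per}}=\{\boldsymbol V=(V_i)_{i\in\mathbb{Z}}: V_i\in\mathbb{R},\ V_{i+J}=V_i\}$, with norm $\|\boldsymbol V\|_h=(h\sum_{i=1}^JV_i^2)^{1/2}$. For $\boldsymbol V,\boldsymbol W\in\mathbb{R}^J_{\mathrm{per}}$: $\Delta_hV_i=h^{-2}(V_{i-1}-2V_i+V_{i+1})$, $\Delta_h^2V_i=h^{-2}(\Delta_hV_{i-1}-2\Delta_hV_i+\Delta_hV_{i+1})$, $$(\mathcal L_h^m\boldsymbol V)_i=\frac{\delta}{R_m^4}\Delta_h^2V_i+\frac1{R_m^2}\Big(\alpha-1+\frac{\delta}{R_m^2}\Big)\Delta_hV_i+\frac{\alpha-1}{R_m^2}V_i,$$ $$(\boldsymbol\varphi(\boldsymbol V,\boldsymbol W))_i=(V_{i-1}+V_i+V_{i+1})(W_{i+1}-W_{i-1}),$$ $$(\boldsymbol\psi(\boldsymbol V,\boldsymbol W))_i=-(2V_{i-1}+V_i)W_{i-1}+(V_{i+1}-V_{i-1})W_i+(2V_{i+1}+V_i)W_{i+1}.$$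 Write $\boldsymbol v^n=(v(\sigma_i,t^n))_i$. Standing assumption: the discrete means vanish, $h\sum_{i=1}^JV^n_i=0$ for $0\le n\le N$ (in particular $h\sum_{i=1}^Jv^0_i=0$). Crank--Nicolson approximation: $\boldsymbol V^0=\boldsymbol v^0$ and, for $n=0,\dots,N-1$, with $\boldsymbol V^{n+\frac12}=\frac12(\boldsymbol V^n+\boldsymbol V^{n+1})$, $$\frac1k(\boldsymbol V^{n+1}-\boldsymbol V^n)+\mathcal L_h^{n+\frac12}\boldsymbol V^{n+\frac12}=\frac{v_c}{6hR_{n+\frac12}^2}\boldsymbol\varphi(\boldsymbol V^{n+\frac12},\boldsymbol V^{n+\frac12}).$$ Newton approximation: $\boldsymbol V^0=\boldsymbol v^0$; $\boldsymbol V^1$ solves $$\frac1k(\boldsymbol V^1-\boldsymbol V^0)+\frac12\mathcal L_h^{\frac12}(\boldsymbol V^1+\boldsymbol V^0)=\frac{v_c}{6hR_{1/2}^2}\boldsymbol\varphi(\boldsymbol v^0,\boldsymbol v^0);$$ for $1\le n\le N-1$ put $\hat{\boldsymbol V}^{n+1}=2\boldsymbol V^n-\boldsymbol V^{n-1}$, $\boldsymbol W^{n+1,0}=\hat{\boldsymbol V}^{n+1}$, let $j_{n+1}\in\mathbb{N}$ be a prescribed number of iterations, and for $j=0,\dots,j_{n+1}-1$ let $\boldsymbol W^{n+1,j+1}$ solve $$\frac1k(\boldsymbol W^{n+1,j+1}-\boldsymbol V^n)+\frac12\mathcal L_h^{n+\frac12}(\boldsymbol W^{n+1,j+1}+\boldsymbol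 V^n)=\frac{v_c}{24hR_{n+\frac12}^2}\Big(\boldsymbol\psi(\boldsymbol V^n+\hat{\boldsymbol V}^{n+1},\boldsymbol W^{n+1,j}-\hat{\boldsymbol V}^{n+1})+\boldsymbol\varphi(\boldsymbol V^n+\hat{\boldsymbol V}^{n+1},\boldsymbol V^n+\hat{\boldsymbol V}^{n+1})\Big);$$ then $\boldsymbol V^{n+1}=\boldsymbol W^{n+1,j_{n+1}}$. Reconstruction: let $\widetilde V(\sigma,t)$ on $[0,2\pi]\times[0,T]$ be the piecewise bilinear interpolant of the values $V^n_i$: for $\sigma\in[\sigma_i,\sigma_{i+1}]$, $t\in[t^n,t^{n+1}]$, with $\theta=(\sigma-\sigma_i)/h$, $\eta=(t-t^n)/k$, $$\widetilde V(\sigma,t)=(1-\theta)\big((1-\eta)V_i^n+\eta V_i^{n+1}\big)+\theta\big((1-\eta)V_{i+1}^n+\eta V_{i+1}^{n+1}\big).$$ Let $I(0)=\frac1{2\pi}\int_0^{2\pi}u(\sigma,0)\,d\sigma$ and $$\widetilde I(t)=\frac{\dot R(t)}{\dot R(0)}\Big[I(0)+\frac{v_c}{4\pi\dot R(0)}\int_0^t\Big(\frac{\dot R(\tau)}{R(\tau)^2}\int_0^{2\pi}\widetilde V(\sigma,\tau)^2\,d\sigma\Big)d\tau\Big].$$ Then $$U^n_i=\widetilde I(t^n)-\frac1{2\pi}\int_0^{2\pi}\Big(\int_0^\sigma\widetilde V(\xi,t^n)\,d\xi\Big)d\sigma+\int_0^{\sigma_i}\widetilde V(\xi,t^n)\,d\xi$$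 for $0\le i\le J$, extended periodically in $i$.
   Formalization: The weight in Ĩ is corrected: the bracket's second term is (v_c Ṙ(0)/4π)∫₀ᵗ (1/(Ṙ(τ)R(τ)²))∫Ṽ² dσ dτ, since the printed weight Ṙ(τ)/Ṙ(0) makes the claim false unless α=1, v_c=0 or v=0; each j_{n+1} is taken ≥ 1. *)

theory Defs
  imports "HOL-Analysis.Analysis"
begin

section \<open>Grids and difference operators\<close>

definition mesh :: "nat \<Rightarrow> real" where
  "mesh J = 2 * pi / real J"

definition node :: "nat \<Rightarrow> int \<Rightarrow> real" where
  "node J i = of_int i * mesh J"

definition tstep :: "real \<Rightarrow> nat \<Rightarrow> real" where
  "tstep T N = T / real N"

definition per :: "nat \<Rightarrow> (int \<Rightarrow> real) \<Rightarrow> bool" where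
  "per J V \<longleftrightarrow> (\<forall>i. V (i + int J) = V i)"

definition grid_norm :: "nat \<Rightarrow> (int \<Rightarrow> real) \<Rightarrow> real" where
  "grid_norm J V = sqrt (mesh J * (\<Sum>i=1..int J. (V i)\<^sup>2))"

definition restrict_grid :: "nat \<Rightarrow> (real \<Rightarrow> real) \<Rightarrow> int \<Rightarrow> real" where
  "restrict_grid J f = (\<lambda>i. f (node J i))"

definition lap :: "real \<Rightarrow> (int \<Rightarrow> real) \<Rightarrow> int \<Rightarrow> real" where
  "lap h V = (\<lambda>i. (V (i - 1) - 2 * V i + V (i + 1)) / h\<^sup>2)"

text \<open>The argument \<open>r\<close> is the value of the radius at the relevant time level.\<close>

definition Lh :: "real \<Rightarrow> real \<Rightarrow> real \<Rightarrow> real \<Rightarrow> (int \<Rightarrow> real) \<Rightarrow> int \<Rightarrow> real" where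
  "Lh \<delta> \<alpha> h r V = (\<lambda>i.
     \<delta> / r ^ 4 * lap h (lap h V) i
     + 1 / r\<^sup>2 * (\<alpha> - 1 + \<delta> / r\<^sup>2) * lap h V i
     + (\<alpha> - 1) / r\<^sup>2 * V i)"

definition phi :: "(int \<Rightarrow> real) \<Rightarrow> (int \<Rightarrow> real) \<Rightarrow> int \<Rightarrow> real" where
  "phi V W = (\<lambda>i. (V (i - 1) + V i + V (i + 1)) * (W (i + 1) - W (i - 1)))"

definition psi :: "(int \<Rightarrow> real) \<Rightarrow> (int \<Rightarrow> real) \<Rightarrow> int \<Rightarrow> real" where
  "psi V W = (\<lambda>i. - (2 * V (i - 1) + V i) * W (i - 1)
                   + (V (i + 1) - V (i - 1)) * W i
                   + (2 * V (i + 1) + V i) * W (i + 1))"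

section \<open>The two fully discrete schemes\<close>

definition crank_nicolson ::
  "real \<Rightarrow> real \<Rightarrow> real \<Rightarrow> real \<Rightarrow> (real \<Rightarrow> real) \<Rightarrow> nat \<Rightarrow> nat \<Rightarrow> (int \<Rightarrow> real)
    \<Rightarrow> (nat \<Rightarrow> int \<Rightarrow> real) \<Rightarrow> bool" where
  "crank_nicolson \<delta> \<alpha> v\<^sub>c T R J N v0 V \<longleftrightarrow>
     (let h = mesh J; k = tstep T N in
       (\<forall>n\<le>N. per J (V n)) \<and> V 0 = v0 \<and>
       (\<forall>n<N. \<forall>i.
          let r = R ((real n + 1/2) * k);
              Vh = (\<lambda>i. (V n i + V (Suc n) i) / 2)
          in (V (Suc n) i - V n i) / k + Lh \<delta> \<alpha> h r Vh i
             = v\<^sub>c / (6 * h * r\<^sup>2) * phi Vh Vh i))"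

text \<open>
  \<open>W n j\<close> is the \<open>j\<close>-th iterate for time level \<open>n\<close>, and \<open>its n\<close> the number of
  iterations performed there. At least one iteration is required: with none, the scheme would
  degenerate to the extrapolation \<open>V (n + 1) = 2 V n - V (n - 1)\<close>.
\<close>

definition newton ::
  "real \<Rightarrow> real \<Rightarrow> real \<Rightarrow> real \<Rightarrow> (real \<Rightarrow> real) \<Rightarrow> nat \<Rightarrow> nat \<Rightarrow> (nat \<Rightarrow> nat) \<Rightarrow> (int \<Rightarrow> real)
    \<Rightarrow> (nat \<Rightarrow> int \<Rightarrow> real) \<Rightarrow> bool" where
  "newton \<delta> \<alpha> v\<^sub>c T R J N its v0 V \<longleftrightarrow>
     (let h = mesh J; k = tstep T N in
       (\<forall>n\<le>N. per J (V n)) \<and> V 0 = v0 \<and>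
       (\<forall>i. let r = R (k / 2) in
          (V 1 i - V 0 i) / k + 1/2 * Lh \<delta> \<alpha> h r (\<lambda>i. V 1 i + V 0 i) i
          = v\<^sub>c / (6 * h * r\<^sup>2) * phi v0 v0 i) \<and>
       (\<forall>n\<in>{2..N}. 1 \<le> its n) \<and>
       (\<exists>W. \<forall>n\<in>{1..<N}.
          let r = R ((real n + 1/2) * k);
              Vhat = (\<lambda>i. 2 * V n i - V (n - 1) i);
              A = (\<lambda>i. V n i + Vhat i)
          in (\<forall>j\<le>its (n + 1). per J (W (n + 1) j)) \<and>
             W (n + 1) 0 = Vhat \<and>
             (\<forall>j<its (n + 1). \<forall>i.
                (W (n + 1) (Suc j) i - V n i) / k
                + 1/2 * Lh \<delta> \<alpha> h r (\<lambda>i. W (n + 1) (Suc j) i + V n i) i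
                = v\<^sub>c / (24 * h * r\<^sup>2)
                  * (psi A (\<lambda>i. W (n + 1) j i - Vhat i) i + phi A A i)) \<and>
             V (n + 1) = W (n + 1) (its (n + 1))))"

section \<open>Reconstruction\<close>

text \<open>
  The cell containing \<open>(\<sigma>, t)\<close> is selected by rounding down. On a cell boundary the
  choice is immaterial, and at \<open>\<sigma> = 2 * pi\<close> or \<open>t = T\<close> the value outside the grid
  gets weight zero.
\<close>

definition bilinear :: "real \<Rightarrow> nat \<Rightarrow> nat \<Rightarrow> (nat \<Rightarrow> int \<Rightarrow> real) \<Rightarrow> real \<Rightarrow> real \<Rightarrow> real" where
  "bilinear T J N V \<sigma> t =
     (let i = \<lfloor>\<sigma> / mesh J\<rfloor>; \<theta> = frac (\<sigma> / mesh J);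
          n = nat \<lfloor>t / tstep T N\<rfloor>; \<eta> = frac (t / tstep T N)
      in (1 - \<theta>) * ((1 - \<eta>) * V n i + \<eta> * V (Suc n) i)
         + \<theta> * ((1 - \<eta>) * V n (i + 1) + \<eta> * V (Suc n) (i + 1)))"

text \<open>
  For an exact solution \<open>u\<close> with \<open>\<sigma>\<close>-derivative \<open>v\<close>, integrating the equation over
  one period shows that the mean \<open>I\<close> of \<open>u\<close> satisfies
  \<open>I' = - (\<alpha> - 1) / R^2 * I + f\<close> with \<open>f = v\<^sub>c / (4 * pi * R^2) * \<integral> v^2\<close>.
  As \<open>(R')' = - (\<alpha> - 1) / R^2 * R'\<close>, the following lemma gives
  \<open>I t = R' t / R' 0 * (I 0 + R' 0 * \<integral> f / R')\<close>, which is what \<open>I_tilde\<close>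
  below discretizes. Pitfall: the weight under the integral is \<open>R' 0 / R' \<tau>\<close>. With the
  inverted weight \<open>R' \<tau> / R' 0\<close>, which appears in the source, the reconstruction is
  consistent only if \<open>\<alpha> = 1\<close>, \<open>v\<^sub>c = 0\<close> or \<open>v = 0\<close>.
\<close>

lemma mean_integrating_factor:
  fixes R R' I f :: "real \<Rightarrow> real"
  assumes R: "(R has_real_derivative R' t) (at t within S)"
    and R': "\<And>s. s \<in> S \<Longrightarrow> R' s = v\<^sub>c + (\<alpha> - 1) / R s"
    and nz: "R t > 0" "R' t > 0" and t: "t \<in> S"
    and I: "(I has_real_derivative - ((\<alpha> - 1) / (R t)\<^sup>2) * I t + f t) (at t within S)"
  shows "((\<lambda>s. I s / R' s) has_real_derivative f t / R' t) (at t within S)"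
proof -
  have "((\<lambda>s. v\<^sub>c + (\<alpha> - 1) / R s) has_real_derivative - ((\<alpha> - 1) / (R t)\<^sup>2) * R' t)
          (at t within S)"
    using nz by (auto intro!: derivative_eq_intros R simp: power2_eq_square)
  then have "(R' has_real_derivative - ((\<alpha> - 1) / (R t)\<^sup>2) * R' t) (at t within S)"
    unfolding has_field_derivative_def
    by (rule has_derivative_transform[OF t, rotated]) (simp add: R')
  then show ?thesis
    using nz by (auto intro!: derivative_eq_intros I simp: field_simps power2_eq_square)
qed

definition I_tilde ::
  "real \<Rightarrow> real \<Rightarrow> (real \<Rightarrow> real) \<Rightarrow> (real \<Rightarrow> real) \<Rightarrow> (real \<Rightarrow> real) \<Rightarrow> nat \<Rightarrow> nat
    \<Rightarrow> (nat \<Rightarrow> int \<Rightarrow> real) \<Rightarrow> real \<Rightarrow> real" where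
  "I_tilde v\<^sub>c T R R' u0 J N V t =
     R' t / R' 0 *
       (1 / (2 * pi) * integral {0..2 * pi} u0
        + v\<^sub>c * R' 0 / (4 * pi) *
          integral {0..t} (\<lambda>\<tau>. 1 / (R' \<tau> * (R \<tau>)\<^sup>2) *
            integral {0..2 * pi} (\<lambda>\<sigma>. (bilinear T J N V \<sigma> \<tau>)\<^sup>2)))"

text \<open>
  Reducing the index modulo \<open>J\<close> is the periodic extension. The formula takes the same
  value at \<open>i = 0\<close> and at \<open>i = J\<close> because the discrete means vanish.
\<close>

definition reconstruction ::
  "real \<Rightarrow> real \<Rightarrow> (real \<Rightarrow> real) \<Rightarrow> (real \<Rightarrow> real) \<Rightarrow> (real \<Rightarrow> real) \<Rightarrow> nat \<Rightarrow> nat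
    \<Rightarrow> (nat \<Rightarrow> int \<Rightarrow> real) \<Rightarrow> nat \<Rightarrow> int \<Rightarrow> real" where
  "reconstruction v\<^sub>c T R R' u0 J N V n i =
     (if n = 0 then restrict_grid J u0 i
      else let t = real n * tstep T N; i' = i mod int J in
        I_tilde v\<^sub>c T R R' u0 J N V t
        - 1 / (2 * pi) *
          integral {0..2 * pi} (\<lambda>\<sigma>. integral {0..\<sigma>} (\<lambda>\<xi>. bilinear T J N V \<xi> t))
        + integral {0..node J i'} (\<lambda>\<xi>. bilinear T J N V \<xi> t))"

section \<open>Smoothness and the differential equation\<close>

text \<open>
  Class \<open>C^m\<close> on \<open>\<real> \<times> [0, T]\<close>, with one-sided time derivatives at the end points;
  \<open>D a b\<close> is the partial derivative of order \<open>a\<close> in \<open>\<sigma>\<close> and \<open>b\<close> in \<open>t\<close>. Mixed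
  derivatives of order up to \<open>m\<close> commute for such functions, so this doubly indexed family
  loses no generality.
\<close>

definition smooth_strip :: "nat \<Rightarrow> real \<Rightarrow> (real \<Rightarrow> real \<Rightarrow> real) \<Rightarrow> bool" where
  "smooth_strip m T f \<longleftrightarrow>
     (\<exists>D :: nat \<Rightarrow> nat \<Rightarrow> real \<Rightarrow> real \<Rightarrow> real.
        (\<forall>\<sigma>. \<forall>t\<in>{0..T}. D 0 0 \<sigma> t = f \<sigma> t) \<and>
        (\<forall>a b. a + b \<le> m \<longrightarrow> continuous_on (UNIV \<times> {0..T}) (\<lambda>(\<sigma>, t). D a b \<sigma> t)) \<and>
        (\<forall>a b. a + b < m \<longrightarrow> (\<forall>\<sigma>. \<forall>t\<in>{0..T}.
           ((\<lambda>s. D a b s t) has_real_derivative D (Suc a) b \<sigma> t) (at \<sigma>) \<and>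
           ((\<lambda>\<tau>. D a b \<sigma> \<tau>) has_real_derivative D a (Suc b) \<sigma> t) (at t within {0..T}))))"

definition dsigma :: "nat \<Rightarrow> (real \<Rightarrow> real \<Rightarrow> real) \<Rightarrow> real \<Rightarrow> real \<Rightarrow> real" where
  "dsigma m f \<sigma> t = (deriv ^^ m) (\<lambda>s. f s t) \<sigma>"

definition dtime :: "real \<Rightarrow> (real \<Rightarrow> real \<Rightarrow> real) \<Rightarrow> real \<Rightarrow> real \<Rightarrow> real" where
  "dtime T f \<sigma> t = vector_derivative (\<lambda>\<tau>. f \<sigma> \<tau>) (at t within {0..T})"

end

theory Submission
  imports Defs
begin

text \<open>
  Everything is done in discrete \<open>L\<^sup>2\<close> norms. The quadratic term is in conservation form, so after
  summation by parts its pairing with a test sequence \<open>X\<close> is bounded by the \<open>L\<^sup>2\<close> norms of its two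
  factors and that of the discrete Laplacian of \<open>X\<close>, which the fourth order term absorbs. For
  Crank--Nicolson, the part of the error equation that is quadratic in the error is orthogonal to the
  error, and Gronwall's lemma finishes the proof for all meshes. For Newton, the constants depend on a bound
  \<open>K\<close> for the computed solution. On fine meshes this bound propagates from step to step, as the
  error is \<open>O(k\<^sup>2 + h\<^sup>2)\<close>. On the remaining coarse meshes an error of order one is harmless, and
  the bound comes from the energy of the scheme itself: the increments are \<open>O(k)\<close>, hence the
  scheme is a small perturbation of one in which the quadratic term is orthogonal to the solution.

  In the reconstruction, the difference of the interpolants is controlled in \<open>L\<^sup>1\<close>, and dividing
  the mean of \<open>u\<close> by \<open>R'\<close> reduces its evolution to an integral of \<open>v\<^sup>2\<close>.
\<close>

section \<open>Periodic grid functions\<close>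

text \<open>The obstacle is that the bound on \<open>k\<close> must not involve the mesh. Turning
  discrete L2 bounds for the computed solution into maximum norm bounds by an inverse inequality
  would cost a negative power of \<open>h\<close>. Therefore the quadratic term is always charged to
  two L2 norms and one discrete Laplacian, and the factor \<open>mesh J\<close> gained in
  \<open>diff_le_lap\<close> pays for the \<open>1 / h\<close> in the scheme. Fine and coarse meshes
  are separated by a threshold \<open>h0\<close> that depends on the data only: below it the
  predicted error is at most one, above it \<open>4 / h0\<^sup>2\<close> bounds the discrete
  Laplacian. Smallness of \<open>k\<close> is imposed last, once the solution bounds of both regimes
  are fixed; this is not circular, because the coarse growth factor \<open>L (2 * b)\<close> does
  not involve the bound that it produces. The algebra rests on \<open>psi\<close> being a symmetric
  bilinear form with \<open>psi V V = 2 * phi V V\<close>: differences of nonlinear terms follow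
  from binomial identities, and the Newton right-hand side equals the Crank-Nicolson one at the
  previous iterate up to the square of a correction.\<close>

definition ip :: "nat \<Rightarrow> (int \<Rightarrow> real) \<Rightarrow> (int \<Rightarrow> real) \<Rightarrow> real" where
  "ip J X Y = mesh J * (\<Sum>i=1..int J. X i * Y i)"

lemma mesh_nonneg [simp]: "0 \<le> mesh J"
  by (simp add: mesh_def)

lemma mesh_pos: "J \<ge> 1 \<Longrightarrow> 0 < mesh J"
  by (simp add: mesh_def)

lemma ip_commute: "ip J X Y = ip J Y X"
  by (simp add: ip_def mult.commute)

lemma ip_add_left: "ip J (\<lambda>i. X i + Y i) Z = ip J X Z + ip J Y Z"
  and ip_diff_left: "ip J (\<lambda>i. X i - Y i) Z = ip J X Z - ip J Y Z"
  and ip_scale_left: "ip J (\<lambda>i. c * X i) Z = c * ip J X Z"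
  by (simp_all add: ip_def sum.distrib sum_subtractf algebra_simps sum_distrib_left)

lemma ip_add_right: "ip J Z (\<lambda>i. X i + Y i) = ip J Z X + ip J Z Y"
  and ip_diff_right: "ip J Z (\<lambda>i. X i - Y i) = ip J Z X - ip J Z Y"
  and ip_scale_right: "ip J Z (\<lambda>i. c * X i) = c * ip J Z X"
  by (simp_all add: ip_def sum.distrib sum_subtractf algebra_simps sum_distrib_left)

lemmas ip_bilinear = ip_add_left ip_diff_left ip_scale_left ip_add_right ip_diff_right ip_scale_right

lemma ip_cong:
  assumes "\<And>i. i \<in> {1..int J} \<Longrightarrow> X i = X' i" "\<And>i. i \<in> {1..int J} \<Longrightarrow> Y i = Y' i"
  shows "ip J X Y = ip J X' Y'"
  using assms by (simp add: ip_def)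

lemma grid_norm_nonneg [simp]: "0 \<le> grid_norm J X"
  by (simp add: grid_norm_def sum_nonneg)

lemma grid_norm_L2_set: "grid_norm J X = sqrt (mesh J) * L2_set X {1..int J}"
  by (simp add: grid_norm_def L2_set_def real_sqrt_mult)

lemma ip_self: "ip J X X = (grid_norm J X)\<^sup>2"
  by (simp add: grid_norm_def ip_def sum_nonneg flip: power2_eq_square)

lemma ip_abs_le: "mesh J * (\<Sum>i=1..int J. \<bar>X i\<bar> * \<bar>Y i\<bar>) \<le> grid_norm J X * grid_norm J Y"
proof -
  have "mesh J * (\<Sum>i=1..int J. \<bar>X i\<bar> * \<bar>Y i\<bar>)
      \<le> mesh J * (L2_set X {1..int J} * L2_set Y {1..int J})"
    by (intro mult_left_mono L2_set_mult_ineq) simp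
  also have "\<dots> = (sqrt (mesh J) * sqrt (mesh J)) * (L2_set X {1..int J} * L2_set Y {1..int J})"
    by simp
  also have "\<dots> = grid_norm J X * grid_norm J Y"
    by (simp only: grid_norm_L2_set mult_ac)
  finally show ?thesis .
qed

lemma ip_Cauchy_Schwarz: "\<bar>ip J X Y\<bar> \<le> grid_norm J X * grid_norm J Y"
proof -
  have "\<bar>ip J X Y\<bar> \<le> mesh J * (\<Sum>i=1..int J. \<bar>X i\<bar> * \<bar>Y i\<bar>)"
    unfolding ip_def abs_mult using sum_abs[of "\<lambda>i. X i * Y i"]
    by (intro mult_mono) (auto simp: abs_mult)
  then show ?thesis using ip_abs_le order_trans by blast
qed

text \<open>Young's inequality, weighted so that the norm of \<open>Z\<close> appears with
  coefficient one, the slot that \<open>energy_step\<close> reserves for residuals.\<close>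

lemma ip_le_squares:
  assumes "grid_norm J X \<le> \<rho>"
  shows "ip J X Z \<le> (grid_norm J Z)\<^sup>2 + \<rho>\<^sup>2 / 4"
proof -
  have "ip J X Z \<le> \<rho> * grid_norm J Z"
    using ip_Cauchy_Schwarz[of J X Z] mult_right_mono[OF assms, of "grid_norm J Z"] by simp
  also have "\<dots> \<le> (grid_norm J Z)\<^sup>2 + \<rho>\<^sup>2 / 4"
    using zero_le_power2[of "grid_norm J Z - \<rho> / 2"] by (simp add: power2_eq_square algebra_simps)
  finally show ?thesis .
qed

lemma grid_norm_triangle: "grid_norm J (\<lambda>i. X i + Y i) \<le> grid_norm J X + grid_norm J Y"
  unfolding grid_norm_L2_set
  by (metis L2_set_triangle_ineq distrib_left mesh_nonneg mult_left_mono real_sqrt_ge_zero)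

lemma grid_norm_scale: "grid_norm J (\<lambda>i. c * X i) = \<bar>c\<bar> * grid_norm J X"
  by (simp add: grid_norm_L2_set L2_set_def power_mult_distrib real_sqrt_mult flip: sum_distrib_left)

lemma grid_norm_uminus: "grid_norm J (\<lambda>i. - X i) = grid_norm J X"
  using grid_norm_scale[of J "-1" X] by simp

lemma grid_norm_diff: "grid_norm J (\<lambda>i. X i - Y i) \<le> grid_norm J X + grid_norm J Y"
  using grid_norm_triangle[of J X "\<lambda>i. - Y i"] by (simp add: grid_norm_uminus)

lemma grid_norm_bound:
  assumes "\<And>i. i \<in> {1..int J} \<Longrightarrow> \<bar>X i\<bar> \<le> B" and "J \<ge> 1"
  shows "grid_norm J X \<le> sqrt (2 * pi) * B"
proof -
  have B: "B \<ge> 0" using assms(1)[of 1] assms(2) by simp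
  have "(\<Sum>i=1..int J. (X i)\<^sup>2) \<le> (\<Sum>i=1..int J. B\<^sup>2)"
    using assms(1) B by (intro sum_mono) (simp add: abs_le_square_iff[symmetric])
  then have "mesh J * (\<Sum>i=1..int J. (X i)\<^sup>2) \<le> mesh J * (real J * B\<^sup>2)"
    by (intro mult_left_mono) auto
  also have "\<dots> = 2 * pi * B\<^sup>2" using assms(2) by (simp add: mesh_def)
  finally show ?thesis using B unfolding grid_norm_def
    by (intro real_le_lsqrt) (auto simp: power_mult_distrib sum_nonneg)
qed

lemma sum_shift_per:
  assumes "per J X"
  shows "(\<Sum>i=1..int J. X (i + 1)) = (\<Sum>i=1..int J. X i)"
proof (cases "J = 0")
  case False
  have "(\<Sum>i=1..int J. X (i + 1)) = (\<Sum>i=2..int J + 1. X i)"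
    by (rule sum.reindex_bij_witness[of _ "\<lambda>i. i - 1" "\<lambda>i. i + 1"]) auto
  also have "{2..int J + 1} = insert (int J + 1) {2..int J}" using False by auto
  also have "sum X \<dots> = X (1 + int J) + sum X {2..int J}" by (simp add: add.commute)
  also have "X (1 + int J) = X 1" using assms by (simp add: per_def)
  also have "X 1 + sum X {2..int J} = sum X (insert 1 {2..int J})" by simp
  also have "insert 1 {2..int J} = {1..int J}" using False by auto
  finally show ?thesis .
qed simp

lemma per_shift: "per J X \<Longrightarrow> per J (\<lambda>i. X (i + s))"
  and per_shift': "per J X \<Longrightarrow> per J (\<lambda>i. X (i - s))"
  unfolding per_def by (metis add.assoc add.commute, metis add_diff_eq diff_add_eq)

lemma sum_shift_per':
  assumes "per J X"
  shows "(\<Sum>i=1..int J. X (i - 1)) = (\<Sum>i=1..int J. X i)"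
  using sum_shift_per[OF per_shift'[OF assms, of 1]] by simp

lemma per_add: "per J X \<Longrightarrow> per J Y \<Longrightarrow> per J (\<lambda>i. X i + Y i)"
  and per_diff: "per J X \<Longrightarrow> per J Y \<Longrightarrow> per J (\<lambda>i. X i - Y i)"
  and per_mult: "per J X \<Longrightarrow> per J Y \<Longrightarrow> per J (\<lambda>i. X i * Y i)"
  and per_divide: "per J X \<Longrightarrow> per J (\<lambda>i. X i / c)"
  and per_const: "per J (\<lambda>i. c)"
  and per_uminus: "per J X \<Longrightarrow> per J (\<lambda>i. - X i)"
  and per_abs: "per J X \<Longrightarrow> per J (\<lambda>i. \<bar>X i\<bar>)"
  by (simp_all add: per_def)

lemma per_lap: "per J X \<Longrightarrow> per J (lap h X)"
  unfolding lap_def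
  by (intro per_divide per_add per_diff per_mult per_const per_shift per_shift')

lemmas per_intros = per_add per_diff per_mult per_divide per_const per_uminus per_abs per_lap
  per_shift per_shift'

lemma grid_norm_shift:
  assumes "per J X" shows "grid_norm J (\<lambda>i. X (i + 1)) = grid_norm J X"
  unfolding grid_norm_def
  using sum_shift_per[of J "\<lambda>i. (X i)\<^sup>2"] assms by (simp add: per_def)

lemma grid_norm_shift':
  assumes "per J X" shows "grid_norm J (\<lambda>i. X (i - 1)) = grid_norm J X"
  unfolding grid_norm_def
  using sum_shift_per'[of J "\<lambda>i. (X i)\<^sup>2"] assms by (simp add: per_def)

lemma ip_lap:
  assumes "per J X" "per J Y"
  shows "ip J (lap h X) Y = ip J X (lap h Y)"
proof -
  have 1: "(\<Sum>i=1..int J. X (i - 1) * Y i) = (\<Sum>i=1..int J. X i * Y (i + 1))"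
    using sum_shift_per[of J "\<lambda>i. X (i - 1) * Y i"] assms
    by (simp add: per_mult per_shift')
  have 2: "(\<Sum>i=1..int J. X (i + 1) * Y i) = (\<Sum>i=1..int J. X i * Y (i - 1))"
    using sum_shift_per'[of J "\<lambda>i. X (i + 1) * Y i"] assms
    by (simp add: per_mult per_shift)
  have "(\<Sum>i=1..int J. lap h X i * Y i)
      = ((\<Sum>i=1..int J. X (i - 1) * Y i) - 2 * (\<Sum>i=1..int J. X i * Y i)
          + (\<Sum>i=1..int J. X (i + 1) * Y i)) / h\<^sup>2"
    by (simp add: lap_def sum_divide_distrib sum_distrib_left algebra_simps
        add_divide_distrib diff_divide_distrib sum.distrib sum_subtractf)
  also have "\<dots> = (\<Sum>i=1..int J. X i * lap h Y i)"
    unfolding 1 2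
    by (simp add: lap_def sum_divide_distrib sum_distrib_left algebra_simps
        add_divide_distrib diff_divide_distrib sum.distrib sum_subtractf)
  finally show ?thesis by (simp add: ip_def)
qed

lemma lap_add: "lap h (\<lambda>i. X i + Y i) = (\<lambda>i. lap h X i + lap h Y i)"
  and lap_diff: "lap h (\<lambda>i. X i - Y i) = (\<lambda>i. lap h X i - lap h Y i)"
  and lap_scale: "lap h (\<lambda>i. c * X i) = (\<lambda>i. c * lap h X i)"
  by (rule ext, simp add: lap_def add_divide_distrib diff_divide_distrib algebra_simps)+

text \<open>An inverse inequality. Its factor blows up under refinement, so it enters only through
  \<open>increment_le\<close>, where the mesh width is bounded below.\<close>

lemma grid_norm_lap_le:
  assumes "per J X"
  shows "grid_norm J (lap h X) \<le> 4 / h\<^sup>2 * grid_norm J X"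
proof -
  have e: "lap h X = (\<lambda>i. (1 / h\<^sup>2) * ((X (i - 1) + (-2) * X i) + X (i + 1)))"
    by (rule ext) (simp add: lap_def)
  have "grid_norm J (\<lambda>i. (X (i - 1) + (-2) * X i) + X (i + 1))
      \<le> grid_norm J (\<lambda>i. X (i - 1) + (-2) * X i) + grid_norm J (\<lambda>i. X (i + 1))"
    by (rule grid_norm_triangle)
  also have "grid_norm J (\<lambda>i. X (i - 1) + (-2) * X i)
      \<le> grid_norm J (\<lambda>i. X (i - 1)) + grid_norm J (\<lambda>i. (-2) * X i)"
    by (rule grid_norm_triangle)
  finally have "grid_norm J (\<lambda>i. (X (i - 1) + (-2) * X i) + X (i + 1)) \<le> 4 * grid_norm J X"
    unfolding grid_norm_scale grid_norm_shift[OF assms] grid_norm_shift'[OF assms] by simp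
  then show ?thesis unfolding e grid_norm_scale
    by (simp add: divide_right_mono)
qed

text \<open>The differences of a periodic sequence have zero sum, so they are bounded by their total variation.\<close>

lemma diff_le_lap:
  assumes X: "per J X" and J: "J \<ge> 1"
  shows "\<bar>X (m + 1) - X m\<bar> \<le> mesh J * (sqrt (2 * pi) * grid_norm J (lap (mesh J) X))"
proof -
  define d where "d i = X (i + 1) - X i" for i
  define TV where "TV = (\<Sum>i=1..int J. \<bar>d (i + 1) - d i\<bar>)"
  have pd: "per J d" unfolding d_def using X by (intro per_intros)
  have shift: "(\<Sum>i=1..int J. f (i + int s)) = (\<Sum>i=1..int J. f i)" if "per J f"
    for f :: "int \<Rightarrow> real" and s :: nat
  proof (induction s)
    case (Suc s)
    have "(\<Sum>i=1..int J. f (i + int (Suc s))) = (\<Sum>i=1..int J. (\<lambda>j. f (j + int s)) (i + 1))"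
      by (simp add: algebra_simps)
    also have "\<dots> = (\<Sum>i=1..int J. f (i + int s))"
      by (rule sum_shift_per) (intro per_intros that)
    finally show ?case using Suc by simp
  qed simp
  have shift_any: "(\<Sum>i=1..int J. f (i + s)) = (\<Sum>i=1..int J. f i)" if "per J f"
    for f :: "int \<Rightarrow> real" and s :: int
  proof (cases "s \<ge> 0")
    case True then show ?thesis using shift[OF that, of "nat s"] by simp
  next
    case False
    then show ?thesis using shift[OF per_shift[OF that, of s], of "nat (- s)"] by simp
  qed
  have dd: "\<bar>d (m + int j) - d m\<bar> \<le> (\<Sum>i=m..<m + int j. \<bar>d (i + 1) - d i\<bar>)" for j :: nat
  proof (induction j)
    case (Suc j)
    have "{m..<m + int (Suc j)} = insert (m + int j) {m..<m + int j}" by auto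
    then have "(\<Sum>i=m..<m + int (Suc j). \<bar>d (i + 1) - d i\<bar>)
        = \<bar>d (m + int j + 1) - d (m + int j)\<bar> + (\<Sum>i=m..<m + int j. \<bar>d (i + 1) - d i\<bar>)"
      by simp
    with Suc show ?case by (simp add: algebra_simps)
  qed simp
  have TV': "(\<Sum>i=m..<m + int J. \<bar>d (i + 1) - d i\<bar>) = TV"
  proof -
    have "(\<Sum>i=m..<m + int J. \<bar>d (i + 1) - d i\<bar>)
        = (\<Sum>i=1..int J. (\<lambda>i. \<bar>d (i + 1) - d i\<bar>) (i + (m - 1)))"
      by (rule sum.reindex_bij_witness[of _ "\<lambda>i. i + (m - 1)" "\<lambda>i. i - (m - 1)"]) (auto simp: algebra_simps)
    also have "\<dots> = TV" unfolding TV_def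
      by (rule shift_any) (intro per_intros pd)
    finally show ?thesis .
  qed
  have dj: "\<bar>d (m + i) - d m\<bar> \<le> TV" if "i \<in> {1..int J}" for i
  proof -
    have "\<bar>d (m + int (nat i)) - d m\<bar> \<le> (\<Sum>i=m..<m + int (nat i). \<bar>d (i + 1) - d i\<bar>)" by (rule dd)
    also have "\<dots> \<le> (\<Sum>i=m..<m + int J. \<bar>d (i + 1) - d i\<bar>)"
      using that by (intro sum_mono2) auto
    finally show ?thesis using that TV' by simp
  qed
  have zero: "(\<Sum>i=1..int J. d (m + i)) = 0"
    using shift_any[OF pd, of m] sum_shift_per[OF X]
    by (simp add: d_def sum_subtractf add.commute)
  have "real J * d m = (\<Sum>i=1..int J. d m - d (m + i))"
    using zero by (simp add: sum_subtractf)
  then have "real J * \<bar>d m\<bar> = \<bar>\<Sum>i=1..int J. d m - d (m + i)\<bar>"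
    by (metis abs_mult abs_of_nat)
  also have "\<dots> \<le> (\<Sum>i=1..int J. \<bar>d m - d (m + i)\<bar>)" by (rule sum_abs)
  also have "\<dots> \<le> (\<Sum>i=1..int J. TV)"
    by (intro sum_mono) (use dj in \<open>simp add: abs_minus_commute\<close>)
  finally have dTV: "\<bar>d m\<bar> \<le> TV" using J by simp
  have h: "mesh J > 0" using J by (rule mesh_pos)
  have "TV = (\<Sum>i=1..int J. (\<lambda>i. \<bar>d i - d (i - 1)\<bar>) (i + 1))" by (simp add: TV_def)
  also have "\<dots> = (\<Sum>i=1..int J. \<bar>d i - d (i - 1)\<bar>)"
    by (rule sum_shift_per) (intro per_intros pd)
  \<comment> \<open>Of the two factors \<open>h\<close> that turn the Laplacian into second
    differences, one completes a discrete L1 norm, bounded by Cauchy-Schwarz against the constant 1.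
    The other one survives and later cancels the \<open>1 / h\<close> in front of the
    nonlinearity.\<close>
  also have "\<dots> = (\<Sum>i=1..int J. (mesh J)\<^sup>2 * \<bar>lap (mesh J) X i\<bar>)"
    using h by (intro sum.cong) (auto simp: d_def lap_def abs_divide algebra_simps)
  also have "\<dots> = mesh J * (mesh J * (\<Sum>i=1..int J. \<bar>1\<bar> * \<bar>lap (mesh J) X i\<bar>))"
    by (simp add: sum_distrib_left power2_eq_square mult_ac)
  also have "\<dots> \<le> mesh J * (grid_norm J (\<lambda>_. 1) * grid_norm J (lap (mesh J) X))"
    by (intro mult_left_mono ip_abs_le) simp
  also have "\<dots> \<le> mesh J * (sqrt (2 * pi) * grid_norm J (lap (mesh J) X))"
    using grid_norm_bound[of J "\<lambda>_. 1" 1] J by (intro mult_left_mono mult_right_mono) auto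
  finally show ?thesis using dTV by (simp add: d_def)
qed

section \<open>The quadratic term\<close>

text \<open>Since \<open>phi\<close> occurs in both schemes with equal arguments only, this lets
  \<open>psi\<close> carry all nonlinear terms.\<close>

lemma phi_eq_psi: "phi V V i = psi V V i / 2"
  by (simp add: phi_def psi_def field_simps)

text \<open>A cell flux approximating \<open>6 * A * B\<close>. It is symmetric in \<open>A\<close>
  and \<open>B\<close>, which makes \<open>psi\<close> a symmetric bilinear form; every later
  identity proved by expanding \<open>psi_def\<close> is a binomial formula for it.\<close>

definition flux :: "(int \<Rightarrow> real) \<Rightarrow> (int \<Rightarrow> real) \<Rightarrow> int \<Rightarrow> real" where
  "flux A B i = 2 * (A (i + 1) * B (i + 1)) + A (i + 1) * B i + A i * B (i + 1) + 2 * (A i * B i)"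

lemma psi_flux: "psi A B i = flux A B i - flux A B (i - 1)"
  by (simp add: psi_def flux_def algebra_simps)

text \<open>Cauchy-Schwarz on each of the four products, shifts leaving the norm unchanged; 6 is the
  sum of the weights 2, 1, 1, 2.\<close>

lemma flux_sum_le:
  assumes "per J A" "per J B"
  shows "mesh J * (\<Sum>i=1..int J. \<bar>flux A B i\<bar>) \<le> 6 * (grid_norm J A * grid_norm J B)"
proof -
  have "(\<Sum>i=1..int J. \<bar>flux A B i\<bar>) \<le> (\<Sum>i=1..int J. 2 * (\<bar>A (i + 1)\<bar> * \<bar>B (i + 1)\<bar>) + \<bar>A (i + 1)\<bar> * \<bar>B i\<bar> +
      \<bar>A i\<bar> * \<bar>B (i + 1)\<bar> + 2 * (\<bar>A i\<bar> * \<bar>B i\<bar>))"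
    by (intro sum_mono) (simp add: flux_def flip: abs_mult)
  then have "mesh J * (\<Sum>i=1..int J. \<bar>flux A B i\<bar>) \<le> mesh J * \<dots>"
    by (intro mult_left_mono) auto
  also have "\<dots> = 2 * (mesh J * (\<Sum>i=1..int J. \<bar>A (i + 1)\<bar> * \<bar>B (i + 1)\<bar>)) +
      mesh J * (\<Sum>i=1..int J. \<bar>A (i + 1)\<bar> * \<bar>B i\<bar>) + mesh J * (\<Sum>i=1..int J. \<bar>A i\<bar> * \<bar>B (i + 1)\<bar>)
      + 2 * (mesh J * (\<Sum>i=1..int J. \<bar>A i\<bar> * \<bar>B i\<bar>))"
    by (simp add: sum.distrib distrib_left sum_distrib_left mult_ac)
  also have "\<dots> \<le> 2 * (grid_norm J (\<lambda>i. A (i + 1)) * grid_norm J (\<lambda>i. B (i + 1)))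
     + grid_norm J (\<lambda>i. A (i + 1)) * grid_norm J B + grid_norm J A * grid_norm J (\<lambda>i. B (i + 1))
     + 2 * (grid_norm J A * grid_norm J B)"
    using ip_abs_le[of J "\<lambda>i. A (i + 1)" "\<lambda>i. B (i + 1)"] ip_abs_le[of J "\<lambda>i. A (i + 1)" B]
      ip_abs_le[of J A "\<lambda>i. B (i + 1)"] ip_abs_le[of J A B] by linarith
  also have "\<dots> = 6 * (grid_norm J A * grid_norm J B)"
    using assms by (simp add: grid_norm_shift)
  finally show ?thesis .
qed

text \<open>Summation by parts moves the difference quotient to the test sequence, so that only
  discrete \<open>L\<^sup>2\<close> norms of the factors enter.\<close>

lemma ip_psi_le:
  assumes A: "per J A" and B: "per J B" and X: "per J X" and J: "J \<ge> 1"
  shows "\<bar>ip J (psi A B) X\<bar>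
    \<le> 6 * sqrt (2 * pi) * mesh J * (grid_norm J A * grid_norm J B * grid_norm J (lap (mesh J) X))"
proof -
  define K where "K = mesh J * (sqrt (2 * pi) * grid_norm J (lap (mesh J) X))"
  have pf: "per J (flux A B)"
    unfolding flux_def[abs_def] using A B by (intro per_intros)
  have "(\<Sum>i=1..int J. flux A B (i - 1) * X i) = (\<Sum>i=1..int J. flux A B i * X (i + 1))"
    using sum_shift_per[of J "\<lambda>i. flux A B (i - 1) * X i"] pf X
    by (simp add: per_mult per_shift')
  then have "ip J (psi A B) X = mesh J * (\<Sum>i=1..int J. flux A B i * (X i - X (i + 1)))"
    by (simp add: ip_def psi_flux left_diff_distrib right_diff_distrib sum_subtractf)
  also have "\<bar>\<dots>\<bar> \<le> mesh J * (\<Sum>i=1..int J. \<bar>flux A B i\<bar> * K)"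
  proof -
    have "\<bar>flux A B i * (X i - X (i + 1))\<bar> \<le> \<bar>flux A B i\<bar> * K" for i
      using diff_le_lap[OF X J, of i] unfolding abs_mult K_def
      by (intro mult_left_mono) (auto simp: abs_minus_commute)
    then have "\<bar>\<Sum>i=1..int J. flux A B i * (X i - X (i + 1))\<bar> \<le> (\<Sum>i=1..int J. \<bar>flux A B i\<bar> * K)"
      by (intro order_trans[OF sum_abs] sum_mono)
    then show ?thesis by (simp add: abs_mult mult_left_mono)
  qed
  also have "\<dots> = (mesh J * (\<Sum>i=1..int J. \<bar>flux A B i\<bar>)) * K"
    by (simp add: sum_distrib_right)
  also have "\<dots> \<le> (6 * (grid_norm J A * grid_norm J B)) * K"
    by (intro mult_right_mono flux_sum_le A B) (simp add: K_def)
  finally show ?thesis by (simp add: K_def mult_ac)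
qed

text \<open>The discrete form of the fact that \<open>V\<^sup>2 * V'\<close> is an exact derivative:
  thanks to the equal weights of the three nodes in \<open>phi\<close>, the product with
  \<open>V\<close> is a difference of the cubic \<open>f\<close>, and its sum over a period
  vanishes.\<close>

lemma ip_psi_self:
  assumes V: "per J V"
  shows "ip J (psi V V) V = 0"
proof -
  define f where "f i = 2 * (V i * V (i - 1) * (V i + V (i - 1)))" for i
  have pf: "per J f" unfolding f_def[abs_def] using V by (intro per_intros)
  have "psi V V i * V i = f (i + 1) - f i" for i
    by (simp add: psi_def f_def algebra_simps)
  then show ?thesis
    using sum_shift_per[OF pf] by (simp add: ip_def sum_subtractf)
qed

section \<open>Energy estimates\<close>

text \<open>The coefficients are free parameters, as the energy arguments use bounds on them and not
  their origin in the radius.\<close>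

definition lin4 :: "real \<Rightarrow> real \<Rightarrow> real \<Rightarrow> real \<Rightarrow> (int \<Rightarrow> real) \<Rightarrow> int \<Rightarrow> real" where
  "lin4 h a c d Z i = a * lap h (lap h Z) i + c * lap h Z i + d * Z i"

lemma Lh_lin4:
  "Lh \<delta> \<alpha> h r = lin4 h (\<delta> / r ^ 4) (1 / r\<^sup>2 * (\<alpha> - 1 + \<delta> / r\<^sup>2)) ((\<alpha> - 1) / r\<^sup>2)"
  by (intro ext) (simp add: Lh_def lin4_def)

lemma lin4_diff: "lin4 h a c d (\<lambda>i. X i - Y i) i = lin4 h a c d X i - lin4 h a c d Y i"
  and lin4_scale: "lin4 h a c d (\<lambda>i. s * X i) i = s * lin4 h a c d X i"
  by (simp_all add: lin4_def lap_diff lap_scale algebra_simps)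

lemma Lh_diff: "Lh \<delta> \<alpha> h r (\<lambda>i. X i - Y i) i = Lh \<delta> \<alpha> h r X i - Lh \<delta> \<alpha> h r Y i"
  and Lh_scale: "Lh \<delta> \<alpha> h r (\<lambda>i. s * X i) i = s * Lh \<delta> \<alpha> h r X i"
  by (simp_all only: Lh_lin4 lin4_diff lin4_scale)

lemma ip_lin4:
  assumes "per J Z" "per J X"
  shows "ip J (lin4 h a c d Z) X = a * ip J (lap h Z) (lap h X) + c * ip J (lap h Z) X + d * ip J Z X"
  unfolding lin4_def[abs_def] ip_bilinear
  using ip_lap[OF per_lap[OF assms(1)] assms(2)] by simp

lemma young: "x * y \<le> e / 2 * x\<^sup>2 + y\<^sup>2 / (2 * e)" if "e > 0" for x y e :: real
proof -
  have "0 \<le> (e * x - y)\<^sup>2 / (2 * e)" using that by simp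
  also have "\<dots> = e / 2 * x\<^sup>2 + y\<^sup>2 / (2 * e) - x * y"
    using that by (simp add: power2_eq_square field_simps)
  finally show ?thesis by simp
qed

text \<open>The step is tested with the midpoint \<open>Z\<close>: the time difference becomes a
  difference of squared norms, the fourth order term becomes the coercive
  \<open>a0 * D\<^sup>2\<close>. In the bound for \<open>F\<close>, \<open>p\<close> collects
  nonlinear terms proportional to \<open>Z\<close>, \<open>q\<close> and \<open>s\<close> the
  sources, and the plain square comes from pairing a residual with \<open>Z\<close>; it accounts for
  the 1 in \<open>L\<close>.\<close>

lemma energy_step:
  fixes J :: nat and X Y :: "int \<Rightarrow> real"
  defines "Z \<equiv> \<lambda>i. (X i + Y i) / 2"
  assumes per: "per J X" "per J Y" and k: "k > 0"
    and eq: "\<And>i. i \<in> {1..int J} \<Longrightarrow> (Y i - X i) / k + lin4 h a c d Z i = F i"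
    and co: "0 < a0" "a0 \<le> a" "\<bar>c\<bar> \<le> C1" "\<bar>d\<bar> \<le> C1"
    and F: "ip J F Z \<le> p * (grid_norm J Z * grid_norm J (lap h Z)) + (grid_norm J Z)\<^sup>2
                 + q * grid_norm J (lap h Z) + s"
    and s: "s \<ge> 0" and p: "p \<ge> 0"
    and L: "L = (p + C1)\<^sup>2 / (2 * a0) + C1 + 1" and kL: "k * L \<le> 1 / 2"
  shows "(grid_norm J Y)\<^sup>2 \<le> (1 + 4 * k * L) * (grid_norm J X)\<^sup>2 + 2 * k * (q\<^sup>2 / a0 + 2 * s)"
proof -
  define z D where "z = grid_norm J Z" and "D = grid_norm J (lap h Z)"
  have zD: "z \<ge> 0" "D \<ge> 0" by (simp_all add: z_def D_def)
  have C1: "C1 \<ge> 0" using co by linarith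
  have L0: "L \<ge> 0" unfolding L using co C1 by simp
  have pZ: "per J Z" unfolding Z_def using per by (intro per_intros)
  have "ip J (\<lambda>i. (Y i - X i) / k + lin4 h a c d Z i) Z = ip J F Z"
    by (rule ip_cong) (simp_all add: eq)
  then have "ip J F Z = ip J (\<lambda>i. (1 / k) * (Y i - X i) + lin4 h a c d Z i) Z" by simp
  also have "\<dots> = (1 / k) * ip J (\<lambda>i. Y i - X i) Z + ip J (lin4 h a c d Z) Z"
    by (simp only: ip_bilinear)
  also have "ip J (\<lambda>i. Y i - X i) Z = ((grid_norm J Y)\<^sup>2 - (grid_norm J X)\<^sup>2) / 2"
  proof -
    have "ip J (\<lambda>i. Y i - X i) Z = ip J (\<lambda>i. Y i - X i) (\<lambda>i. (1/2) * (X i + Y i))"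
      by (simp add: Z_def)
    also have "\<dots> = ((grid_norm J Y)\<^sup>2 - (grid_norm J X)\<^sup>2) / 2"
      unfolding ip_bilinear ip_self[symmetric] using ip_commute[of J X Y] by (simp add: algebra_simps)
    finally show ?thesis .
  qed
  finally have en: "((grid_norm J Y)\<^sup>2 - (grid_norm J X)\<^sup>2) / (2 * k)
      = ip J F Z - ip J (lin4 h a c d Z) Z" using k by (simp add: field_simps)
  have lin: "ip J (lin4 h a c d Z) Z \<ge> a0 * D\<^sup>2 - C1 * (z * D) - C1 * z\<^sup>2"
  proof -
    have e: "ip J (lin4 h a c d Z) Z = a * D\<^sup>2 + c * ip J (lap h Z) Z + d * z\<^sup>2"
      unfolding ip_lin4[OF pZ pZ] ip_self z_def D_def ..
    have "\<bar>c * ip J (lap h Z) Z\<bar> \<le> C1 * (D * z)"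
      unfolding abs_mult z_def D_def using ip_Cauchy_Schwarz[of J "lap h Z" Z] co
      by (intro mult_mono) auto
    moreover have "\<bar>d * z\<^sup>2\<bar> \<le> C1 * z\<^sup>2" unfolding abs_mult using co by (intro mult_mono) auto
    moreover have "a0 * D\<^sup>2 \<le> a * D\<^sup>2" using co by (intro mult_right_mono) auto
    ultimately show ?thesis unfolding e by (simp add: mult.commute)
  qed
  \<comment> \<open>The coercive term is spent in two halves: one absorbs the products of
    \<open>z\<close> and \<open>D\<close>, the other the source \<open>q * D\<close>.\<close>
  have y1: "D * ((p + C1) * z) \<le> a0 / 2 * D\<^sup>2 + ((p + C1) * z)\<^sup>2 / (2 * a0)" by (rule young) (rule co)
  have y2: "D * q \<le> a0 / 2 * D\<^sup>2 + q\<^sup>2 / (2 * a0)" by (rule young) (rule co)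
  have z2: "2 * z\<^sup>2 \<le> (grid_norm J X)\<^sup>2 + (grid_norm J Y)\<^sup>2"
  proof -
    have "z = grid_norm J (\<lambda>i. (1/2) * (X i + Y i))" by (simp add: z_def Z_def)
    also have "\<dots> \<le> (grid_norm J X + grid_norm J Y) / 2"
      unfolding grid_norm_scale using grid_norm_triangle[of J X Y] by simp
    finally have "z\<^sup>2 \<le> ((grid_norm J X + grid_norm J Y) / 2)\<^sup>2" using zD by (intro power_mono)
    also have "\<dots> \<le> ((grid_norm J X)\<^sup>2 + (grid_norm J Y)\<^sup>2) / 2"
      using zero_le_power2[of "grid_norm J X - grid_norm J Y"]
      by (simp add: power2_eq_square field_simps)
    finally show ?thesis by simp
  qed
  have "((grid_norm J Y)\<^sup>2 - (grid_norm J X)\<^sup>2) / (2 * k) \<le> L * z\<^sup>2 + q\<^sup>2 / (2 * a0) + s"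
  proof -
    have "L * z\<^sup>2 = ((p + C1) * z)\<^sup>2 / (2 * a0) + C1 * z\<^sup>2 + z\<^sup>2"
      unfolding L power_mult_distrib by (simp add: distrib_right)
    moreover have "D * ((p + C1) * z) = p * (z * D) + C1 * (z * D)" by (simp add: algebra_simps)
    ultimately show ?thesis
      using en lin F[folded z_def D_def] y1 y2 by (simp only: mult.commute[of D q])
  qed
  then have "(grid_norm J Y)\<^sup>2 - (grid_norm J X)\<^sup>2 \<le> (L * z\<^sup>2 + q\<^sup>2 / (2 * a0) + s) * (2 * k)"
    using k by (simp add: pos_divide_le_eq)
  also have "\<dots> = k * L * (2 * z\<^sup>2) + k * (q\<^sup>2 / a0 + 2 * s)" by (simp add: field_simps)
  also have "\<dots> \<le> k * L * ((grid_norm J X)\<^sup>2 + (grid_norm J Y)\<^sup>2) + k * (q\<^sup>2 / a0 + 2 * s)"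
    using z2 k L0 by (intro add_right_mono mult_left_mono) auto
  finally have main: "(1 - k * L) * (grid_norm J Y)\<^sup>2
      \<le> (1 + k * L) * (grid_norm J X)\<^sup>2 + k * (q\<^sup>2 / a0 + 2 * s)"
    by (simp add: algebra_simps)
  have kL0: "0 \<le> k * L" using k L0 by simp
  have S0: "0 \<le> q\<^sup>2 / a0 + 2 * s" using s co by simp
  have "(1 - k * L) * (grid_norm J Y)\<^sup>2
      \<le> (1 - k * L) * ((1 + 4 * (k * L)) * (grid_norm J X)\<^sup>2 + 2 * (k * (q\<^sup>2 / a0 + 2 * s)))"
  proof -
    \<comment> \<open>With \<open>x = k * L\<close>,
      \<open>(1 - x) * (1 + 4 * x) - (1 + x) = 2 * x - 4 * x\<^sup>2\<close>, which is nonnegative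
      exactly because \<open>x\<close> lies in \<open>[0, 1/2]\<close>. This makes the implicit
      estimate explicit.\<close>
    have "2 * (k * L) * (k * L) \<le> 1 * (k * L)" using kL0 kL by (intro mult_right_mono) auto
    then have "1 + k * L \<le> (1 - k * L) * (1 + 4 * (k * L))"
      by (simp add: algebra_simps)
    then have "(1 + k * L) * (grid_norm J X)\<^sup>2 \<le> (1 - k * L) * (1 + 4 * (k * L)) * (grid_norm J X)\<^sup>2"
      by (rule mult_right_mono) simp
    moreover have "1 * (k * (q\<^sup>2 / a0 + 2 * s)) \<le> (1 - k * L) * 2 * (k * (q\<^sup>2 / a0 + 2 * s))"
      using kL k S0 by (intro mult_right_mono) auto
    moreover have e: "u * (v * x + 2 * w) = u * v * x + u * 2 * w" for u v x w :: real
      by (simp add: algebra_simps)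
    ultimately show ?thesis using main unfolding e by linarith
  qed
  then show ?thesis using kL by (simp add: mult.assoc)
qed

text \<open>Here the test sequence is the difference quotient \<open>G\<close> itself. Mesh widths
  of at least \<open>h0\<close> bound each Laplacian by the factor \<open>m\<close>, so every term
  on the right carries one norm of \<open>G\<close>, which can be cancelled.\<close>

lemma increment_le:
  fixes J :: nat and X Y :: "int \<Rightarrow> real"
  defines "Z \<equiv> \<lambda>i. (X i + Y i) / 2"
  assumes per: "per J X" "per J Y" and k: "k > 0" and h: "0 < h0" "h0 \<le> h"
    and eq: "\<And>i. i \<in> {1..int J} \<Longrightarrow> (Y i - X i) / k + lin4 h a c d Z i = F i"
    and co: "\<bar>a\<bar> \<le> a1" "\<bar>c\<bar> \<le> C1" "\<bar>d\<bar> \<le> C1"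
    and F: "\<And>G. per J G \<Longrightarrow> ip J F G \<le> q * grid_norm J (lap h G)" and q: "q \<ge> 0"
    and m: "m = 4 / h0\<^sup>2"
  shows "grid_norm J (\<lambda>i. Y i - X i) \<le> k * ((a1 * m\<^sup>2 + C1 * m + C1) * grid_norm J Z + q * m)"
proof -
  define G where "G i = (1 / k) * (Y i - X i)" for i
  define g where "g = grid_norm J G"
  have pG: "per J G" unfolding G_def[abs_def] using per by (intro per_intros)
  have pZ: "per J Z" unfolding Z_def using per by (intro per_intros)
  have g0: "g \<ge> 0" by (simp add: g_def)
  have m0: "m > 0" using h m by simp
  have lap: "grid_norm J (lap h X) \<le> m * grid_norm J X" if "per J X" for X
  proof -
    have "4 / h\<^sup>2 \<le> m" unfolding m using h by (intro divide_left_mono) auto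
    then show ?thesis
      using grid_norm_lap_le[OF that, of h] mult_right_mono[of "4 / h\<^sup>2" m "grid_norm J X"] by simp
  qed
  have "ip J (\<lambda>i. G i + lin4 h a c d Z i) G = ip J F G"
    by (rule ip_cong) (use eq in \<open>simp_all add: G_def\<close>)
  then have "g\<^sup>2 = ip J F G - (a * ip J (lap h Z) (lap h G) + c * ip J (lap h Z) G + d * ip J Z G)"
    unfolding ip_bilinear ip_self ip_lin4[OF pZ pG] g_def by simp
  also have "\<dots> \<le> q * (m * g) + a1 * ((m * grid_norm J Z) * (m * g))
      + C1 * ((m * grid_norm J Z) * g) + C1 * (grid_norm J Z * g)"
  proof -
    have bd: "\<bar>x * ip J A B\<bar> \<le> y * (\<alpha> * \<beta>)"
      if "\<bar>x\<bar> \<le> y" "grid_norm J A \<le> \<alpha>" "grid_norm J B \<le> \<beta>" for x y A B \<alpha> \<beta>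
      unfolding abs_mult
      by (rule mult_mono[OF that(1) order_trans[OF ip_Cauchy_Schwarz]])
        (use that in \<open>auto intro!: mult_mono order_trans[OF grid_norm_nonneg that(2)]\<close>)
    have "ip J F G \<le> q * (m * g)"
      using F[OF pG] mult_left_mono[OF lap[OF pG] q] by (simp add: g_def)
    moreover have "\<bar>a * ip J (lap h Z) (lap h G)\<bar> \<le> a1 * ((m * grid_norm J Z) * (m * g))"
      unfolding g_def by (intro bd co lap pZ pG)
    moreover have "\<bar>c * ip J (lap h Z) G\<bar> \<le> C1 * ((m * grid_norm J Z) * g)"
      unfolding g_def by (intro bd co lap pZ pG order_refl)
    moreover have "\<bar>d * ip J Z G\<bar> \<le> C1 * (grid_norm J Z * g)"
      unfolding g_def by (intro bd co order_refl)
    ultimately show ?thesis by linarith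
  qed
  also have "\<dots> = ((a1 * m\<^sup>2 + C1 * m + C1) * grid_norm J Z + q * m) * g"
    by (simp add: power2_eq_square algebra_simps)
  finally have g: "g * g \<le> ((a1 * m\<^sup>2 + C1 * m + C1) * grid_norm J Z + q * m) * g"
    by (simp add: power2_eq_square)
  have "g \<le> (a1 * m\<^sup>2 + C1 * m + C1) * grid_norm J Z + q * m"
  proof (cases "g = 0")
    case True
    then show ?thesis using q m0 co by (auto intro!: add_nonneg_nonneg mult_nonneg_nonneg)
  next
    case False
    then show ?thesis using g g0 by simp
  qed
  moreover have "grid_norm J (\<lambda>i. Y i - X i) = k * g"
    using k grid_norm_scale[of J "1 / k" "\<lambda>i. Y i - X i"] by (simp add: g_def G_def[abs_def])
  ultimately show ?thesis using k by simp
qed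

text \<open>The full power multiplies the accumulated sources as well. This is slightly wasteful,
  but gives a closed majorant that is monotone in \<open>n\<close>, as needed when one bound must
  cover two consecutive time levels.\<close>

lemma gronwall_step:
  fixes x y A :: real
  assumes "x \<ge> 0" "y \<ge> 0" "A \<ge> 0"
  defines "\<beta> \<equiv> \<lambda>n. (1 + x) ^ n * (A + real n * y)"
  shows "(1 + x) * \<beta> n + y \<le> \<beta> (Suc n)" and "\<beta> n \<le> \<beta> (Suc n)"
    and "\<beta> n \<le> exp (real n * x) * (A + real n * y)"
proof -
  have "1 * y \<le> (1 + x) ^ Suc n * y" using assms by (intro mult_right_mono one_le_power) auto
  then show 1: "(1 + x) * \<beta> n + y \<le> \<beta> (Suc n)" by (simp add: \<beta>_def algebra_simps)
  have "0 \<le> x * \<beta> n" using assms by simp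
  with 1 \<open>y \<ge> 0\<close> show "\<beta> n \<le> \<beta> (Suc n)" by (simp only: distrib_right)
  have "(1 + x) ^ n \<le> exp x ^ n" using assms by (intro power_mono exp_ge_add_one_self) auto
  then show "\<beta> n \<le> exp (real n * x) * (A + real n * y)"
    unfolding \<beta>_def using assms by (intro mult_right_mono) (auto simp: exp_of_nat_mult)
qed

section \<open>One time step with the radius frozen at a value in \<open>[r0, r1]\<close>\<close>

locale radius_bounds =
  fixes \<delta> \<alpha> v\<^sub>c r0 r1 :: real
  assumes \<delta>: "\<delta> > 0" and r0: "0 < r0" and r1: "r0 \<le> r1"
begin

definition "a0 = \<delta> / r1 ^ 4"
definition "a1 = \<delta> / r0 ^ 4"
definition "C1 = (\<bar>\<alpha> - 1\<bar> + \<delta> / r0\<^sup>2) / r0\<^sup>2"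
text \<open>The constant of \<open>ip_psi_le\<close> times the prefactor in \<open>Q\<close>: the
  mesh width cancels and \<open>6 / 24\<close> leaves \<open>1 / 4\<close>.\<close>

definition "b = \<bar>v\<^sub>c\<bar> * sqrt (2 * pi) / (4 * r0\<^sup>2)"
definition "L p = (p + C1)\<^sup>2 / (2 * a0) + C1 + 1"

definition Q :: "nat \<Rightarrow> real \<Rightarrow> (int \<Rightarrow> real) \<Rightarrow> (int \<Rightarrow> real) \<Rightarrow> int \<Rightarrow> real" where
  "Q J r A B i = v\<^sub>c / (24 * mesh J * r\<^sup>2) * psi A B i"

text \<open>Because \<open>psi (X + Y) (X + Y)\<close> is eight times \<open>phi\<close> of the half
  sum, this is the Crank-Nicolson nonlinearity at the midpoint of \<open>X\<close> and
  \<open>Y\<close>.\<close>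

abbreviation QQ :: "nat \<Rightarrow> real \<Rightarrow> (int \<Rightarrow> real) \<Rightarrow> (int \<Rightarrow> real) \<Rightarrow> int \<Rightarrow> real" where
  "QQ J r X Y i \<equiv> Q J r (\<lambda>i. X i + Y i) (\<lambda>i. X i + Y i) i / 2"

text \<open>The equation is imposed on one period only: norms and inner products see nothing else,
  so a defect \<open>F\<close> can be used without proving that it is periodic.\<close>

definition step :: "nat \<Rightarrow> real \<Rightarrow> real \<Rightarrow> (int \<Rightarrow> real) \<Rightarrow> (int \<Rightarrow> real) \<Rightarrow> (int \<Rightarrow> real) \<Rightarrow> bool" where
  "step J k r X Y F \<longleftrightarrow> (\<forall>i\<in>{1..int J}.
     (Y i - X i) / k + Lh \<delta> \<alpha> (mesh J) r (\<lambda>i. (X i + Y i) / 2) i = F i)"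

lemma a0_pos: "a0 > 0" and b_nonneg: "b \<ge> 0" and C1_nonneg: "C1 \<ge> 0"
  using \<delta> r0 r1 by (simp_all add: a0_def b_def C1_def)

lemma L_ge1: "L p \<ge> 1"
  using a0_pos C1_nonneg by (simp add: L_def)

lemma coeffs:
  assumes "r \<in> {r0..r1}"
  shows "a0 \<le> \<delta> / r ^ 4" "\<bar>\<delta> / r ^ 4\<bar> \<le> a1" "\<bar>1 / r\<^sup>2 * (\<alpha> - 1 + \<delta> / r\<^sup>2)\<bar> \<le> C1"
    "\<bar>(\<alpha> - 1) / r\<^sup>2\<bar> \<le> C1"
proof -
  have r: "0 < r" "r0 \<le> r" "r \<le> r1" using assms r0 by auto
  show "a0 \<le> \<delta> / r ^ 4" unfolding a0_def using r \<delta> r0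
    by (intro divide_left_mono power_mono) auto
  show "\<bar>\<delta> / r ^ 4\<bar> \<le> a1" unfolding a1_def using r \<delta> r0
    by (auto intro!: divide_left_mono power_mono)
  have dr: "\<bar>\<delta> / r\<^sup>2\<bar> \<le> \<delta> / r0\<^sup>2" using r \<delta> r0 by (auto intro!: divide_left_mono power_mono)
  have ir: "\<bar>1 / r\<^sup>2\<bar> \<le> 1 / r0\<^sup>2" using r r0 by (auto intro!: divide_left_mono power_mono)
  have d0: "\<delta> / r0\<^sup>2 \<ge> 0" using \<delta> by simp
  have "\<bar>1 / r\<^sup>2 * (\<alpha> - 1 + \<delta> / r\<^sup>2)\<bar> \<le> 1 / r0\<^sup>2 * (\<bar>\<alpha> - 1\<bar> + \<delta> / r0\<^sup>2)"
    unfolding abs_mult using dr ir d0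
    by (intro mult_mono order_trans[OF abs_triangle_ineq] add_mono) auto
  then show "\<bar>1 / r\<^sup>2 * (\<alpha> - 1 + \<delta> / r\<^sup>2)\<bar> \<le> C1" by (simp add: C1_def)
  have "\<bar>1 / r\<^sup>2 * (\<alpha> - 1)\<bar> \<le> 1 / r0\<^sup>2 * (\<bar>\<alpha> - 1\<bar> + \<delta> / r0\<^sup>2)"
    unfolding abs_mult using dr ir d0 by (intro mult_mono) auto
  then show "\<bar>(\<alpha> - 1) / r\<^sup>2\<bar> \<le> C1" by (simp add: C1_def)
qed

lemma ip_Q_self: "per J V \<Longrightarrow> ip J (Q J r V V) V = 0"
  unfolding Q_def[abs_def] ip_scale_left by (simp add: ip_psi_self)

lemma ip_Q_le:
  assumes "per J A" "per J B" "per J X" and J: "J \<ge> 1" and r: "r \<in> {r0..r1}"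
  shows "\<bar>ip J (Q J r A B) X\<bar> \<le> b * (grid_norm J A * grid_norm J B * grid_norm J (lap (mesh J) X))"
proof -
  have h: "mesh J > 0" using J by (rule mesh_pos)
  let ?n = "grid_norm J A * grid_norm J B * grid_norm J (lap (mesh J) X)"
  have "\<bar>ip J (Q J r A B) X\<bar> = \<bar>v\<^sub>c\<bar> / (24 * mesh J * r\<^sup>2) * \<bar>ip J (psi A B) X\<bar>"
    unfolding Q_def[abs_def] ip_scale_left abs_mult using h r r0 by (simp add: abs_divide abs_mult)
  also have "\<dots> \<le> \<bar>v\<^sub>c\<bar> / (24 * mesh J * r0\<^sup>2) * (6 * sqrt (2 * pi) * mesh J * ?n)"
    using r r0 h
    by (intro mult_mono ip_psi_le assms divide_left_mono power_mono) auto
  also have "\<dots> = b * ?n" using h r0 by (simp add: b_def field_simps)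
  finally show ?thesis .
qed

lemma step_energy:
  fixes X Y :: "int \<Rightarrow> real"
  defines "Z \<equiv> \<lambda>i. (X i + Y i) / 2"
  assumes "per J X" "per J Y" "k > 0" and r: "r \<in> {r0..r1}" and st: "step J k r X Y F"
    and "ip J F Z \<le> p * (grid_norm J Z * grid_norm J (lap (mesh J) Z)) + (grid_norm J Z)\<^sup>2
                 + q * grid_norm J (lap (mesh J) Z) + s"
    and "s \<ge> 0" "p \<ge> 0" and "k * L p \<le> 1 / 2"
  shows "(grid_norm J Y)\<^sup>2 \<le> (1 + 4 * k * L p) * (grid_norm J X)\<^sup>2 + 2 * k * (q\<^sup>2 / a0 + 2 * s)"
proof (rule energy_step[where F = F and h = "mesh J" and ?C1.0 = C1 and p = p])
  show "(Y i - X i) / k + lin4 (mesh J) (\<delta> / r ^ 4) (1 / r\<^sup>2 * (\<alpha> - 1 + \<delta> / r\<^sup>2)) ((\<alpha> - 1) / r\<^sup>2)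
      (\<lambda>i. (X i + Y i) / 2) i = F i" if "i \<in> {1..int J}" for i
    using st that by (simp add: step_def Lh_lin4)
qed (use assms coeffs[OF r] a0_pos in \<open>simp_all add: L_def\<close>)

lemma step_increment:
  assumes "per J X" "per J Y" "k > 0" "0 < h0" "h0 \<le> mesh J" and r: "r \<in> {r0..r1}"
    and st: "step J k r X Y F"
    and "\<And>G. per J G \<Longrightarrow> ip J F G \<le> q * grid_norm J (lap (mesh J) G)" "q \<ge> 0"
    and "m = 4 / h0\<^sup>2"
  shows "grid_norm J (\<lambda>i. Y i - X i)
    \<le> k * ((a1 * m\<^sup>2 + C1 * m + C1) * grid_norm J (\<lambda>i. (X i + Y i) / 2) + q * m)"
proof (rule increment_le[where F = F and h = "mesh J" and ?h0.0 = h0])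
  show "(Y i - X i) / k + lin4 (mesh J) (\<delta> / r ^ 4) (1 / r\<^sup>2 * (\<alpha> - 1 + \<delta> / r\<^sup>2)) ((\<alpha> - 1) / r\<^sup>2)
      (\<lambda>i. (X i + Y i) / 2) i = F i" if "i \<in> {1..int J}" for i
    using st that by (simp add: step_def Lh_lin4)
qed (use assms coeffs[OF r] in simp_all)

lemma step_diff:
  assumes "step J k r X Y F" "step J k r X' Y' F'"
  shows "step J k r (\<lambda>i. X i - X' i) (\<lambda>i. Y i - Y' i) (\<lambda>i. F i - F' i)"
proof -
  have e: "(\<lambda>i. (X i - X' i + (Y i - Y' i)) / 2) = (\<lambda>i. (X i + Y i) / 2 - (X' i + Y' i) / 2)"
    by (rule ext) (simp add: field_simps)
  show ?thesis unfolding step_def e Lh_diff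
  proof
    fix i assume i: "i \<in> {1..int J}"
    have "(Y i - Y' i - (X i - X' i)) / k = (Y i - X i) / k - (Y' i - X' i) / k"
      by (simp add: diff_divide_distrib)
    then show "(Y i - Y' i - (X i - X' i)) / k + (Lh \<delta> \<alpha> (mesh J) r (\<lambda>i. (X i + Y i) / 2) i
        - Lh \<delta> \<alpha> (mesh J) r (\<lambda>i. (X' i + Y' i) / 2) i) = F i - F' i"
      using assms i unfolding step_def by force
  qed
qed

end

section \<open>Stability and convergence of the two schemes\<close>

context radius_bounds
begin

lemma grid_norm_half_le: "grid_norm J (\<lambda>i. (X i + Y i) / 2) \<le> (grid_norm J X + grid_norm J Y) / 2"
  using grid_norm_triangle[of J X Y] grid_norm_scale[of J "1/2" "\<lambda>i. X i + Y i"] by simp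

text \<open>Only the exact values \<open>x\<close> and \<open>y\<close> have to be bounded by
  \<open>K\<close>: the computed ones enter through the error, and the part quadratic in it drops
  out of the pairing with \<open>Z\<close>.\<close>

lemma cn_error_step:
  assumes per: "per J X" "per J Y" "per J x" "per J y" and k: "k > 0" and J: "J \<ge> 1"
    and r: "r \<in> {r0..r1}"
    and v: "step J k r x y (\<lambda>i. QQ J r x y i + \<tau> i)"
    and V: "step J k r X Y (\<lambda>i. QQ J r X Y i)"
    and Kv: "grid_norm J x \<le> K" "grid_norm J y \<le> K"
    and \<tau>: "grid_norm J \<tau> \<le> \<rho>"
    and kL: "k * L (4 * b * K) \<le> 1 / 2"
  shows "(grid_norm J (\<lambda>i. y i - Y i))\<^sup>2
    \<le> (1 + 4 * k * L (4 * b * K)) * (grid_norm J (\<lambda>i. x i - X i))\<^sup>2 + k * \<rho>\<^sup>2"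
proof -
  define Z where "Z i = (x i - X i + (y i - Y i)) / 2" for i
  define F where "F i = 2 * Q J r (\<lambda>i. x i + y i) Z i - 2 * Q J r Z Z i + \<tau> i" for i
  have pZ: "per J Z" unfolding Z_def[abs_def] using per by (intro per_intros)
  have ps: "per J (\<lambda>i. x i + y i)" using per by (intro per_intros)
  have K0: "K \<ge> 0" using Kv(1) grid_norm_nonneg order_trans by blast
  \<comment> \<open>With \<open>s = x + y\<close>, the computed sum is \<open>s - 2 * Z\<close>, and
    expanding its square leaves a term linear and a term quadratic in \<open>Z\<close>.\<close>
  have eq: "psi (\<lambda>i. x i + y i) (\<lambda>i. x i + y i) i / 2 - psi (\<lambda>i. X i + Y i) (\<lambda>i. X i + Y i) i / 2
      = 2 * psi (\<lambda>i. x i + y i) Z i - 2 * psi Z Z i" for i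
    by (simp add: psi_def Z_def field_simps)
  have st: "step J k r (\<lambda>i. x i - X i) (\<lambda>i. y i - Y i) F"
  proof -
    have "QQ J r x y i + \<tau> i
        - QQ J r X Y i = F i" for i
      using arg_cong[OF eq[of i], of "\<lambda>a. v\<^sub>c / (24 * mesh J * r\<^sup>2) * a"]
      unfolding F_def Q_def by (simp add: algebra_simps)
    then have "F = (\<lambda>i. QQ J r x y i + \<tau> i
        - QQ J r X Y i)" by (intro ext) simp
    then show ?thesis using step_diff[OF v V] by simp
  qed
  \<comment> \<open>The coefficient \<open>4 * b * K\<close> is twice \<open>b\<close> times the
    bound \<open>2 * K\<close> for \<open>x + y\<close>.\<close>
  have ipF: "ip J F Z \<le> 4 * b * K * (grid_norm J Z * grid_norm J (lap (mesh J) Z))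
      + (grid_norm J Z)\<^sup>2 + 0 * grid_norm J (lap (mesh J) Z) + \<rho>\<^sup>2 / 4"
  proof -
    have "ip J F Z = 2 * ip J (Q J r (\<lambda>i. x i + y i) Z) Z - 2 * ip J (Q J r Z Z) Z + ip J \<tau> Z"
      unfolding F_def[abs_def] ip_bilinear ..
    moreover have "ip J (Q J r Z Z) Z = 0" by (rule ip_Q_self[OF pZ])
    moreover have "ip J (Q J r (\<lambda>i. x i + y i) Z) Z
        \<le> b * (2 * K * grid_norm J Z * grid_norm J (lap (mesh J) Z))"
    proof -
      have "ip J (Q J r (\<lambda>i. x i + y i) Z) Z
        \<le> b * (grid_norm J (\<lambda>i. x i + y i) * grid_norm J Z * grid_norm J (lap (mesh J) Z))"
        using ip_Q_le[OF ps pZ pZ J r] by simp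
      also have "grid_norm J (\<lambda>i. x i + y i) \<le> 2 * K"
        using grid_norm_triangle[of J x y] Kv by simp
      finally show ?thesis using b_nonneg by (simp add: mult_left_mono mult_right_mono)
    qed
    moreover have "ip J \<tau> Z \<le> (grid_norm J Z)\<^sup>2 + \<rho>\<^sup>2 / 4" by (rule ip_le_squares) (rule \<tau>)
    ultimately show ?thesis by simp
  qed
  have "0 \<le> \<rho>\<^sup>2 / 4" "0 \<le> 4 * b * K" using K0 b_nonneg by simp_all
  then have "(grid_norm J (\<lambda>i. y i - Y i))\<^sup>2 \<le> (1 + 4 * k * L (4 * b * K))
      * (grid_norm J (\<lambda>i. x i - X i))\<^sup>2 + 2 * k * (0\<^sup>2 / a0 + 2 * (\<rho>\<^sup>2 / 4))"
    by (rule step_energy[OF per_diff[OF per(3,1)] per_diff[OF per(4,2)] k r st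
        ipF[unfolded Z_def[abs_def]] _ _ kL])
  also have "2 * k * (0\<^sup>2 / a0 + 2 * (\<rho>\<^sup>2 / 4)) = k * \<rho>\<^sup>2" by simp
  finally show ?thesis .
qed

section \<open>The inner iteration within one time step\<close>

definition newton_iterates ::
  "nat \<Rightarrow> real \<Rightarrow> real \<Rightarrow> (int \<Rightarrow> real) \<Rightarrow> (int \<Rightarrow> real) \<Rightarrow> nat \<Rightarrow> (nat \<Rightarrow> int \<Rightarrow> real) \<Rightarrow> bool" where
  "newton_iterates J k r P X m W \<longleftrightarrow>
     W 0 = (\<lambda>i. 2 * X i - P i) \<and> (\<forall>j\<le>m. per J (W j)) \<and>
     (\<forall>j<m. step J k r X (W (Suc j)) (\<lambda>i. Q J r (\<lambda>i. X i + W 0 i) (\<lambda>i. W j i - W 0 i) i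
        + QQ J r X (W 0) i))"

text \<open>Completing the square: with \<open>A = X + W0\<close> and \<open>d = W - W0\<close>, the
  expression is \<open>A * d + A * A / 2 = (A + d) * (A + d) / 2 - d * d / 2\<close> for the form
  \<open>Q\<close>. So one iteration is a Crank-Nicolson step with lagged nonlinearity and a
  remainder quadratic in \<open>d\<close>.\<close>

lemma newton_rhs:
  "Q J r (\<lambda>i. X i + W0 i) (\<lambda>i. W i - W0 i) i + QQ J r X W0 i
   = QQ J r X W i - Q J r (\<lambda>i. W i - W0 i) (\<lambda>i. W i - W0 i) i / 2"
proof -
  have "psi (\<lambda>i. X i + W0 i) (\<lambda>i. W i - W0 i) i + psi (\<lambda>i. X i + W0 i) (\<lambda>i. X i + W0 i) i / 2
   = psi (\<lambda>i. X i + W i) (\<lambda>i. X i + W i) i / 2 - psi (\<lambda>i. W i - W0 i) (\<lambda>i. W i - W0 i) i / 2"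
    by (simp add: psi_def field_simps)
  from arg_cong[OF this, of "\<lambda>a. v\<^sub>c / (24 * mesh J * r\<^sup>2) * a"]
  show ?thesis unfolding Q_def by (simp add: algebra_simps)
qed

text \<open>The extrapolation has norm at most \<open>3 * K\<close>, hence the factors are bounded
  by \<open>4 * K\<close> and \<open>6 * K + 1\<close>; the constant is
  \<open>4 * K * (6 * K + 1)\<close> plus half of \<open>(4 * K)\<^sup>2\<close>.\<close>

lemma newton_rhs_le:
  assumes per: "per J P" "per J X" "per J W" "per J G" and J: "J \<ge> 1" and r: "r \<in> {r0..r1}"
    and K: "grid_norm J P \<le> K" "grid_norm J X \<le> K" "grid_norm J W \<le> 3 * K + 1"
    and W0: "W0 = (\<lambda>i. 2 * X i - P i)"
  shows "ip J (\<lambda>i. Q J r (\<lambda>i. X i + W0 i) (\<lambda>i. W i - W0 i) i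
        + QQ J r X W0 i) G
    \<le> b * (32 * K\<^sup>2 + 4 * K) * grid_norm J (lap (mesh J) G)"
proof -
  define A where "A i = X i + W0 i" for i
  define B where "B i = W i - W0 i" for i
  have K0: "K \<ge> 0" using K(1) grid_norm_nonneg order_trans by blast
  have p0: "per J W0" unfolding W0 using per by (intro per_intros)
  have pA: "per J A" and pB: "per J B" unfolding A_def[abs_def] B_def[abs_def]
    using per p0 by (auto intro: per_intros)
  have nW0: "grid_norm J W0 \<le> 3 * K"
    unfolding W0 using grid_norm_diff[of J "\<lambda>i. 2 * X i" P] K by (simp add: grid_norm_scale)
  have nA: "grid_norm J A \<le> 4 * K"
    unfolding A_def[abs_def] using grid_norm_triangle[of J X W0] K nW0 by simp
  have nB: "grid_norm J B \<le> 6 * K + 1"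
    unfolding B_def[abs_def] using grid_norm_diff[of J W W0] K nW0 by simp
  let ?D = "grid_norm J (lap (mesh J) G)"
  have "ip J (\<lambda>i. Q J r A B i + Q J r A A i / 2) G = ip J (Q J r A B) G + (1/2) * ip J (Q J r A A) G"
    unfolding ip_add_left[symmetric] ip_scale_left[symmetric] by simp
  also have "ip J (Q J r A B) G \<le> b * (4 * K * (6 * K + 1) * ?D)"
    using ip_Q_le[OF pA pB per(4) J r] nA nB K0 b_nonneg
    by (intro order_trans[OF _ mult_left_mono[OF mult_right_mono[OF mult_mono[OF nA nB]]]]) auto
  also have "ip J (Q J r A A) G \<le> b * (4 * K * (4 * K) * ?D)"
    using ip_Q_le[OF pA pA per(4) J r] nA K0 b_nonneg
    by (intro order_trans[OF _ mult_left_mono[OF mult_right_mono[OF mult_mono[OF nA nA]]]]) auto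
  finally show ?thesis unfolding A_def[symmetric] B_def[symmetric]
    by (simp add: algebra_simps power2_eq_square)
qed

text \<open>The bound does not deteriorate with \<open>j\<close>: every iterate restarts from
  \<open>X\<close>, and the previous iterate acts only through a right-hand side whose effect
  carries a factor \<open>k\<close>.\<close>

lemma newton_iterates_bounded:
  assumes it: "newton_iterates J k r P X m W"
    and per: "per J P" "per J X" and J: "J \<ge> 1" and r: "r \<in> {r0..r1}" and k: "k > 0"
    and K: "grid_norm J P \<le> K" "grid_norm J X \<le> K"
    and kL: "k * L 0 \<le> 1 / 4" and kq: "2 * k * (b * (32 * K\<^sup>2 + 4 * K))\<^sup>2 / a0 \<le> 1"
  shows "j \<le> m \<Longrightarrow> grid_norm J (W j) \<le> 3 * K + 1"
proof (induction j)
  case 0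
  then show ?case
    using it grid_norm_diff[of J "\<lambda>i. 2 * X i" P] K by (simp add: newton_iterates_def grid_norm_scale)
next
  case (Suc j)
  have K0: "K \<ge> 0" using K(1) grid_norm_nonneg order_trans by blast
  have W0: "W 0 = (\<lambda>i. 2 * X i - P i)" and pW: "per J (W j)" "per J (W (Suc j))"
    using it Suc by (auto simp: newton_iterates_def)
  let ?F = "\<lambda>i. Q J r (\<lambda>i. X i + W 0 i) (\<lambda>i. W j i - W 0 i) i
        + QQ J r X (W 0) i"
  let ?Z = "\<lambda>i. (X i + W (Suc j) i) / 2"
  let ?q = "b * (32 * K\<^sup>2 + 4 * K)"
  have "step J k r X (W (Suc j)) ?F" using it Suc by (auto simp: newton_iterates_def)
  \<comment> \<open>The whole nonlinearity goes into the source slot \<open>q\<close>, so the growth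
    factor is \<open>L 0\<close> and does not see \<open>K\<close>.\<close>
  moreover have "ip J ?F ?Z \<le> 0 * (grid_norm J ?Z * grid_norm J (lap (mesh J) ?Z))
      + (grid_norm J ?Z)\<^sup>2 + ?q * grid_norm J (lap (mesh J) ?Z) + 0"
    using newton_rhs_le[OF per pW(1) _ J r K _ W0, of ?Z] Suc
      per pW by (simp add: per_intros add_increasing)
  ultimately have "(grid_norm J (W (Suc j)))\<^sup>2
      \<le> (1 + 4 * k * L 0) * (grid_norm J X)\<^sup>2 + 2 * k * (?q\<^sup>2 / a0 + 2 * 0)"
    by (intro step_energy) (use per pW k r kL in auto)
  also have "\<dots> \<le> 2 * K\<^sup>2 + 1"
    using kL kq K L_ge1[of 0] k
    by (intro add_mono mult_mono power_mono) auto
  also have "\<dots> \<le> (3 * K + 1)\<^sup>2" using K0 by (simp add: power2_eq_square algebra_simps)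
  finally show ?case using K0 by (simp add: power2_le_iff_abs_le)
qed

text \<open>The errors of the iterates obey a recursion in which the error of the previous iterate
  is multiplied by \<open>k\<close>. A crude bound of ten times
  \<open>\<beta> + \<rho>\<^sup>2\<close> therefore persists for any number of iterations, and
  feeding it into the recursion once more gives a growth factor \<open>1 + O(k)\<close>.\<close>

lemma newton_error_step:
  assumes it: "newton_iterates J k r P X m W"
    and per: "per J P" "per J X" "per J p" "per J x" "per J y"
    and J: "J \<ge> 1" and r: "r \<in> {r0..r1}" and k: "k > 0"
    and K: "grid_norm J P \<le> K" "grid_norm J X \<le> K" "grid_norm J x \<le> K" "grid_norm J y \<le> K"
    and kL: "k * L 0 \<le> 1 / 4" and kq: "2 * k * (b * (32 * K\<^sup>2 + 4 * K))\<^sup>2 / a0 \<le> 1"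
    and C: "C = 15 * (b * (6 * K + 1) / 2)\<^sup>2 / a0" and kC: "24 * k * C \<le> 1" and k1: "k \<le> 1"
    and v: "step J k r x y (\<lambda>i. QQ J r x y i + \<tau> i)"
    and \<tau>: "grid_norm J \<tau> \<le> \<rho>" and \<rho>2: "grid_norm J (\<lambda>i. y i - 2 * x i + p i) \<le> \<rho>"
    and \<beta>: "(grid_norm J (\<lambda>i. x i - X i))\<^sup>2 \<le> \<beta>" "(grid_norm J (\<lambda>i. p i - P i))\<^sup>2 \<le> \<beta>"
    and m: "m \<ge> 1" and E: "E = 4 * L 0 + 24 * C + 1"
  shows "(grid_norm J (\<lambda>i. y i - W m i))\<^sup>2 \<le> (1 + k * E) * \<beta> + k * E * \<rho>\<^sup>2"
proof -
  have K0: "K \<ge> 0" using K(1) grid_norm_nonneg order_trans by blast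
  have \<beta>0: "\<beta> \<ge> 0" using \<beta>(1) zero_le_power2 order_trans by blast
  have C0: "C \<ge> 0" using a0_pos by (simp add: C)
  have W0: "W 0 = (\<lambda>i. 2 * X i - P i)" using it by (simp add: newton_iterates_def)
  define \<epsilon> where "\<epsilon> j i = y i - W j i" for j i
  define e where "e i = x i - X i" for i
  define e' where "e' i = p i - P i" for i
  have pW: "per J (W j)" if "j \<le> m" for j using it that by (auto simp: newton_iterates_def)
  have nW: "grid_norm J (W j) \<le> 3 * K + 1" if "j \<le> m" for j
    by (rule newton_iterates_bounded[OF it per(1,2) J r k K(1,2) kL kq that])
  have e: "grid_norm J e \<le> sqrt \<beta>" "grid_norm J e' \<le> sqrt \<beta>"
    using \<beta> by (simp_all add: real_le_rsqrt e_def[abs_def] e'_def[abs_def])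
  have bump: "(grid_norm J (\<epsilon> (Suc j)))\<^sup>2
      \<le> (1 + 4 * k * L 0) * \<beta> + 2 * k * (C * ((grid_norm J (\<epsilon> j))\<^sup>2 + 2 * \<beta> + \<rho>\<^sup>2) + \<rho>\<^sup>2 / 2)"
    if j: "Suc j \<le> m" for j
  proof -
    define B where "B i = W j i - W 0 i" for i
    define S where "S i = X i + W j i" for i
    define s where "s i = x i + y i" for i
    define Z where "Z i = (e i + \<epsilon> (Suc j) i) / 2" for i
    define D where "D = grid_norm J (lap (mesh J) Z)"
    define F where "F i = (1/2) * Q J r (\<lambda>i. s i + S i) (\<lambda>i. e i + \<epsilon> j i) i
        + (1/2) * Q J r B B i + \<tau> i" for i
    have ps: "per J (\<lambda>i. s i + S i)" "per J (\<lambda>i. e i + \<epsilon> j i)" "per J B" "per J Z" "per J e"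
        "per J (\<epsilon> (Suc j))"
      unfolding s_def S_def e_def \<epsilon>_def B_def[abs_def] Z_def[abs_def] using per pW j
      by (auto intro!: per_intros)
    have "step J k r X (W (Suc j)) (\<lambda>i. Q J r S S i / 2 - Q J r B B i / 2)"
      using it j unfolding newton_iterates_def newton_rhs S_def[abs_def] B_def[abs_def] by auto
    from step_diff[OF v this]
    have "step J k r e (\<epsilon> (Suc j)) (\<lambda>i. Q J r s s i / 2 + \<tau> i - (Q J r S S i / 2 - Q J r B B i / 2))"
      by (simp add: e_def[abs_def] \<epsilon>_def[abs_def] s_def[abs_def])
    also have "(\<lambda>i. Q J r s s i / 2 + \<tau> i - (Q J r S S i / 2 - Q J r B B i / 2)) = F"
    proof
      fix i
      \<comment> \<open>A difference of squares, with
        \<open>s - S = e + \<epsilon> j\<close>.\<close>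
      have "psi s s i - psi S S i = psi (\<lambda>i. s i + S i) (\<lambda>i. e i + \<epsilon> j i) i"
        by (simp add: psi_def s_def S_def e_def \<epsilon>_def algebra_simps)
      from arg_cong[OF this, of "\<lambda>a. v\<^sub>c / (24 * mesh J * r\<^sup>2) * a"]
      have "Q J r s s i - Q J r S S i = Q J r (\<lambda>i. s i + S i) (\<lambda>i. e i + \<epsilon> j i) i"
        unfolding Q_def by (simp only: right_diff_distrib)
      then show "Q J r s s i / 2 + \<tau> i - (Q J r S S i / 2 - Q J r B B i / 2) = F i"
        unfolding F_def by simp
    qed
    finally have st: "step J k r e (\<epsilon> (Suc j)) F" .
    \<comment> \<open>Adds the two bilinear contributions: \<open>e + \<epsilon> j\<close> has
      coefficients 1 and 1, while \<open>B\<close> brings \<open>\<rho>\<close>, another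
      \<open>\<epsilon> j\<close>, twice \<open>e\<close>, and \<open>e'\<close>.\<close>
    define q where "q = b * (6 * K + 1) / 2 * (2 * grid_norm J (\<epsilon> j) + 3 * grid_norm J e + grid_norm J e' + \<rho>)"
    have nsS: "grid_norm J (\<lambda>i. s i + S i) \<le> 6 * K + 1"
      using grid_norm_triangle[of J s S] grid_norm_triangle[of J x y] grid_norm_triangle[of J X "W j"]
        K nW[of j] j by (simp add: s_def[abs_def] S_def[abs_def])
    have neps: "grid_norm J (\<lambda>i. e i + \<epsilon> j i) \<le> grid_norm J e + grid_norm J (\<epsilon> j)"
      by (rule grid_norm_triangle)
    \<comment> \<open>The square of \<open>B\<close> is bounded asymmetrically: one factor by the
      stability constant here, the other in \<open>nB2\<close> by errors and the second time
      difference, so that the product is linear in small quantities.\<close>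
    have nB1: "grid_norm J B \<le> 6 * K + 1"
      unfolding B_def[abs_def] W0
      using grid_norm_diff[of J "W j" "\<lambda>i. 2 * X i - P i"] grid_norm_diff[of J "\<lambda>i. 2 * X i" P] K
        nW[of j] j by (simp add: grid_norm_scale)
    have nB2: "grid_norm J B \<le> \<rho> + grid_norm J (\<epsilon> j) + 2 * grid_norm J e + grid_norm J e'"
    proof -
      have "B = (\<lambda>i. ((y i - 2 * x i + p i) - \<epsilon> j i) + (2 * e i - e' i))"
        by (rule ext) (simp add: B_def W0 \<epsilon>_def e_def e'_def)
      then have "grid_norm J B \<le> grid_norm J (\<lambda>i. (y i - 2 * x i + p i) - \<epsilon> j i)
          + grid_norm J (\<lambda>i. 2 * e i - e' i)"
        by (simp only: grid_norm_triangle)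
      then show ?thesis
        using grid_norm_diff[of J "\<lambda>i. y i - 2 * x i + p i" "\<epsilon> j"] grid_norm_diff[of J "\<lambda>i. 2 * e i" e'] \<rho>2
        by (simp add: grid_norm_scale)
    qed
    have "ip J F Z \<le> 0 * (grid_norm J Z * D) + (grid_norm J Z)\<^sup>2 + q * D + \<rho>\<^sup>2 / 4"
    proof -
      have "ip J F Z = (1/2) * ip J (Q J r (\<lambda>i. s i + S i) (\<lambda>i. e i + \<epsilon> j i)) Z
          + (1/2) * ip J (Q J r B B) Z + ip J \<tau> Z"
        unfolding F_def[abs_def] ip_bilinear ..
      moreover have "ip J (Q J r (\<lambda>i. s i + S i) (\<lambda>i. e i + \<epsilon> j i)) Z
          \<le> b * ((6 * K + 1) * (grid_norm J e + grid_norm J (\<epsilon> j)) * D)"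
        unfolding D_def using ip_Q_le[OF ps(1,2,4) J r] K0 b_nonneg
        by (intro order_trans[OF _ mult_left_mono[OF mult_right_mono[OF mult_mono[OF nsS neps]]]]) auto
      moreover have "ip J (Q J r B B) Z
          \<le> b * ((6 * K + 1) * (\<rho> + grid_norm J (\<epsilon> j) + 2 * grid_norm J e + grid_norm J e') * D)"
        unfolding D_def using ip_Q_le[OF ps(3,3,4) J r] K0 b_nonneg
        by (intro order_trans[OF _ mult_left_mono[OF mult_right_mono[OF mult_mono[OF nB1 nB2]]]]) auto
      moreover have "ip J \<tau> Z \<le> (grid_norm J Z)\<^sup>2 + \<rho>\<^sup>2 / 4" by (rule ip_le_squares) (rule \<tau>)
      moreover have "q * D = 1/2 * (b * ((6 * K + 1) * (grid_norm J e + grid_norm J (\<epsilon> j)) * D))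
         + 1/2 * (b * ((6 * K + 1) * (\<rho> + grid_norm J (\<epsilon> j) + 2 * grid_norm J e + grid_norm J e') * D))"
        unfolding q_def by (simp add: field_simps)
      ultimately show ?thesis by linarith
    qed
    then have "(grid_norm J (\<epsilon> (Suc j)))\<^sup>2
      \<le> (1 + 4 * k * L 0) * (grid_norm J e)\<^sup>2 + 2 * k * (q\<^sup>2 / a0 + 2 * (\<rho>\<^sup>2 / 4))"
      unfolding Z_def[abs_def] D_def
      by (intro step_energy[OF ps(5,6) k r st]) (use kL in auto)
    also have "(1 + 4 * k * L 0) * (grid_norm J e)\<^sup>2 \<le> (1 + 4 * k * L 0) * \<beta>"
      using \<beta> k L_ge1[of 0] by (intro mult_left_mono) (auto simp: e_def[abs_def])
    also have "q\<^sup>2 / a0 \<le> C * ((grid_norm J (\<epsilon> j))\<^sup>2 + 2 * \<beta> + \<rho>\<^sup>2)"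
    proof -
      \<comment> \<open>Cauchy-Schwarz with the weights 2, 3, 1, 1, whose squares add up to 15; the
        sum of squares below is the remainder in Lagrange's identity.\<close>
      have cs: "(2 * a + 3 * c + d + f)\<^sup>2 \<le> 15 * (a\<^sup>2 + c\<^sup>2 + d\<^sup>2 + f\<^sup>2)" for a c d f :: real
      proof -
        have "15 * (a\<^sup>2 + c\<^sup>2 + d\<^sup>2 + f\<^sup>2) - (2 * a + 3 * c + d + f)\<^sup>2
          = (3 * a - 2 * c)\<^sup>2 + (a - 2 * d)\<^sup>2 + (a - 2 * f)\<^sup>2 + (c - 3 * d)\<^sup>2 + (c - 3 * f)\<^sup>2 + (d - f)\<^sup>2"
          by (simp add: power2_eq_square algebra_simps)
        also have "\<dots> \<ge> 0" by simp
        finally show ?thesis by simp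
      qed
      have "q\<^sup>2 / a0 \<le> (b * (6 * K + 1) / 2)\<^sup>2 * (15 * ((grid_norm J (\<epsilon> j))\<^sup>2 + (grid_norm J e)\<^sup>2
          + (grid_norm J e')\<^sup>2 + \<rho>\<^sup>2)) / a0"
        unfolding q_def power_mult_distrib[of "b * (6 * K + 1) / 2"] using cs a0_pos
        by (intro divide_right_mono mult_left_mono) auto
      also have "\<dots> = C * ((grid_norm J (\<epsilon> j))\<^sup>2 + (grid_norm J e)\<^sup>2 + (grid_norm J e')\<^sup>2 + \<rho>\<^sup>2)"
        by (simp add: C)
      also have "\<dots> \<le> C * ((grid_norm J (\<epsilon> j))\<^sup>2 + 2 * \<beta> + \<rho>\<^sup>2)"
        using \<beta> C0 by (intro mult_left_mono) (auto simp: e_def[abs_def] e'_def[abs_def])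
      finally show ?thesis .
    qed
    finally show ?thesis using k by simp
  qed
  have bnd: "(grid_norm J (\<epsilon> j))\<^sup>2 + 2 * \<beta> + \<rho>\<^sup>2 \<le> 12 * (\<beta> + \<rho>\<^sup>2)"
    if "(grid_norm J (\<epsilon> j))\<^sup>2 \<le> 10 * (\<beta> + \<rho>\<^sup>2)" for j
    using that zero_le_power2[of \<rho>] by argo
  \<comment> \<open>The constant 10 is \<open>1\<^sup>2 + 3\<^sup>2\<close>, from the start:
    \<open>\<epsilon> 0\<close> is a second time difference plus \<open>2 * e - e'\<close>. The
    conditions on \<open>k\<close> then keep later iterates below the same bound.\<close>
  have all: "j \<le> m \<Longrightarrow> (grid_norm J (\<epsilon> j))\<^sup>2 \<le> 10 * (\<beta> + \<rho>\<^sup>2)" for j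
  proof (induction j)
    case 0
    have "\<epsilon> 0 = (\<lambda>i. (y i - 2 * x i + p i) + (2 * e i - e' i))"
      by (rule ext) (simp add: W0 \<epsilon>_def e_def e'_def)
    then have "grid_norm J (\<epsilon> 0) \<le> grid_norm J (\<lambda>i. y i - 2 * x i + p i) + grid_norm J (\<lambda>i. 2 * e i - e' i)"
      by (simp only: grid_norm_triangle)
    also have "\<dots> \<le> \<rho> + 3 * sqrt \<beta>"
      using \<rho>2 grid_norm_diff[of J "\<lambda>i. 2 * e i" e'] e by (simp add: grid_norm_scale)
    finally have "(grid_norm J (\<epsilon> 0))\<^sup>2 \<le> (\<rho> + 3 * sqrt \<beta>)\<^sup>2" by (intro power_mono) auto
    also have "\<dots> \<le> 10 * ((sqrt \<beta>)\<^sup>2 + \<rho>\<^sup>2)"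
    proof -
      have "(a + 3 * c)\<^sup>2 \<le> 10 * (c\<^sup>2 + a\<^sup>2)" for a c :: real
        using zero_le_power2[of "3 * a - c"] unfolding power2_eq_square by (simp add: algebra_simps)
      then show ?thesis .
    qed
    finally show ?case using \<beta>0 by simp
  next
    case (Suc j)
    have "(grid_norm J (\<epsilon> (Suc j)))\<^sup>2
      \<le> (1 + 4 * k * L 0) * \<beta> + 2 * k * (C * ((grid_norm J (\<epsilon> j))\<^sup>2 + 2 * \<beta> + \<rho>\<^sup>2) + \<rho>\<^sup>2 / 2)"
      by (rule bump) (rule Suc)
    also have "\<dots> \<le> (1 + 4 * k * L 0) * \<beta> + 2 * k * (C * (12 * (\<beta> + \<rho>\<^sup>2)) + \<rho>\<^sup>2 / 2)"
      using bnd[of j] Suc k C0 by (intro add_left_mono mult_left_mono add_right_mono) auto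
    also have "\<dots> = \<beta> + 4 * (k * L 0) * \<beta> + (24 * k * C) * (\<beta> + \<rho>\<^sup>2) + k * \<rho>\<^sup>2"
      by (simp add: algebra_simps)
    also have "\<dots> \<le> \<beta> + 1 * \<beta> + 1 * (\<beta> + \<rho>\<^sup>2) + 1 * \<rho>\<^sup>2"
      using kL kC k1 \<beta>0 by (intro add_mono mult_right_mono order_refl) auto
    also have "\<dots> \<le> 10 * (\<beta> + \<rho>\<^sup>2)" using \<beta>0 by simp
    finally show ?case .
  qed
  \<comment> \<open>The existence of a last iteration matters here: the extrapolated start alone
    satisfies only the crude bound.\<close>
  obtain j where j: "m = Suc j" using m by (cases m) auto
  have "(grid_norm J (\<epsilon> m))\<^sup>2
      \<le> (1 + 4 * k * L 0) * \<beta> + 2 * k * (C * ((grid_norm J (\<epsilon> j))\<^sup>2 + 2 * \<beta> + \<rho>\<^sup>2) + \<rho>\<^sup>2 / 2)"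
    unfolding j by (rule bump) (simp add: j)
  also have "\<dots> \<le> (1 + 4 * k * L 0) * \<beta> + 2 * k * (C * (12 * (\<beta> + \<rho>\<^sup>2)) + \<rho>\<^sup>2 / 2)"
    using bnd[OF all[of j]] j k C0 by (intro add_left_mono mult_left_mono add_right_mono) auto
  also have "\<dots> = (1 + k * (4 * L 0 + 24 * C)) * \<beta> + k * (24 * C + 1) * \<rho>\<^sup>2"
    by (simp add: algebra_simps)
  also have "\<dots> \<le> (1 + k * E) * \<beta> + k * E * \<rho>\<^sup>2"
  proof (rule add_mono; rule mult_right_mono)
    show "1 + k * (4 * L 0 + 24 * C) \<le> 1 + k * E" "k * (24 * C + 1) \<le> k * E"
      unfolding E using k L_ge1[of 0] by auto
  qed (use \<beta>0 in auto)
  finally show ?thesis by (simp add: \<epsilon>_def[abs_def])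
qed

text \<open>On a coarse mesh the spatial operators are bounded, so the increments of the scheme are
  \<open>O(k)\<close> and the nonlinear term loses its influence on the energy as \<open>k\<close> tends to zero.
  It is essential that the growth factor does not depend on \<open>K\<close>.\<close>

lemma newton_coarse_step:
  assumes it: "newton_iterates J k r P X m W"
    and per: "per J P" "per J X"
    and J: "J \<ge> 1" and r: "r \<in> {r0..r1}" and k: "k > 0"
    and K: "grid_norm J P \<le> K" "grid_norm J X \<le> K"
    and kL: "k * L 0 \<le> 1 / 4" and kq: "2 * k * (b * (32 * K\<^sup>2 + 4 * K))\<^sup>2 / a0 \<le> 1"
    and h: "0 < h0" "h0 \<le> mesh J" and \<mu>: "\<mu> = 4 / h0\<^sup>2"
    and I: "I = (a1 * \<mu>\<^sup>2 + C1 * \<mu> + C1) * (2 * K + 1) + b * (32 * K\<^sup>2 + 4 * K) * \<mu>"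
    and XP: "grid_norm J (\<lambda>i. X i - P i) \<le> k * I"
    and kI: "2 * (k * I) \<le> 1" and kL2: "k * L (2 * b) \<le> 1 / 2" and m: "m \<ge> 1"
  shows "grid_norm J (\<lambda>i. W m i - X i) \<le> k * I"
    and "(grid_norm J (W m))\<^sup>2 \<le> (1 + 4 * k * L (2 * b)) * (grid_norm J X)\<^sup>2 + 2 * k * (b\<^sup>2 / a0)"
proof -
  have K0: "K \<ge> 0" using K(1) grid_norm_nonneg order_trans by blast
  have W0: "W 0 = (\<lambda>i. 2 * X i - P i)" using it by (simp add: newton_iterates_def)
  have pW: "per J (W j)" if "j \<le> m" for j using it that by (auto simp: newton_iterates_def)
  have nW: "grid_norm J (W j) \<le> 3 * K + 1" if "j \<le> m" for j
    by (rule newton_iterates_bounded[OF it per(1,2) J r k K(1,2) kL kq that])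
  have a1: "a1 \<ge> 0" using \<delta> r0 by (simp add: a1_def)
  have \<mu>0: "\<mu> \<ge> 0" unfolding \<mu> by simp
  have inc: "grid_norm J (\<lambda>i. W j i - X i) \<le> k * I" if "j \<le> m" for j
  proof (cases j)
    case 0
    \<comment> \<open>The extrapolation leaves \<open>X\<close> by exactly \<open>X - P\<close>, so
      the increment of the preceding time step is inherited.\<close>
    then show ?thesis using XP by (simp add: W0)
  next
    case (Suc j')
    let ?F = "\<lambda>i. Q J r (\<lambda>i. X i + W 0 i) (\<lambda>i. W j' i - W 0 i) i
        + QQ J r X (W 0) i"
    have j': "j' \<le> m" "j' < m" using Suc that by auto
    have "step J k r X (W j) ?F" using it j' unfolding newton_iterates_def Suc by blast
    then have "grid_norm J (\<lambda>i. W j i - X i)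
      \<le> k * ((a1 * \<mu>\<^sup>2 + C1 * \<mu> + C1) * grid_norm J (\<lambda>i. (X i + W j i) / 2) + b * (32 * K\<^sup>2 + 4 * K) * \<mu>)"
      using step_increment[OF per(2) pW[OF that] k h r _ newton_rhs_le[OF per pW[OF j'(1)] _ J r K nW[OF j'(1)] W0] _ \<mu>]
        b_nonneg K0 by simp
    also have "\<dots> \<le> k * I"
      unfolding I using k grid_norm_half_le[of J X "W j"] K nW[OF that] K0 a1 C1_nonneg \<mu>0
      by (intro mult_left_mono add_right_mono) auto
    finally show ?thesis .
  qed
  show "grid_norm J (\<lambda>i. W m i - X i) \<le> k * I" using inc by simp
  obtain j where j: "m = Suc j" using m by (cases m) auto
  define g where "g i = W m i - W j i" for i
  define B where "B i = W j i - W 0 i" for i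
  define Z where "Z i = (X i + W m i) / 2" for i
  define D where "D = grid_norm J (lap (mesh J) Z)"
  define \<kappa> where "\<kappa> = 2 * (k * I)"
  have jm: "j \<le> m" using j by simp
  have ng: "grid_norm J g \<le> \<kappa>"
    using grid_norm_diff[of J "\<lambda>i. W m i - X i" "\<lambda>i. W j i - X i"] inc[of m] inc[OF jm]
    by (simp add: g_def[abs_def] \<kappa>_def)
  have nB: "grid_norm J B \<le> \<kappa>"
    using grid_norm_diff[of J "\<lambda>i. W j i - X i" "\<lambda>i. W 0 i - X i"] inc[of 0] inc[OF jm]
    by (simp add: B_def[abs_def] \<kappa>_def)
  have \<kappa>: "0 \<le> \<kappa>" "\<kappa> \<le> 1" using ng grid_norm_nonneg order_trans kI \<kappa>_def by (blast, simp)
  have ps: "per J g" "per J B" "per J Z" "per J (\<lambda>i. 4 * Z i - g i)"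
    unfolding g_def[abs_def] B_def[abs_def] Z_def[abs_def] using per pW[of m] pW[of j] pW[of 0] j
    by (auto intro!: per_intros)
  let ?F = "\<lambda>i. 2 * Q J r Z Z i - (1/2) * Q J r (\<lambda>i. 4 * Z i - g i) g i - (1/2) * Q J r B B i"
  have "step J k r X (W m) (\<lambda>i. QQ J r X (W j) i - Q J r B B i / 2)"
    using it j unfolding newton_iterates_def newton_rhs B_def[abs_def] by auto
  also have "(\<lambda>i. QQ J r X (W j) i - Q J r B B i / 2) = ?F"
  proof
    fix i
    \<comment> \<open>The last iterate defines the midpoint \<open>Z\<close>, so the lagged sum is
      \<open>X + W j = 2 * Z - g\<close>. Its square splits into one of \<open>Z\<close>, which is
      orthogonal to \<open>Z\<close>, and terms containing the small \<open>g\<close>.\<close>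
    have "psi (\<lambda>i. X i + W j i) (\<lambda>i. X i + W j i) i / 2
        = 2 * psi Z Z i - (1/2) * psi (\<lambda>i. 4 * Z i - g i) g i"
      by (simp add: psi_def Z_def g_def field_simps)
    from arg_cong[OF this, of "\<lambda>a. v\<^sub>c / (24 * mesh J * r\<^sup>2) * a"]
    show "QQ J r X (W j) i - Q J r B B i / 2 = ?F i"
      unfolding Q_def by (simp add: algebra_simps)
  qed
  finally have st: "step J k r X (W m) ?F" .
  have "ip J ?F Z \<le> 2 * b * (grid_norm J Z * D) + (grid_norm J Z)\<^sup>2 + b * D + 0"
  proof -
    have "ip J ?F Z = 2 * ip J (Q J r Z Z) Z - (1/2) * ip J (Q J r (\<lambda>i. 4 * Z i - g i) g) Z
        - (1/2) * ip J (Q J r B B) Z"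
      unfolding ip_diff_left ip_scale_left ..
    moreover have "ip J (Q J r Z Z) Z = 0" by (rule ip_Q_self) (rule ps)
    moreover have "\<bar>ip J (Q J r (\<lambda>i. 4 * Z i - g i) g) Z\<bar> \<le> b * ((4 * grid_norm J Z + 1) * 1 * D)"
    proof -
      have "grid_norm J (\<lambda>i. 4 * Z i - g i) \<le> 4 * grid_norm J Z + 1"
        using grid_norm_diff[of J "\<lambda>i. 4 * Z i" g] ng \<kappa> by (simp add: grid_norm_scale)
      then show ?thesis
        unfolding D_def using ng \<kappa> b_nonneg
        by (intro order_trans[OF ip_Q_le[OF ps(4,1,3) J r]] mult_left_mono mult_right_mono mult_mono) auto
    qed
    moreover have "\<bar>ip J (Q J r B B) Z\<bar> \<le> b * (1 * 1 * D)"
      unfolding D_def using nB \<kappa> b_nonneg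
      by (intro order_trans[OF ip_Q_le[OF ps(2,2,3) J r]] mult_left_mono mult_right_mono mult_mono) auto
    \<comment> \<open>Since \<open>g\<close> and \<open>B\<close> have norm at most one, no
      \<open>K\<close> is left in the coefficients \<open>2 * b\<close> and \<open>b\<close>; it
      enters only through the requirement that \<open>k * I\<close> be small.\<close>
    ultimately have "ip J ?F Z \<le> (1/2) * (b * ((4 * grid_norm J Z + 1) * 1 * D)) + (1/2) * (b * (1 * 1 * D))"
      by linarith
    also have "\<dots> = 2 * b * (grid_norm J Z * D) + b * D" by (simp add: algebra_simps)
    finally show ?thesis using zero_le_power2[of "grid_norm J Z"] by linarith
  qed
  then have "(grid_norm J (W m))\<^sup>2
      \<le> (1 + 4 * k * L (2 * b)) * (grid_norm J X)\<^sup>2 + 2 * k * (b\<^sup>2 / a0 + 2 * 0)"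
    unfolding Z_def[abs_def] D_def
    by (intro step_energy[OF per(2) pW[OF order_refl] k r st]) (use kL2 b_nonneg in \<open>auto simp: Z_def[abs_def]\<close>)
  then show "(grid_norm J (W m))\<^sup>2
      \<le> (1 + 4 * k * L (2 * b)) * (grid_norm J X)\<^sup>2 + 2 * k * (b\<^sup>2 / a0)" by simp
qed

end

lemma eventually_mult_le_at_right_0: "d > 0 \<Longrightarrow> \<forall>\<^sub>F k :: real in at_right 0. k * c \<le> d" for c d :: real
proof -
  assume "d > 0"
  moreover have "((\<lambda>k. k * c) \<longlongrightarrow> 0 * c) (at_right 0)" by (intro tendsto_intros)
  ultimately have "\<forall>\<^sub>F k in at_right 0. k * c < d" by (intro order_tendstoD(2)) auto
  then show ?thesis by eventually_elim simp
qed

section \<open>Summation over the time steps\<close>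

context radius_bounds
begin

lemma cn_error:
  assumes J: "J \<ge> 1" and k: "k > 0" and NT: "real N * k \<le> T"
    and r: "\<And>n. n < N \<Longrightarrow> rr n \<in> {r0..r1}"
    and perV: "\<And>n. n \<le> N \<Longrightarrow> per J (V n)"
    and perv: "\<And>n. n \<le> N \<Longrightarrow> per J (v n)"
    and Kv: "\<And>n. n \<le> N \<Longrightarrow> grid_norm J (v n) \<le> K"
    and v: "\<And>n. n < N \<Longrightarrow> step J k (rr n) (v n) (v (Suc n))
        (\<lambda>i. QQ J (rr n) (v n) (v (Suc n)) i + \<tau> n i)"
    and V: "\<And>n. n < N \<Longrightarrow> step J k (rr n) (V n) (V (Suc n))
        (\<lambda>i. QQ J (rr n) (V n) (V (Suc n)) i)"
    and \<tau>: "\<And>n. n < N \<Longrightarrow> grid_norm J (\<tau> n) \<le> \<rho>"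
    and V0: "V 0 = v 0" and kL: "k * L (4 * b * K) \<le> 1 / 2"
  shows "n \<le> N \<Longrightarrow> (grid_norm J (\<lambda>i. v n i - V n i))\<^sup>2 \<le> exp (4 * T * L (4 * b * K)) * T * \<rho>\<^sup>2"
proof -
  assume n: "n \<le> N"
  define x y where "x = 4 * k * L (4 * b * K)" and "y = k * \<rho>\<^sup>2"
  have L0: "L (4 * b * K) \<ge> 0" using L_ge1[of "4 * b * K"] by simp
  have xy: "x \<ge> 0" "y \<ge> 0" using k L0 by (simp_all add: x_def y_def)
  let ?\<beta> = "\<lambda>n. (1 + x) ^ n * (0 + real n * y)"
  have "m \<le> N \<Longrightarrow> (grid_norm J (\<lambda>i. v m i - V m i))\<^sup>2 \<le> ?\<beta> m" for m
  proof (induction m)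
    case 0
    then show ?case using V0 by (simp add: grid_norm_def)
  next
    case (Suc m)
    then have m: "m < N" "m \<le> N" by auto
    have "(grid_norm J (\<lambda>i. v (Suc m) i - V (Suc m) i))\<^sup>2 \<le> (1 + x) * (grid_norm J (\<lambda>i. v m i - V m i))\<^sup>2 + y"
      unfolding x_def y_def
      by (rule cn_error_step[OF perV[OF m(2)] perV[OF Suc.prems] perv[OF m(2)] perv[OF Suc.prems] k J
         r[OF m(1)] v[OF m(1)] V[OF m(1)] Kv[OF m(2)] Kv[OF Suc.prems] \<tau>[OF m(1)] kL])
    also have "\<dots> \<le> (1 + x) * ?\<beta> m + y"
      using Suc.IH[OF m(2)] xy by (intro add_right_mono mult_left_mono) auto
    also have "\<dots> \<le> ?\<beta> (Suc m)" by (rule gronwall_step(1)) (use xy in auto)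
    finally show ?case .
  qed
  from this[OF n] have "(grid_norm J (\<lambda>i. v n i - V n i))\<^sup>2 \<le> ?\<beta> n" .
  also have "\<dots> \<le> exp (real n * x) * (0 + real n * y)" by (rule gronwall_step(3)) (use xy in auto)
  also have "\<dots> \<le> exp (4 * T * L (4 * b * K)) * (T * \<rho>\<^sup>2)"
  proof -
    have nk: "real n * k \<le> T" using n k NT by (meson mult_right_mono of_nat_mono order_trans less_imp_le)
    have "real n * x \<le> 4 * T * L (4 * b * K)"
      using mult_right_mono[OF nk L0] by (simp add: x_def mult_ac)
    moreover have "real n * y \<le> T * \<rho>\<^sup>2"
      using mult_right_mono[OF nk, of "\<rho>\<^sup>2"] by (simp add: y_def mult_ac)
    moreover have "0 \<le> real n * y" using xy by simp
    ultimately show ?thesis by (intro mult_mono) auto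
  qed
  finally show ?thesis by (simp add: mult_ac)
qed

text \<open>The number of iterations is hidden behind an existential quantifier, as all estimates
  are uniform in it.\<close>

definition newton_scheme :: "nat \<Rightarrow> nat \<Rightarrow> real \<Rightarrow> (nat \<Rightarrow> real) \<Rightarrow> (nat \<Rightarrow> int \<Rightarrow> real) \<Rightarrow> bool" where
  "newton_scheme J N k rr V \<longleftrightarrow> (\<forall>n\<le>N. per J (V n)) \<and>
     step J k (rr 0) (V 0) (V 1) (\<lambda>i. 2 * Q J (rr 0) (V 0) (V 0) i) \<and>
     (\<forall>n\<in>{1..<N}. \<exists>m W. 1 \<le> m \<and> newton_iterates J k (rr n) (V (n - 1)) (V n) m W \<and> V (Suc n) = W m)"

text \<open>A bootstrap: the condition on \<open>c\<close> and \<open>\<rho>\<close> keeps the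
  predicted error below one, so the computed solution stays within \<open>K = Kv + 1\<close>, and
  with this bound the next error estimate can be made with constants fixed in advance.\<close>

lemma newton_fine:
  assumes J: "J \<ge> 1" and N: "N \<ge> 1" and k: "k > 0" and NT: "real N * k \<le> T"
    and r: "\<And>n. n < N \<Longrightarrow> rr n \<in> {r0..r1}"
    and V: "newton_scheme J N k rr V"
    and perv: "\<And>n. n \<le> N \<Longrightarrow> per J (v n)"
    and Kv: "\<And>n. n \<le> N \<Longrightarrow> grid_norm J (v n) \<le> Kv" and K: "K = Kv + 1"
    and kL: "k * L 0 \<le> 1 / 4" and kq: "2 * k * (b * (32 * K\<^sup>2 + 4 * K))\<^sup>2 / a0 \<le> 1"
    and C: "C = 15 * (b * (6 * K + 1) / 2)\<^sup>2 / a0" and kC: "24 * k * C \<le> 1" and k1: "k \<le> 1"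
    and v: "\<And>n. n < N \<Longrightarrow> step J k (rr n) (v n) (v (Suc n))
        (\<lambda>i. QQ J (rr n) (v n) (v (Suc n)) i + \<tau> n i)"
    and v0: "step J k (rr 0) (v 0) (v 1) (\<lambda>i. 2 * Q J (rr 0) (v 0) (v 0) i + \<tau>0 i)"
    and \<tau>: "\<And>n. n < N \<Longrightarrow> grid_norm J (\<tau> n) \<le> \<rho>" and \<tau>0: "k * grid_norm J \<tau>0 \<le> \<rho>"
    and \<rho>2: "\<And>n. n \<in> {1..<N} \<Longrightarrow> grid_norm J (\<lambda>i. v (Suc n) i - 2 * v n i + v (n - 1) i) \<le> \<rho>"
    and E: "E = 4 * L 0 + 24 * C + 1" and V0: "V 0 = v 0"
    and c: "c = exp (E * T) * (4 + E * T)" and c\<rho>: "c * \<rho>\<^sup>2 \<le> 1"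
  shows "n \<le> N \<Longrightarrow> (grid_norm J (\<lambda>i. v n i - V n i))\<^sup>2 \<le> c * \<rho>\<^sup>2"
proof -
  assume n: "n \<le> N"
  have C0: "C \<ge> 0" using a0_pos by (simp add: C)
  have E0: "E \<ge> 0" using C0 L_ge1[of 0] by (simp add: E)
  define x y where "x = k * E" and "y = k * E * \<rho>\<^sup>2"
  have xy: "x \<ge> 0" "y \<ge> 0" using k E0 by (simp_all add: x_def y_def)
  let ?\<beta> = "\<lambda>n. (1 + x) ^ n * (4 * \<rho>\<^sup>2 + real n * y)"
  have perV: "per J (V n)" if "n \<le> N" for n using V that by (simp add: newton_scheme_def)
  have \<beta>c: "?\<beta> n \<le> c * \<rho>\<^sup>2" if "n \<le> N" for n
  proof -
    have "?\<beta> n \<le> exp (real n * x) * (4 * \<rho>\<^sup>2 + real n * y)" by (rule gronwall_step(3)) (use xy in auto)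
    also have "\<dots> \<le> exp (E * T) * ((4 + E * T) * \<rho>\<^sup>2)"
    proof -
      have nk: "real n * k \<le> T" using that k NT by (meson mult_right_mono of_nat_mono order_trans less_imp_le)
      have "real n * x \<le> E * T" using mult_left_mono[OF nk E0] by (simp add: x_def mult_ac)
      moreover have "real n * y \<le> E * T * \<rho>\<^sup>2"
        using mult_right_mono[OF mult_left_mono[OF nk E0], of "\<rho>\<^sup>2"] by (simp add: y_def mult_ac)
      moreover have "0 \<le> real n * y" using xy by simp
      ultimately show ?thesis by (intro mult_mono) (auto simp: algebra_simps)
    qed
    finally show ?thesis by (simp add: c mult_ac)
  qed
  have bV: "grid_norm J (V n) \<le> K" if "n \<le> N" "(grid_norm J (\<lambda>i. v n i - V n i))\<^sup>2 \<le> ?\<beta> n" for n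
  proof -
    have "(grid_norm J (\<lambda>i. v n i - V n i))\<^sup>2 \<le> 1\<^sup>2" using that \<beta>c[of n] c\<rho> by simp
    then have "grid_norm J (\<lambda>i. v n i - V n i) \<le> 1" by (rule power2_le_imp_le) simp
    moreover have "V n = (\<lambda>i. v n i - (v n i - V n i))" by simp
    then have "grid_norm J (V n) \<le> grid_norm J (v n) + grid_norm J (\<lambda>i. v n i - V n i)"
      using grid_norm_diff[of J "v n" "\<lambda>i. v n i - V n i"] by simp
    ultimately show ?thesis using Kv[OF that(1)] K by simp
  qed
  have e1: "(grid_norm J (\<lambda>i. v 1 i - V 1 i))\<^sup>2 \<le> ?\<beta> 1"
  proof -
    define e where "e i = v 1 i - V 1 i" for i
    define Z where "Z i = e i / 2" for i
    have e_half: "grid_norm J Z = grid_norm J e / 2"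
      using grid_norm_scale[of J "1/2" e] by (simp add: Z_def[abs_def])
    have V1: "step J k (rr 0) (V 0) (V 1) (\<lambda>i. 2 * Q J (rr 0) (V 0) (V 0) i)"
      using V by (simp add: newton_scheme_def)
    have st: "step J k (rr 0) (\<lambda>i. 0) e \<tau>0"
      using step_diff[OF v0 V1] by (simp add: V0 e_def[abs_def])
    have pe: "per J (\<lambda>i. 0)" "per J e"
      unfolding e_def[abs_def] using perv[of 1] perV[of 1] N by (auto intro: per_diff simp: per_def)
    have Z_eq: "Z = (\<lambda>i. (0 + e i) / 2)" by (simp add: Z_def[abs_def])
    \<comment> \<open>The pairing with the residual is left as a product: as \<open>Z\<close> is
      half the unknown error, one factor cancels and the error is at most \<open>2 * k\<close> times
      the norm of \<open>\<tau>0\<close>. Young's inequality would lose half a power of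
      \<open>k\<close>. The resulting bound \<open>2 * \<rho>\<close> is the origin of the initial
      value \<open>4 * \<rho>\<^sup>2\<close>.\<close>
    have ipZ: "ip J \<tau>0 Z \<le> 0 * (grid_norm J Z * grid_norm J (lap (mesh J) Z))
        + (grid_norm J Z)\<^sup>2 + 0 * grid_norm J (lap (mesh J) Z) + grid_norm J \<tau>0 * grid_norm J Z"
      using ip_Cauchy_Schwarz[of J \<tau>0 Z] by (simp add: add_increasing)
    have "(grid_norm J e)\<^sup>2 \<le> (1 + 4 * k * L 0) * (grid_norm J (\<lambda>i. 0))\<^sup>2
        + 2 * k * (0\<^sup>2 / a0 + 2 * (grid_norm J \<tau>0 * grid_norm J Z))"
      by (rule step_energy[OF pe k r[of 0] st, folded Z_eq, OF _ ipZ]) (use N kL in auto)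
    moreover have "grid_norm J (\<lambda>i. 0) = 0" by (simp add: grid_norm_def)
    ultimately have "grid_norm J e * grid_norm J e \<le> 2 * (k * grid_norm J \<tau>0) * grid_norm J e"
      unfolding e_half by (simp add: power2_eq_square)
    moreover have "2 * (k * grid_norm J \<tau>0) * grid_norm J e \<le> 2 * \<rho> * grid_norm J e"
      using \<tau>0 by (intro mult_right_mono) auto
    ultimately have "grid_norm J e * grid_norm J e \<le> 2 * \<rho> * grid_norm J e" by (rule order_trans)
    moreover have "\<rho> \<ge> 0" using order_trans[OF grid_norm_nonneg \<tau>[of 0]] N by simp
    ultimately have "grid_norm J e \<le> 2 * \<rho>"
      by (cases "grid_norm J e = 0") (auto simp: order_less_le)
    then have "(grid_norm J e)\<^sup>2 \<le> (2 * \<rho>)\<^sup>2" by (intro power_mono) auto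
    also have "\<dots> = 1 * (4 * \<rho>\<^sup>2 + 0)" by (simp add: power_mult_distrib)
    also have "\<dots> \<le> (1 + x) ^ 1 * (4 * \<rho>\<^sup>2 + real 1 * y)"
      using xy by (intro mult_mono add_mono) auto
    finally show ?thesis by (simp add: e_def[abs_def])
  qed
  have e0: "(grid_norm J (\<lambda>i. v 0 i - V 0 i))\<^sup>2 \<le> ?\<beta> 0" using V0 by (simp add: grid_norm_def)
  have mono: "?\<beta> m \<le> ?\<beta> (Suc m)" for m by (rule gronwall_step(2)) (use xy in auto)
  \<comment> \<open>Two consecutive levels are carried because the extrapolation reads both;
    monotonicity of the majorant lets the newer bound serve for the older error.\<close>
  have "Suc m \<le> N \<Longrightarrow> (grid_norm J (\<lambda>i. v m i - V m i))\<^sup>2 \<le> ?\<beta> m \<and>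
      (grid_norm J (\<lambda>i. v (Suc m) i - V (Suc m) i))\<^sup>2 \<le> ?\<beta> (Suc m)" for m
  proof (induction m)
    case 0
    then show ?case using e0 e1 by simp
  next
    case (Suc m)
    then have le: "m \<le> N" "Suc m \<le> N" "Suc m < N" "Suc (Suc m) \<le> N" by auto
    have IH: "(grid_norm J (\<lambda>i. v m i - V m i))\<^sup>2 \<le> ?\<beta> m"
      "(grid_norm J (\<lambda>i. v (Suc m) i - V (Suc m) i))\<^sup>2 \<le> ?\<beta> (Suc m)"
      using Suc.IH le by auto
    obtain l W where lW: "1 \<le> l" "newton_iterates J k (rr (Suc m)) (V m) (V (Suc m)) l W"
      "V (Suc (Suc m)) = W l"
      using V le unfolding newton_scheme_def
      by (metis Suc_le_mono atLeastLessThan_iff diff_Suc_1 le0 One_nat_def)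
    have \<rho>2': "grid_norm J (\<lambda>i. v (Suc (Suc m)) i - 2 * v (Suc m) i + v m i) \<le> \<rho>"
      using \<rho>2[of "Suc m"] le by simp
    have KvK: "grid_norm J (v n) \<le> K" if "n \<le> N" for n using Kv[OF that] K by simp
    have "(grid_norm J (\<lambda>i. v (Suc (Suc m)) i - W l i))\<^sup>2 \<le> (1 + k * E) * ?\<beta> (Suc m) + k * E * \<rho>\<^sup>2"
      by (rule newton_error_step[OF lW(2) perV[OF le(1)] perV[OF le(2)] perv[OF le(1)] perv[OF le(2)]
          perv[OF le(4)] J r[OF le(3)] k bV[OF le(1) IH(1)] bV[OF le(2) IH(2)] KvK[OF le(2)] KvK[OF le(4)]
          kL kq C kC k1 v[OF le(3)] \<tau>[OF le(3)] \<rho>2' IH(2) order_trans[OF IH(1) mono] lW(1) E])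
    also have "\<dots> = (1 + x) * ?\<beta> (Suc m) + y" by (simp only: x_def y_def)
    also have "\<dots> \<le> ?\<beta> (Suc (Suc m))" by (rule gronwall_step(1)) (use xy in auto)
    finally show ?case using IH lW(3) by simp
  qed
  then have "(grid_norm J (\<lambda>i. v n i - V n i))\<^sup>2 \<le> ?\<beta> n"
    using n e0 by (cases n) auto
  then show ?thesis using \<beta>c[OF n] by simp
qed

text \<open>The bound \<open>K\<close> is computed from the initial data, the final time and
  constants free of \<open>K\<close>; only afterwards is \<open>k\<close> required to be small
  relative to it. The increment bound belongs to the induction because it controls how far the next
  extrapolation leaves the current level.\<close>

lemma newton_coarse:
  assumes J: "J \<ge> 1" and N: "N \<ge> 1" and k: "k > 0" and NT: "real N * k \<le> T"
    and r: "\<And>n. n < N \<Longrightarrow> rr n \<in> {r0..r1}"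
    and V: "newton_scheme J N k rr V"
    and V0: "grid_norm J (V 0) \<le> Kv"
    and A0: "A0 = 2 * Kv\<^sup>2 + 8 * (b * Kv\<^sup>2)\<^sup>2 / a0"
    and K: "K = sqrt (exp (4 * T * L (2 * b)) * (A0 + 2 * T * (b\<^sup>2 / a0)))"
    and kL: "k * L 0 \<le> 1 / 4" and kq: "2 * k * (b * (32 * K\<^sup>2 + 4 * K))\<^sup>2 / a0 \<le> 1"
    and h: "0 < h0" "h0 \<le> mesh J" and \<mu>: "\<mu> = 4 / h0\<^sup>2"
    and I: "I = (a1 * \<mu>\<^sup>2 + C1 * \<mu> + C1) * (2 * K + 1) + b * (32 * K\<^sup>2 + 4 * K) * \<mu>"
    and kI: "2 * (k * I) \<le> 1" and kL2: "k * L (2 * b) \<le> 1 / 2" and k1: "k \<le> 1"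
  shows "n \<le> N \<Longrightarrow> grid_norm J (V n) \<le> K"
proof -
  assume n: "n \<le> N"
  have Kv0: "Kv \<ge> 0" using V0 grid_norm_nonneg order_trans by blast
  have A00: "A0 \<ge> 0" using a0_pos by (simp add: A0)
  have L0: "L (2 * b) \<ge> 0" using L_ge1[of "2 * b"] by simp
  have T0: "T \<ge> 0" using NT k by (meson dual_order.trans less_imp_le mult_nonneg_nonneg of_nat_0_le_iff)
  define x y where "x = 4 * k * L (2 * b)" and "y = 2 * k * (b\<^sup>2 / a0)"
  have xy: "x \<ge> 0" "y \<ge> 0" using k L0 a0_pos by (simp_all add: x_def y_def)
  let ?\<beta> = "\<lambda>n. (1 + x) ^ n * (A0 + real n * y)"
  have perV: "per J (V n)" if "n \<le> N" for n using V that by (simp add: newton_scheme_def)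
  have K0: "K \<ge> 0" unfolding K using A00 T0 a0_pos by simp
  have K2: "K\<^sup>2 = exp (4 * T * L (2 * b)) * (A0 + 2 * T * (b\<^sup>2 / a0))"
    unfolding K using A00 T0 a0_pos by simp
  have \<beta>K: "?\<beta> n \<le> K\<^sup>2" if "n \<le> N" for n
  proof -
    have "?\<beta> n \<le> exp (real n * x) * (A0 + real n * y)" by (rule gronwall_step(3)) (use xy A00 in auto)
    also have "\<dots> \<le> exp (4 * T * L (2 * b)) * (A0 + 2 * T * (b\<^sup>2 / a0))"
    proof -
      have nk: "real n * k \<le> T" using that k NT by (meson mult_right_mono of_nat_mono order_trans less_imp_le)
      have "real n * x \<le> 4 * T * L (2 * b)" using mult_right_mono[OF nk L0] by (simp add: x_def mult_ac)
      moreover have "real n * y \<le> 2 * T * (b\<^sup>2 / a0)"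
        using mult_right_mono[OF nk, of "2 * (b\<^sup>2 / a0)"] a0_pos by (simp add: y_def mult_ac)
      moreover have "0 \<le> real n * y" using xy by simp
      ultimately show ?thesis by (intro mult_mono[OF _ add_left_mono]) (use A00 in auto)
    qed
    finally show ?thesis using K2 by simp
  qed
  have bV: "grid_norm J (V n) \<le> K" if "n \<le> N" "(grid_norm J (V n))\<^sup>2 \<le> ?\<beta> n" for n
    using that \<beta>K[of n] K0 by (meson order_trans power2_le_imp_le)
  have V0A: "(grid_norm J (V 0))\<^sup>2 \<le> Kv\<^sup>2" using V0 by (intro power_mono) auto
  have b0: "(grid_norm J (V 0))\<^sup>2 \<le> ?\<beta> 0"
    using V0A a0_pos by (simp add: A0 add_increasing2 order_trans[OF V0A])
  have st: "step J k (rr 0) (V 0) (V 1) (\<lambda>i. 2 * Q J (rr 0) (V 0) (V 0) i)"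
    using V by (simp add: newton_scheme_def)
  have r00: "rr 0 \<in> {r0..r1}" using r N by auto
  have p01: "per J (V 0)" "per J (V 1)" using perV N by auto
  have F: "ip J (\<lambda>i. 2 * Q J (rr 0) (V 0) (V 0) i) G \<le> 2 * (b * Kv\<^sup>2) * grid_norm J (lap (mesh J) G)"
    if "per J G" for G
  proof -
    have "ip J (Q J (rr 0) (V 0) (V 0)) G \<le> b * ((Kv * Kv) * grid_norm J (lap (mesh J) G))"
      using ip_Q_le[OF p01(1) p01(1) that J r00] b_nonneg Kv0
      by (intro order_trans[OF _ mult_left_mono[OF mult_right_mono[OF mult_mono[OF V0 V0]]]]) auto
    then show ?thesis unfolding ip_scale_left by (simp add: power2_eq_square)
  qed
  \<comment> \<open>The initial constant \<open>A0\<close> covers the special first step too: its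
    source \<open>q = 2 * b * Kv\<^sup>2\<close> gives the second summand of \<open>A0\<close>, and
    the growth factor is at most 2.\<close>
  have b1: "(grid_norm J (V 1))\<^sup>2 \<le> ?\<beta> 1"
  proof -
    let ?Z = "\<lambda>i. (V 0 i + V 1 i) / 2"
    have "per J ?Z" using p01 by (intro per_intros)
    from F[OF this] have "ip J (\<lambda>i. 2 * Q J (rr 0) (V 0) (V 0) i) ?Z
        \<le> 0 * (grid_norm J ?Z * grid_norm J (lap (mesh J) ?Z)) + (grid_norm J ?Z)\<^sup>2
          + 2 * (b * Kv\<^sup>2) * grid_norm J (lap (mesh J) ?Z) + 0"
      by (simp add: add_increasing)
    from step_energy[OF p01 k r00 st this] kL
    have "(grid_norm J (V 1))\<^sup>2 \<le> (1 + 4 * (k * L 0)) * (grid_norm J (V 0))\<^sup>2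
        + k * (8 * (b * Kv\<^sup>2)\<^sup>2 / a0)" by (simp add: power_mult_distrib mult_ac)
    also have "\<dots> \<le> 2 * Kv\<^sup>2 + 1 * (8 * (b * Kv\<^sup>2)\<^sup>2 / a0)"
      using kL k1 V0A a0_pos by (intro add_mono mult_mono) auto
    also have "\<dots> = 1 * (A0 + 0)" by (simp add: A0)
    also have "\<dots> \<le> (1 + x) ^ 1 * (A0 + real 1 * y)" using xy A00 by (intro mult_mono add_mono) auto
    finally show ?thesis .
  qed
  have KvK: "Kv\<^sup>2 \<le> K\<^sup>2"
  proof -
    have "Kv\<^sup>2 \<le> A0" using a0_pos by (simp add: A0 add_increasing2)
    also have "\<dots> \<le> K\<^sup>2" using \<beta>K[of 0] by simp
    finally show ?thesis .
  qed
  have inc1: "grid_norm J (\<lambda>i. V 1 i - V 0 i) \<le> k * I"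
  proof -
    have a1: "a1 \<ge> 0" using \<delta> r0 by (simp add: a1_def)
    have \<mu>0: "\<mu> \<ge> 0" unfolding \<mu> by simp
    have "grid_norm J (\<lambda>i. V 1 i - V 0 i)
      \<le> k * ((a1 * \<mu>\<^sup>2 + C1 * \<mu> + C1) * grid_norm J (\<lambda>i. (V 0 i + V 1 i) / 2) + 2 * (b * Kv\<^sup>2) * \<mu>)"
      by (rule step_increment[OF p01 k h r00 st F _ \<mu>]) (use b_nonneg in auto)
    also have "\<dots> \<le> k * I"
    proof -
      have "grid_norm J (\<lambda>i. (V 0 i + V 1 i) / 2) \<le> 2 * K + 1"
        using grid_norm_half_le[of J "V 0" "V 1"] bV[OF _ b0] bV[OF _ b1] N K0 by simp
      moreover have "2 * (b * Kv\<^sup>2) \<le> b * (32 * K\<^sup>2 + 4 * K)"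
      proof -
        have "0 \<le> 30 * K\<^sup>2 + 4 * K" using K0 by simp
        then have "2 * Kv\<^sup>2 \<le> 32 * K\<^sup>2 + 4 * K" using KvK by linarith
        then have "b * (2 * Kv\<^sup>2) \<le> b * (32 * K\<^sup>2 + 4 * K)" by (rule mult_left_mono) (rule b_nonneg)
        then show ?thesis by (simp only: mult_ac)
      qed
      ultimately show ?thesis
        unfolding I using k a1 C1_nonneg \<mu>0 by (intro mult_left_mono add_mono mult_right_mono) auto
    qed
    finally show ?thesis .
  qed
  have "Suc m \<le> N \<Longrightarrow> (grid_norm J (V m))\<^sup>2 \<le> ?\<beta> m \<and> (grid_norm J (V (Suc m)))\<^sup>2 \<le> ?\<beta> (Suc m)
      \<and> grid_norm J (\<lambda>i. V (Suc m) i - V m i) \<le> k * I" for m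
  proof (induction m)
    case 0
    then show ?case using b0 b1 inc1 by simp
  next
    case (Suc m)
    then have le: "m \<le> N" "Suc m \<le> N" "Suc m < N" "Suc (Suc m) \<le> N" by auto
    have IH: "(grid_norm J (V m))\<^sup>2 \<le> ?\<beta> m" "(grid_norm J (V (Suc m)))\<^sup>2 \<le> ?\<beta> (Suc m)"
       "grid_norm J (\<lambda>i. V (Suc m) i - V m i) \<le> k * I"
      using Suc.IH le by auto
    obtain l W where lW: "1 \<le> l" "newton_iterates J k (rr (Suc m)) (V m) (V (Suc m)) l W"
      "V (Suc (Suc m)) = W l"
      using V le unfolding newton_scheme_def
      by (metis Suc_le_mono atLeastLessThan_iff diff_Suc_1 le0 One_nat_def)
    note st = newton_coarse_step[OF lW(2) perV[OF le(1)] perV[OF le(2)] J r[OF le(3)] k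
        bV[OF le(1) IH(1)] bV[OF le(2) IH(2)] kL kq h \<mu> I IH(3) kI kL2 lW(1)]
    have "(grid_norm J (W l))\<^sup>2 \<le> (1 + x) * (grid_norm J (V (Suc m)))\<^sup>2 + y"
      using st(2) unfolding x_def y_def .
    also have "\<dots> \<le> (1 + x) * ?\<beta> (Suc m) + y"
      using IH(2) xy by (intro add_right_mono mult_left_mono) auto
    also have "\<dots> \<le> ?\<beta> (Suc (Suc m))" by (rule gronwall_step(1)) (use xy A00 in auto)
    finally show ?case using IH lW(3) st(1) by simp
  qed
  then have "(grid_norm J (V n))\<^sup>2 \<le> ?\<beta> n"
    using n b0 by (cases n) auto
  then show ?thesis by (rule bV[OF n])
qed

text \<open>All that the stability analysis has to know about the exact solution. Newton's method is
  compared with the same Crank-Nicolson residual; it needs in addition the defect of the linear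
  first step, where one order in \<open>k\<close> may be lost, and the accuracy of the
  extrapolation.\<close>

definition consistent ::
  "nat \<Rightarrow> nat \<Rightarrow> real \<Rightarrow> (nat \<Rightarrow> real) \<Rightarrow> (nat \<Rightarrow> int \<Rightarrow> real) \<Rightarrow> real \<Rightarrow> real \<Rightarrow> bool" where
  "consistent J N k rr v K C \<longleftrightarrow>
    (\<forall>n\<le>N. per J (v n) \<and> grid_norm J (v n) \<le> K) \<and>
    (\<forall>n\<in>{..<N}. \<exists>\<tau>. step J k (rr n) (v n) (v (Suc n)) (\<lambda>i. QQ J (rr n) (v n) (v (Suc n)) i + \<tau> i)
       \<and> grid_norm J \<tau> \<le> C * (k\<^sup>2 + (mesh J)\<^sup>2)) \<and>
    (\<exists>\<tau>. step J k (rr 0) (v 0) (v 1) (\<lambda>i. 2 * Q J (rr 0) (v 0) (v 0) i + \<tau> i)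
       \<and> grid_norm J \<tau> \<le> C * (k + (mesh J)\<^sup>2)) \<and>
    (\<forall>n\<in>{1..<N}. grid_norm J (\<lambda>i. v (Suc n) i - 2 * v n i + v (n - 1) i) \<le> C * k\<^sup>2)"

lemma consistent_residuals:
  assumes "consistent J N k rr v K C"
  obtains \<tau> where
    "\<And>n. n < N \<Longrightarrow> step J k (rr n) (v n) (v (Suc n)) (\<lambda>i. QQ J (rr n) (v n) (v (Suc n)) i + \<tau> n i)"
    "\<And>n. n < N \<Longrightarrow> grid_norm J (\<tau> n) \<le> C * (k\<^sup>2 + (mesh J)\<^sup>2)"
proof -
  have "\<forall>n\<in>{..<N}. \<exists>\<tau>. step J k (rr n) (v n) (v (Suc n)) (\<lambda>i. QQ J (rr n) (v n) (v (Suc n)) i + \<tau> i)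
       \<and> grid_norm J \<tau> \<le> C * (k\<^sup>2 + (mesh J)\<^sup>2)"
    using assms unfolding consistent_def by blast
  from bchoice[OF this] that show ?thesis by blast
qed

lemma newton_convergence:
  assumes T: "T > 0" and Kv: "Kv \<ge> 0" and C\<tau>: "C\<tau> > 0"
  shows "\<exists>c\<ge>0. \<exists>k0>0. \<forall>J N k rr V v. J \<ge> 1 \<longrightarrow> N \<ge> 1 \<longrightarrow> 0 < k \<longrightarrow> k \<le> k0 \<longrightarrow> real N * k \<le> T \<longrightarrow>
    (\<forall>n<N. rr n \<in> {r0..r1}) \<longrightarrow> newton_scheme J N k rr V \<longrightarrow> V 0 = v 0 \<longrightarrow>
    consistent J N k rr v Kv C\<tau> \<longrightarrow>
    (\<forall>n\<le>N. grid_norm J (\<lambda>i. v n i - V n i) \<le> c * (k\<^sup>2 + (mesh J)\<^sup>2))"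
proof -
  define K where "K = Kv + 1"
  define C where "C = 15 * (b * (6 * K + 1) / 2)\<^sup>2 / a0"
  define E where "E = 4 * L 0 + 24 * C + 1"
  define c where "c = exp (E * T) * (4 + E * T)"
  have C0: "C \<ge> 0" using a0_pos by (simp add: C_def)
  have E0: "E \<ge> 0" using C0 L_ge1[of 0] by (simp add: E_def)
  have c0: "c > 0" using E0 T by (simp add: c_def add_pos_nonneg)
  \<comment> \<open>If \<open>s = k\<^sup>2 + h\<^sup>2\<close> is at most \<open>d\<close>, the
    error bound \<open>c * (C\<tau> * s)\<^sup>2\<close> is at most one. Half of \<open>d\<close> is
    allotted to the mesh, which defines \<open>h0\<close>, and half to \<open>k\<close>.\<close>
  define d where "d = 1 / (sqrt c * C\<tau>)"
  have d0: "d > 0" using c0 C\<tau> by (simp add: d_def)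
  define h0 where "h0 = sqrt (d / 2)"
  have h0: "h0 > 0" "h0\<^sup>2 = d / 2" using d0 by (simp_all add: h0_def)
  define A0 where "A0 = 2 * Kv\<^sup>2 + 8 * (b * Kv\<^sup>2)\<^sup>2 / a0"
  define K2 where "K2 = sqrt (exp (4 * T * L (2 * b)) * (A0 + 2 * T * (b\<^sup>2 / a0)))"
  define \<mu> where "\<mu> = 4 / h0\<^sup>2"
  define I where "I = (a1 * \<mu>\<^sup>2 + C1 * \<mu> + C1) * (2 * K2 + 1) + b * (32 * K2\<^sup>2 + 4 * K2) * \<mu>"
  have K20: "K2 \<ge> 0" unfolding K2_def A0_def using T a0_pos by simp
  have "\<forall>\<^sub>F k in at_right 0. k * L 0 \<le> 1/4 \<and> k * (2 * (b * (32 * K\<^sup>2 + 4 * K))\<^sup>2 / a0) \<le> 1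
     \<and> k * (24 * C) \<le> 1 \<and> k * 1 \<le> 1 \<and> k * 1 \<le> d / 2 \<and> k * (2 * (b * (32 * K2\<^sup>2 + 4 * K2))\<^sup>2 / a0) \<le> 1
     \<and> k * (2 * I) \<le> 1 \<and> k * L (2 * b) \<le> 1 / 2"
    by (intro eventually_conj eventually_mult_le_at_right_0) (use d0 in auto)
  \<comment> \<open>All smallness conditions for both regimes at once; none of the constants depends
    on \<open>J\<close> or \<open>N\<close>.\<close>
  then obtain k0 where k0: "k0 > 0" and ev: "\<And>k. 0 < k \<Longrightarrow> k < k0 \<Longrightarrow> k * L 0 \<le> 1/4 \<and> k * (2 * (b * (32 * K\<^sup>2 + 4 * K))\<^sup>2 / a0) \<le> 1
     \<and> k * (24 * C) \<le> 1 \<and> k * 1 \<le> 1 \<and> k * 1 \<le> d / 2 \<and> k * (2 * (b * (32 * K2\<^sup>2 + 4 * K2))\<^sup>2 / a0) \<le> 1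
     \<and> k * (2 * I) \<le> 1 \<and> k * L (2 * b) \<le> 1 / 2"
    unfolding eventually_at_right_field by blast
  define c' where "c' = sqrt c * C\<tau> + (K2 + Kv) / h0\<^sup>2"
  have c'0: "c' \<ge> 0" using c0 C\<tau> K20 Kv by (simp add: c'_def)
  show ?thesis
  proof (intro exI conjI allI impI)
    show "c' \<ge> 0" by fact
    \<comment> \<open>The conditions hold for steps strictly below \<open>k0\<close>, hence the
      halving.\<close>
    show "k0 / 2 > 0" using k0 by simp
    fix J N k rr V v n
    assume J: "J \<ge> 1" and N: "N \<ge> 1" and k: "0 < k" and kk: "k \<le> k0 / 2" and NT: "real N * k \<le> T"
      and r: "\<forall>n<N. rr n \<in> {r0..r1}" and V: "newton_scheme J N k rr V" and V0: "V 0 = v 0"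
      and cs: "consistent J N k rr v Kv C\<tau>" and n: "n \<le> N"
    obtain \<tau> where st': "\<And>n. n < N \<Longrightarrow> step J k (rr n) (v n) (v (Suc n)) (\<lambda>i. QQ J (rr n) (v n) (v (Suc n)) i + \<tau> n i)"
      and \<tau>: "\<And>n. n < N \<Longrightarrow> grid_norm J (\<tau> n) \<le> C\<tau> * (k\<^sup>2 + (mesh J)\<^sup>2)"
      using consistent_residuals[OF cs] by blast
    obtain \<tau>0 where st0: "step J k (rr 0) (v 0) (v 1) (\<lambda>i. 2 * Q J (rr 0) (v 0) (v 0) i + \<tau>0 i)"
      and \<tau>0: "grid_norm J \<tau>0 \<le> C\<tau> * (k + (mesh J)\<^sup>2)"
      using cs unfolding consistent_def by blast
    have v: "\<forall>n\<le>N. per J (v n) \<and> grid_norm J (v n) \<le> Kv"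
      and dd: "\<forall>n\<in>{1..<N}. grid_norm J (\<lambda>i. v (Suc n) i - 2 * v n i + v (n - 1) i) \<le> C\<tau> * k\<^sup>2"
      using cs unfolding consistent_def by blast+
    have evk: "k * L 0 \<le> 1/4" "k * (2 * (b * (32 * K\<^sup>2 + 4 * K))\<^sup>2 / a0) \<le> 1"
     "k * (24 * C) \<le> 1" "k * 1 \<le> 1" "k * 1 \<le> d / 2" "k * (2 * (b * (32 * K2\<^sup>2 + 4 * K2))\<^sup>2 / a0) \<le> 1"
     "k * (2 * I) \<le> 1" "k * L (2 * b) \<le> 1 / 2"
      using ev[of k] k kk k0 by auto
    define s where "s = k\<^sup>2 + (mesh J)\<^sup>2"
    have s0: "s \<ge> 0" by (simp add: s_def)
    have r': "rr n \<in> {r0..r1}" if "n < N" for n using r that by blast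
    have pv: "per J (v n)" and kv: "grid_norm J (v n) \<le> Kv" if "n \<le> N" for n
      using v that by blast+
    have vn: "grid_norm J (v n) \<le> Kv" using v n by simp
    show "grid_norm J (\<lambda>i. v n i - V n i) \<le> c' * (k\<^sup>2 + (mesh J)\<^sup>2)"
    proof (cases "mesh J \<le> h0")
      case True
      have "k\<^sup>2 \<le> k" using k evk(4) by (simp add: power2_eq_square mult_left_le)
      moreover have "(mesh J)\<^sup>2 \<le> d / 2" using True h0 by (metis mesh_nonneg power_mono)
      ultimately have sd: "s \<le> d" using evk(5) by (simp add: s_def)
      have "sqrt c * (C\<tau> * s) \<le> 1" using sd c0 C\<tau> by (simp add: d_def field_simps)
      then have "(sqrt c * (C\<tau> * s))\<^sup>2 \<le> 1" using c0 C\<tau> s0 by (simp add: power_le_one)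
      then have c1: "c * (C\<tau> * s)\<^sup>2 \<le> 1" using c0 by (simp add: power_mult_distrib)
      \<comment> \<open>The first residual is of order \<open>k + h\<^sup>2\<close> only, but acts
        over a single step, and \<open>k * (k + h\<^sup>2)\<close> is at most \<open>s\<close> for
        \<open>k\<close> up to 1.\<close>
      have "k * k + k * (mesh J)\<^sup>2 \<le> s"
        using mult_right_mono[of k 1 "(mesh J)\<^sup>2"] evk(4) by (simp add: s_def power2_eq_square)
      then have t0: "k * grid_norm J \<tau>0 \<le> C\<tau> * s"
        using mult_left_mono[OF \<tau>0, of k] k C\<tau> mult_left_mono[of "k * k + k * (mesh J)\<^sup>2" s C\<tau>]
        by (simp add: algebra_simps)
      have "C\<tau> * k\<^sup>2 \<le> C\<tau> * s" using C\<tau> by (simp add: s_def)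
      then have dd': "grid_norm J (\<lambda>i. v (Suc n) i - 2 * v n i + v (n - 1) i) \<le> C\<tau> * s" if "n \<in> {1..<N}" for n
        using dd that by fastforce
      have "2 * k * (b * (32 * K\<^sup>2 + 4 * K))\<^sup>2 / a0 \<le> 1" "24 * k * C \<le> 1" "k \<le> 1"
        using evk(2-4) by (simp_all only: mult_ac times_divide_eq_right mult_1)
      note kk = this
      note \<tau>s = \<tau>[folded s_def]
      have "(grid_norm J (\<lambda>i. v n i - V n i))\<^sup>2 \<le> c * (C\<tau> * s)\<^sup>2"
        by (rule newton_fine[where \<tau> = \<tau> and \<rho> = "C\<tau> * s", OF J N k NT r' V pv kv K_def evk(1)
            kk(1) C_def kk(2,3) st' st0 \<tau>s t0 dd' E_def V0 c_def c1 n])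
      moreover have "c * (C\<tau> * s)\<^sup>2 = (sqrt c * C\<tau> * s)\<^sup>2" using c0 by (simp add: power_mult_distrib)
      moreover have "0 \<le> sqrt c * C\<tau> * s" using c0 C\<tau> s0 by simp
      ultimately have "grid_norm J (\<lambda>i. v n i - V n i) \<le> sqrt c * C\<tau> * s"
        by (simp only: power2_le_imp_le)
      also have "\<dots> \<le> c' * s" using s0 K20 Kv by (intro mult_right_mono) (auto simp: c'_def)
      finally show ?thesis by (simp add: s_def)
    next
      case False
      then have hh: "h0 \<le> mesh J" by simp
      have "grid_norm J (V n) \<le> K2"
      proof (rule newton_coarse[OF J N k NT r' V _ A0_def K2_def evk(1) _ h0(1) hh \<mu>_def I_def _ evk(8) _ n])
        show "grid_norm J (V 0) \<le> Kv" using kv[of 0] V0 by simp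
        show "2 * k * (b * (32 * K2\<^sup>2 + 4 * K2))\<^sup>2 / a0 \<le> 1" "2 * (k * I) \<le> 1" "k \<le> 1"
          using evk(4,6,7) by (simp_all only: mult_ac times_divide_eq_right mult_1)
      qed
      \<comment> \<open>A bounded error is enough here: \<open>s\<close> is at least
        \<open>h0\<^sup>2\<close>, so a constant is at most a fixed multiple of
        \<open>s\<close>.\<close>
      then have "grid_norm J (\<lambda>i. v n i - V n i) \<le> (K2 + Kv) / h0\<^sup>2 * h0\<^sup>2"
        using grid_norm_diff[of J "v n" "V n"] vn h0 by simp
      also have "\<dots> \<le> c' * s"
      proof (rule mult_mono)
        show "(K2 + Kv) / h0\<^sup>2 \<le> c'" using c0 C\<tau> by (simp add: c'_def)
        have "h0\<^sup>2 \<le> (mesh J)\<^sup>2" using hh h0 by (intro power_mono) auto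
        then show "h0\<^sup>2 \<le> s" by (simp add: s_def add_increasing)
      qed (use c'0 in auto)
      finally show ?thesis by (simp add: s_def)
    qed
  qed
qed

end

section \<open>Consistency\<close>

text \<open>Derivatives are taken within \<open>S\<close>, so that the one-sided time derivatives at
  the ends of \<open>[0, T]\<close> are covered. The remainder has \<open>fact n\<close> in the
  denominator, which affects constants only.\<close>

lemma real_Taylor:
  fixes f :: "nat \<Rightarrow> real \<Rightarrow> real"
  assumes "convex S"
    and "\<And>i x. x \<in> S \<Longrightarrow> i \<le> n \<Longrightarrow> (f i has_real_derivative f (Suc i) x) (at x within S)"
    and "\<And>x. x \<in> S \<Longrightarrow> \<bar>f (Suc n) x\<bar> \<le> B" and "w \<in> S" "z \<in> S"
  shows "\<bar>f 0 z - (\<Sum>i\<le>n. f i w * (z - w) ^ i / fact i)\<bar> \<le> B * \<bar>z - w\<bar> ^ Suc n / fact n"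
  using field_Taylor[of S n f B w z] assms by simp

lemma quotient_error:
  fixes d w y e :: real
  assumes "\<bar>d - y * w\<bar> \<le> e * w" "w > 0"
  shows "\<bar>d / w - y\<bar> \<le> e"
proof -
  have "d / w - y = (d - y * w) / w" using assms(2) by (simp add: diff_divide_distrib)
  then have "\<bar>d / w - y\<bar> = \<bar>d - y * w\<bar> / w" using assms(2) by (simp add: abs_divide)
  then show ?thesis using assms by (simp add: pos_divide_le_eq)
qed

section \<open>Difference quotients of a smooth function of one variable\<close>

context
  fixes g :: "nat \<Rightarrow> real \<Rightarrow> real" and S :: "real set" and B h x :: real and n :: nat
  assumes S: "convex S" and g: "\<And>i x. x \<in> S \<Longrightarrow> i \<le> n \<Longrightarrow> (g i has_real_derivative g (Suc i) x) (at x within S)"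
    and B: "\<And>x. x \<in> S \<Longrightarrow> \<bar>g (Suc n) x\<bar> \<le> B" and x: "x \<in> S" and h: "h > 0"
begin

lemma forward_difference_bound:
  assumes "n = 0" "x + h \<in> S"
  shows "\<bar>g 0 (x + h) - g 0 x\<bar> \<le> B * h"
  using real_Taylor[OF S g B x assms(2)] assms h by simp

lemma average_bound:
  assumes n: "n = 1" "x + h \<in> S" "x - h \<in> S"
  shows "\<bar>g 0 (x - h) - 2 * g 0 x + g 0 (x + h)\<bar> \<le> 2 * B * h\<^sup>2"
proof -
  have "\<bar>g 0 (x + h) - (g 0 x + g 1 x * h)\<bar> \<le> B * h\<^sup>2" "\<bar>g 0 (x - h) - (g 0 x - g 1 x * h)\<bar> \<le> B * h\<^sup>2"
    using real_Taylor[OF S g B x n(2)] real_Taylor[OF S g B x n(3)] n h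
    by (simp_all add: numeral_2_eq_2)
  then show ?thesis by linarith
qed

lemma central_difference_bound:
  assumes n: "n = 2" "x + h \<in> S" "x - h \<in> S"
  shows "\<bar>(g 0 (x + h) - g 0 (x - h)) / (2 * h) - g 1 x\<bar> \<le> B * h\<^sup>2 / 2"
proof -
  have "\<bar>g 0 (x + h) - (g 0 x + g 1 x * h + g 2 x * h\<^sup>2 / 2)\<bar> \<le> B * h ^ 3 / 2"
     "\<bar>g 0 (x - h) - (g 0 x - g 1 x * h + g 2 x * h\<^sup>2 / 2)\<bar> \<le> B * h ^ 3 / 2"
    using real_Taylor[OF S g B x n(2)] real_Taylor[OF S g B x n(3)] n h
    by (simp_all add: numeral_2_eq_2 numeral_3_eq_3)
  then have "\<bar>(g 0 (x + h) - g 0 (x - h)) - g 1 x * (2 * h)\<bar> \<le> B * h ^ 3" by linarith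
  also have "\<dots> = B * h\<^sup>2 / 2 * (2 * h)" by (simp add: power2_eq_square power3_eq_cube)
  finally show ?thesis by (rule quotient_error) (use h in simp)
qed

lemma second_difference_bound:
  assumes n: "n = 3" "x + h \<in> S" "x - h \<in> S"
  shows "\<bar>(g 0 (x - h) - 2 * g 0 x + g 0 (x + h)) / h\<^sup>2 - g 2 x\<bar> \<le> B * h\<^sup>2 / 3"
proof -
  have "\<bar>g 0 (x + h) - (g 0 x + g 1 x * h + g 2 x * h\<^sup>2 / 2 + g 3 x * h ^ 3 / 6)\<bar> \<le> B * h ^ 4 / 6"
     "\<bar>g 0 (x - h) - (g 0 x - g 1 x * h + g 2 x * h\<^sup>2 / 2 - g 3 x * h ^ 3 / 6)\<bar> \<le> B * h ^ 4 / 6"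
    using real_Taylor[OF S g B x n(2)] real_Taylor[OF S g B x n(3)] n h
    by (simp_all add: eval_nat_numeral fact_numeral)
  then have "\<bar>(g 0 (x - h) - 2 * g 0 x + g 0 (x + h)) - g 2 x * h\<^sup>2\<bar> \<le> B * h ^ 4 / 3" by linarith
  also have "B * h ^ 4 / 3 = B * h\<^sup>2 / 3 * h\<^sup>2" by (simp add: power2_eq_square power4_eq_xxxx)
  finally show ?thesis by (rule quotient_error) (use h in simp)
qed

lemma fourth_difference_bound:
  assumes n: "n = 5" "x + h \<in> S" "x - h \<in> S" "x + 2 * h \<in> S" "x - 2 * h \<in> S"
  shows "\<bar>(g 0 (x - 2 * h) - 4 * g 0 (x - h) + 6 * g 0 x - 4 * g 0 (x + h) + g 0 (x + 2 * h)) / h ^ 4 - g 4 x\<bar>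
    \<le> 2 * B * h\<^sup>2"
proof -
  let ?d = "g 0 (x - 2 * h) - 4 * g 0 (x - h) + 6 * g 0 x - 4 * g 0 (x + h) + g 0 (x + 2 * h)"
  have B0: "B \<ge> 0" using B[OF x] by simp
  have T: "\<bar>g 0 (x + s) - (g 0 x + g 1 x * s + g 2 x * s\<^sup>2 / 2 + g 3 x * s ^ 3 / 6
      + g 4 x * s ^ 4 / 24 + g 5 x * s ^ 5 / 120)\<bar> \<le> B * \<bar>s\<bar> ^ 6 / 120" if "x + s \<in> S" for s
    using real_Taylor[OF S g B x that] n by (simp add: eval_nat_numeral fact_numeral)
  have sg: "(- h) ^ 3 = - (h ^ 3)" "(- h) ^ 4 = h ^ 4" "(- h) ^ 5 = - (h ^ 5)"
    "(2 * h) ^ 3 = 8 * h ^ 3" "(2 * h) ^ 4 = 16 * h ^ 4" "(2 * h) ^ 5 = 32 * h ^ 5" "(2 * h) ^ 6 = 64 * h ^ 6"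
    "(- (2 * h)) ^ 3 = - (8 * h ^ 3)" "(- (2 * h)) ^ 4 = 16 * h ^ 4" "(- (2 * h)) ^ 5 = - (32 * h ^ 5)"
    "(2 * h)\<^sup>2 = 4 * h\<^sup>2" "(- (2 * h))\<^sup>2 = 4 * h\<^sup>2" "(- h)\<^sup>2 = h\<^sup>2"
    by (simp_all add: power_mult_distrib)
  have "\<bar>g 0 (x + h) - (g 0 x + g 1 x * h + g 2 x * h\<^sup>2 / 2 + g 3 x * h ^ 3 / 6
      + g 4 x * h ^ 4 / 24 + g 5 x * h ^ 5 / 120)\<bar> \<le> B * h ^ 6 / 120"
    using T[of h] n h by simp
  moreover have "\<bar>g 0 (x - h) - (g 0 x - g 1 x * h + g 2 x * h\<^sup>2 / 2 - g 3 x * h ^ 3 / 6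
      + g 4 x * h ^ 4 / 24 - g 5 x * h ^ 5 / 120)\<bar> \<le> B * h ^ 6 / 120"
    using T[of "- h"] n h by (simp add: sg)
  moreover have "\<bar>g 0 (x + 2 * h) - (g 0 x + g 1 x * (2 * h) + g 2 x * (4 * h\<^sup>2) / 2 + g 3 x * (8 * h ^ 3) / 6
      + g 4 x * (16 * h ^ 4) / 24 + g 5 x * (32 * h ^ 5) / 120)\<bar> \<le> B * (64 * h ^ 6) / 120"
    using T[of "2 * h", unfolded sg] n h by (simp add: sg)
  moreover have "\<bar>g 0 (x - 2 * h) - (g 0 x - g 1 x * (2 * h) + g 2 x * (4 * h\<^sup>2) / 2 - g 3 x * (8 * h ^ 3) / 6
      + g 4 x * (16 * h ^ 4) / 24 - g 5 x * (32 * h ^ 5) / 120)\<bar> \<le> B * (64 * h ^ 6) / 120"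
    using T[of "- (2 * h)", unfolded sg] n h by (simp add: sg)
  \<comment> \<open>The remainders add up to \<open>(4 + 4 + 64 + 64) / 120\<close>, the weights
    being 4 at distance \<open>h\<close> and 1 at distance \<open>2 * h\<close>.\<close>
  ultimately have "\<bar>?d - g 4 x * h ^ 4\<bar> \<le> 136 / 120 * (B * h ^ 6)" by (simp only: abs_le_iff) linarith
  also have "\<dots> \<le> 2 * (B * h ^ 6)" using B0 h by (intro mult_right_mono) auto
  also have "\<dots> = 2 * B * h\<^sup>2 * h ^ 4" by (simp add: eval_nat_numeral)
  finally show ?thesis by (rule quotient_error) (use h in simp)
qed

end

lemma lap_lap: "lap h (lap h V) i = (V (i - 2) - 4 * V (i - 1) + 6 * V i - 4 * V (i + 1) + V (i + 2)) / h ^ 4"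
proof (cases "h = 0")
  case False
  have e: "(a / h\<^sup>2 - 2 * (b / h\<^sup>2) + c / h\<^sup>2) / h\<^sup>2 = (a - 2 * b + c) / h ^ 4" for a b c
    using False by (simp add: field_simps power2_eq_square power4_eq_xxxx)
  show ?thesis unfolding lap_def e by (simp add: algebra_simps)
qed (simp add: lap_def)

lemma node_add: "node J (i + s) = node J i + of_int s * mesh J"
  and node_diff: "node J (i - s) = node J i - of_int s * mesh J"
  by (simp_all add: node_def algebra_simps)

lemma node_range:
  assumes "i \<in> {0..int J}" "J \<ge> 1"
  shows "0 \<le> node J i" "node J i \<le> 2 * pi"
proof -
  show "0 \<le> node J i" using assms by (simp add: node_def)
  have "real_of_int i * mesh J \<le> real J * mesh J" using assms by (intro mult_right_mono) auto
  then show "node J i \<le> 2 * pi" using assms by (simp add: node_def mesh_def)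
qed

lemma mesh_le: "J \<ge> 1 \<Longrightarrow> mesh J \<le> 2 * pi"
  by (simp add: mesh_def pos_divide_le_eq mult_le_cancel_left1)

text \<open>The window \<open>{-20..40}\<close> contains all nodes of the difference stencils centred in one period.\<close>

locale smooth_solution = radius_bounds +
  fixes R :: "real \<Rightarrow> real" and D :: "nat \<Rightarrow> nat \<Rightarrow> real \<Rightarrow> real \<Rightarrow> real" and T B :: real
  assumes R: "\<And>t. t \<in> {0..T} \<Longrightarrow> R t \<in> {r0..r1}"
    and D_space: "\<And>p q x t. p + q < 6 \<Longrightarrow> t \<in> {0..T} \<Longrightarrow>
      ((\<lambda>s. D p q s t) has_real_derivative D (Suc p) q x t) (at x)"
    and D_time: "\<And>p q x t. p + q < 6 \<Longrightarrow> t \<in> {0..T} \<Longrightarrow>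
      ((\<lambda>s. D p q x s) has_real_derivative D p (Suc q) x t) (at t within {0..T})"
    and D_bound: "\<And>p q x t. p + q \<le> 6 \<Longrightarrow> x \<in> {-20..40} \<Longrightarrow> t \<in> {0..T} \<Longrightarrow> \<bar>D p q x t\<bar> \<le> B"
    and T_pos: "T > 0"
    and pde: "\<And>x t. t \<in> {0..T} \<Longrightarrow> D 0 1 x t + \<delta> / R t ^ 4 * D 4 0 x t
      + 1 / (R t)\<^sup>2 * (\<alpha> - 1 + \<delta> / (R t)\<^sup>2) * D 2 0 x t + (\<alpha> - 1) / (R t)\<^sup>2 * D 0 0 x t
      - v\<^sub>c / (R t)\<^sup>2 * (D 0 0 x t * D 1 0 x t) = 0"
begin

definition sol :: "nat \<Rightarrow> real \<Rightarrow> int \<Rightarrow> real" where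
  "sol J t i = D 0 0 (node J i) t"

lemma B_nonneg: "B \<ge> 0"
  using D_bound[of 0 0 0 0] T_pos by simp

lemma stencil:
  assumes "i \<in> {1..int J}" "J \<ge> 1" "\<bar>s\<bar> \<le> 2"
  shows "node J i + s * mesh J \<in> {-20..40}"
proof -
  have "0 \<le> node J i" "node J i \<le> 2 * pi" using node_range[of i J] assms by auto
  moreover have "\<bar>s * mesh J\<bar> \<le> 2 * (2 * pi)" unfolding abs_mult
    using assms mesh_le[of J] by (intro mult_mono) auto
  ultimately show ?thesis using pi_less_4 by (auto simp: abs_le_iff)
qed

lemma D_space_within:
  "p + q < 6 \<Longrightarrow> t \<in> {0..T} \<Longrightarrow> ((\<lambda>s. D p q s t) has_real_derivative D (Suc p) q x t) (at x within {-20..40})"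
  using D_space has_field_derivative_at_within by blast

text \<open>Centred at the midpoint with step \<open>k / 2\<close>, so that the first derivative
  cancels. Two time derivatives are spent; applied to \<open>D 4 0\<close> this exhausts the assumed
  order six.\<close>

lemma time_average:
  assumes "p + q \<le> 4" "x \<in> {-20..40}" "k > 0" "t \<in> {0..T}" "t + k \<in> {0..T}"
  shows "\<bar>(D p q x t + D p q x (t + k)) / 2 - D p q x (t + k / 2)\<bar> \<le> B * k\<^sup>2"
proof -
  have "\<bar>D p (q + 0) x (t + k / 2 - k / 2) - 2 * D p (q + 0) x (t + k / 2) + D p (q + 0) x (t + k / 2 + k / 2)\<bar>
      \<le> 2 * B * (k / 2)\<^sup>2"
    by (rule average_bound[where g = "\<lambda>j s. D p (q + j) x s" and S = "{0..T}" and n = 1])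
      (use assms D_time D_bound in \<open>auto simp: add.assoc[symmetric]\<close>)
  also have "2 * B * (k / 2)\<^sup>2 \<le> 2 * (B * k\<^sup>2)" using B_nonneg by (simp add: power2_eq_square)
  finally show ?thesis unfolding abs_le_iff by simp argo
qed

lemma time_difference:
  assumes "p + q \<le> 3" "x \<in> {-20..40}" "k > 0" "t \<in> {0..T}" "t + k \<in> {0..T}"
  shows "\<bar>(D p q x (t + k) - D p q x t) / k - D p (Suc q) x (t + k / 2)\<bar> \<le> B * k\<^sup>2"
proof -
  have "\<bar>(D p (q + 0) x (t + k / 2 + k / 2) - D p (q + 0) x (t + k / 2 - k / 2)) / (2 * (k / 2))
      - D p (q + 1) x (t + k / 2)\<bar> \<le> B * (k / 2)\<^sup>2 / 2"
    by (rule central_difference_bound[where g = "\<lambda>j s. D p (q + j) x s" and S = "{0..T}" and n = 2])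
      (use assms D_time D_bound in \<open>auto simp: add.assoc[symmetric]\<close>)
  also have "B * (k / 2)\<^sup>2 / 2 \<le> B * k\<^sup>2" using B_nonneg by (simp add: power2_eq_square)
  finally show ?thesis by (simp add: add.commute)
qed

lemma time_second_difference:
  assumes "x \<in> {-20..40}" "k > 0" "t - k \<in> {0..T}" "t + k \<in> {0..T}"
  shows "\<bar>D 0 0 x (t + k) - 2 * D 0 0 x t + D 0 0 x (t - k)\<bar> \<le> 2 * B * k\<^sup>2"
proof -
  have "\<bar>D 0 0 x (t - k) - 2 * D 0 0 x t + D 0 0 x (t + k)\<bar> \<le> 2 * B * k\<^sup>2"
    by (rule average_bound[where g = "\<lambda>j s. D 0 j x s" and S = "{0..T}" and n = 1])
      (use assms D_time D_bound in auto)
  then show ?thesis by (simp add: algebra_simps)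
qed

lemma time_increment:
  assumes "p + q \<le> 5" "x \<in> {-20..40}" "k > 0" "t \<in> {0..T}" "t + k \<in> {0..T}"
  shows "\<bar>D p q x (t + k) - D p q x t\<bar> \<le> B * k"
proof -
  have "\<bar>D p (q + 0) x (t + k) - D p (q + 0) x t\<bar> \<le> B * k"
    by (rule forward_difference_bound[where g = "\<lambda>j s. D p (q + j) x s" and S = "{0..T}" and n = 0])
      (use assms D_time D_bound in \<open>auto simp: add.assoc[symmetric]\<close>)
  then show ?thesis by simp
qed

lemma sol_stencil:
  "sol J t (i + 1) = D 0 0 (node J i + mesh J) t" "sol J t (i - 1) = D 0 0 (node J i - mesh J) t"
  "sol J t (i + 2) = D 0 0 (node J i + 2 * mesh J) t" "sol J t (i - 2) = D 0 0 (node J i - 2 * mesh J) t"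
  by (simp_all add: sol_def node_add node_diff)

lemma stencil_mem:
  assumes J: "J \<ge> 1" and i: "i \<in> {1..int J}"
  shows
  "node J i \<in> {-20..40}" "node J i + mesh J \<in> {-20..40}" "node J i - mesh J \<in> {-20..40}"
  "node J i + 2 * mesh J \<in> {-20..40}" "node J i - 2 * mesh J \<in> {-20..40}"
  using stencil[OF i J, of 0] stencil[OF i J, of 1] stencil[OF i J, of "-1"] stencil[OF i J, of 2]
    stencil[OF i J, of "-2"] by auto

lemma space_bounds:
  assumes J: "J \<ge> 1" and i: "i \<in> {1..int J}" and t: "t \<in> {0..T}"
  shows
  "\<bar>sol J t (i - 1) - 2 * sol J t i + sol J t (i + 1)\<bar> \<le> 2 * B * (mesh J)\<^sup>2"
  "\<bar>(sol J t (i + 1) - sol J t (i - 1)) / (2 * mesh J) - D 1 0 (node J i) t\<bar> \<le> B * (mesh J)\<^sup>2 / 2"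
  "\<bar>lap (mesh J) (sol J t) i - D 2 0 (node J i) t\<bar> \<le> B * (mesh J)\<^sup>2 / 3"
  "\<bar>lap (mesh J) (lap (mesh J) (sol J t)) i - D 4 0 (node J i) t\<bar> \<le> 2 * B * (mesh J)\<^sup>2"
proof -
  have h: "mesh J > 0" using J by (rule mesh_pos)
  note cond = stencil_mem[OF J i] h D_space_within[OF _ t] D_bound[OF _ _ t]
  show "\<bar>sol J t (i - 1) - 2 * sol J t i + sol J t (i + 1)\<bar> \<le> 2 * B * (mesh J)\<^sup>2"
    unfolding sol_stencil unfolding sol_def
    by (rule average_bound[where g = "\<lambda>j s. D j 0 s t" and S = "{-20..40}" and n = 1]) (use cond in auto)
  show "\<bar>(sol J t (i + 1) - sol J t (i - 1)) / (2 * mesh J) - D 1 0 (node J i) t\<bar> \<le> B * (mesh J)\<^sup>2 / 2"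
    unfolding sol_stencil
    by (rule central_difference_bound[where g = "\<lambda>j s. D j 0 s t" and S = "{-20..40}" and n = 2]) (use cond in auto)
  show "\<bar>lap (mesh J) (sol J t) i - D 2 0 (node J i) t\<bar> \<le> B * (mesh J)\<^sup>2 / 3"
    unfolding lap_def sol_stencil unfolding sol_def
    by (rule second_difference_bound[where g = "\<lambda>j s. D j 0 s t" and S = "{-20..40}" and n = 3]) (use cond in auto)
  show "\<bar>lap (mesh J) (lap (mesh J) (sol J t)) i - D 4 0 (node J i) t\<bar> \<le> 2 * B * (mesh J)\<^sup>2"
    unfolding lap_lap sol_stencil unfolding sol_def
    by (rule fourth_difference_bound[where g = "\<lambda>j s. D j 0 s t" and S = "{-20..40}" and n = 5]) (use cond in auto)
qed

text \<open>The defect of the linear part with the exact nonlinearity at the midpoint. It is shared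
  by the Crank-Nicolson step and Newton's first step, which differ only in how they discretise the
  product.\<close>

definition mid_residual :: "nat \<Rightarrow> real \<Rightarrow> real \<Rightarrow> int \<Rightarrow> real" where
  "mid_residual J k t i = (sol J (t + k) i - sol J t i) / k
     + Lh \<delta> \<alpha> (mesh J) (R (t + k / 2)) (\<lambda>i. (sol J t i + sol J (t + k) i) / 2) i
     - v\<^sub>c / (R (t + k / 2))\<^sup>2 * (D 0 0 (node J i) (t + k / 2) * D 1 0 (node J i) (t + k / 2))"

lemma mid_residual_bound:
  assumes J: "J \<ge> 1" and i: "i \<in> {1..int J}" and k: "k > 0" and t: "t \<in> {0..T}" "t + k \<in> {0..T}"
  shows "\<bar>mid_residual J k t i\<bar> \<le> B * (1 + 2 * a1 + 2 * C1) * (k\<^sup>2 + (mesh J)\<^sup>2)"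
proof -
  let ?x = "node J i" and ?m = "t + k / 2" and ?h = "mesh J"
  have m: "?m \<in> {0..T}" using t k by auto
  have x: "?x \<in> {-20..40}" using stencil_mem(1)[OF J i] .
  define a where "a = \<delta> / R ?m ^ 4"
  define c where "c = 1 / (R ?m)\<^sup>2 * (\<alpha> - 1 + \<delta> / (R ?m)\<^sup>2)"
  define d where "d = (\<alpha> - 1) / (R ?m)\<^sup>2"
  have abd: "\<bar>a\<bar> \<le> a1" "\<bar>c\<bar> \<le> C1" "\<bar>d\<bar> \<le> C1"
    unfolding a_def c_def d_def by (rule coeffs[OF R[OF m]])+
  define e1 where "e1 = (sol J (t + k) i - sol J t i) / k - D 0 1 ?x ?m"
  define e2 where "e2 = (lap ?h (lap ?h (sol J t)) i + lap ?h (lap ?h (sol J (t + k))) i) / 2 - D 4 0 ?x ?m"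
  define e3 where "e3 = (lap ?h (sol J t) i + lap ?h (sol J (t + k)) i) / 2 - D 2 0 ?x ?m"
  define e4 where "e4 = (sol J t i + sol J (t + k) i) / 2 - D 0 0 ?x ?m"
  have avg: "(\<lambda>i. (sol J t i + sol J (t + k) i) / 2) = (\<lambda>i. (1/2) * (sol J t i + sol J (t + k) i))" by auto
  \<comment> \<open>Subtracting the equation at the midpoint cancels the nonlinear product and
    leaves one consistency error for each linear term.\<close>
  have "mid_residual J k t i = e1 + a * e2 + c * e3 + d * e4"
    unfolding mid_residual_def Lh_lin4 lin4_def avg lap_scale lap_add a_def[symmetric] c_def[symmetric] d_def[symmetric]
    using pde[OF m, of ?x, folded a_def c_def d_def]
    unfolding e1_def e2_def e3_def e4_def by (simp add: algebra_simps add_divide_distrib)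
  also have "\<bar>\<dots>\<bar> \<le> B * k\<^sup>2 + a1 * (2 * B * (k\<^sup>2 + ?h\<^sup>2)) + C1 * (B * (k\<^sup>2 + ?h\<^sup>2)) + C1 * (B * (k\<^sup>2 + ?h\<^sup>2))"
  proof -
    have "\<bar>e1\<bar> \<le> B * k\<^sup>2"
      unfolding e1_def sol_def using time_difference[of 0 0 ?x k t] x k t by simp
    moreover have "\<bar>a * e2\<bar> \<le> a1 * (2 * B * (k\<^sup>2 + ?h\<^sup>2))"
      unfolding abs_mult
    proof (rule mult_mono[OF abd(1)])
      have "\<bar>(D 4 0 ?x t + D 4 0 ?x (t + k)) / 2 - D 4 0 ?x ?m\<bar> \<le> B * k\<^sup>2"
        using time_average[of 4 0 ?x k t] x k t by simp
      moreover have "\<bar>lap ?h (lap ?h (sol J t)) i - D 4 0 ?x t\<bar> \<le> 2 * B * ?h\<^sup>2"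
        "\<bar>lap ?h (lap ?h (sol J (t + k))) i - D 4 0 ?x (t + k)\<bar> \<le> 2 * B * ?h\<^sup>2"
        using space_bounds(4)[OF J i] t by auto
      ultimately have "\<bar>e2\<bar> \<le> B * k\<^sup>2 + 2 * B * ?h\<^sup>2"
        unfolding e2_def by (simp add: abs_le_iff field_simps)
      also have "\<dots> \<le> 2 * B * (k\<^sup>2 + ?h\<^sup>2)" using B_nonneg by (simp add: algebra_simps)
      finally show "\<bar>e2\<bar> \<le> 2 * B * (k\<^sup>2 + ?h\<^sup>2)" .
    qed (use abd in auto)
    moreover have "\<bar>c * e3\<bar> \<le> C1 * (B * (k\<^sup>2 + ?h\<^sup>2))"
      unfolding abs_mult
    proof (rule mult_mono[OF abd(2)])
      have "\<bar>(D 2 0 ?x t + D 2 0 ?x (t + k)) / 2 - D 2 0 ?x ?m\<bar> \<le> B * k\<^sup>2"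
        using time_average[of 2 0 ?x k t] x k t by simp
      moreover have "\<bar>lap ?h (sol J t) i - D 2 0 ?x t\<bar> \<le> B * ?h\<^sup>2 / 3"
        "\<bar>lap ?h (sol J (t + k)) i - D 2 0 ?x (t + k)\<bar> \<le> B * ?h\<^sup>2 / 3"
        using space_bounds(3)[OF J i] t by auto
      ultimately have "\<bar>e3\<bar> \<le> B * k\<^sup>2 + B * ?h\<^sup>2 / 3"
        unfolding e3_def abs_le_iff by argo
      also have "\<dots> \<le> B * (k\<^sup>2 + ?h\<^sup>2)" using B_nonneg by (simp add: algebra_simps)
      finally show "\<bar>e3\<bar> \<le> B * (k\<^sup>2 + ?h\<^sup>2)" .
    qed (use C1_nonneg in auto)
    moreover have "\<bar>d * e4\<bar> \<le> C1 * (B * (k\<^sup>2 + ?h\<^sup>2))"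
      unfolding abs_mult
    proof (rule mult_mono[OF abd(3)])
      have "\<bar>e4\<bar> \<le> B * k\<^sup>2"
        unfolding e4_def sol_def using time_average[of 0 0 ?x k t] x k t by simp
      also have "\<dots> \<le> B * (k\<^sup>2 + ?h\<^sup>2)" using B_nonneg by (simp add: algebra_simps)
      finally show "\<bar>e4\<bar> \<le> B * (k\<^sup>2 + ?h\<^sup>2)" .
    qed (use C1_nonneg in auto)
    ultimately show ?thesis by linarith
  qed
  also have "\<dots> \<le> B * (1 + 2 * a1 + 2 * C1) * (k\<^sup>2 + ?h\<^sup>2)"
    using B_nonneg by (simp add: algebra_simps)
  finally show ?thesis .
qed

text \<open>Displays the nonlinearity as a three-point mean times a central difference quotient,
  each a second order approximation in the mesh width.\<close>

lemma Q_half: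
  fixes X Y :: "int \<Rightarrow> real"
  defines "G \<equiv> \<lambda>i. (X i + Y i) / 2"
  shows "QQ J r X Y i
    = v\<^sub>c / r\<^sup>2 * ((G (i - 1) + G i + G (i + 1)) / 3 * ((G (i + 1) - G (i - 1)) / (2 * mesh J)))"
proof -
  have "psi (\<lambda>i. X i + Y i) (\<lambda>i. X i + Y i) i = 8 * ((G (i - 1) + G i + G (i + 1)) * (G (i + 1) - G (i - 1)))"
    by (simp add: psi_def G_def field_simps)
  then show ?thesis unfolding Q_def by (simp add: mult_ac)
qed

text \<open>The product error is split as \<open>P * (D - q) + (P - p) * q\<close>, where
  \<open>P\<close> is the three-point mean and \<open>D\<close> the difference quotient.\<close>

lemma Q_consistent:
  fixes X Y :: "int \<Rightarrow> real"
  defines "G \<equiv> \<lambda>i. (X i + Y i) / 2"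
  assumes r: "r \<in> {r0..r1}" and bd: "\<bar>p\<bar> \<le> B" "\<bar>q\<bar> \<le> B"
    and G: "\<bar>(G (i - 1) + G i + G (i + 1)) / 3 - p\<bar> \<le> \<epsilon>" "\<bar>(G (i + 1) - G (i - 1)) / (2 * mesh J) - q\<bar> \<le> \<epsilon>"
      "\<bar>(G (i - 1) + G i + G (i + 1)) / 3\<bar> \<le> B"
  shows "\<bar>QQ J r X Y i - v\<^sub>c / r\<^sup>2 * (p * q)\<bar> \<le> \<bar>v\<^sub>c\<bar> / r0\<^sup>2 * (2 * B * \<epsilon>)"
proof -
  let ?P = "(G (i - 1) + G i + G (i + 1)) / 3" and ?D = "(G (i + 1) - G (i - 1)) / (2 * mesh J)"
  have "QQ J r X Y i - v\<^sub>c / r\<^sup>2 * (p * q)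
     = v\<^sub>c / r\<^sup>2 * (?P * (?D - q) + (?P - p) * q)"
    unfolding Q_half G_def by (simp only: algebra_simps)
  also have "\<bar>\<dots>\<bar> \<le> \<bar>v\<^sub>c\<bar> / r0\<^sup>2 * (B * \<epsilon> + \<epsilon> * B)"
    unfolding abs_mult
  proof (rule mult_mono)
    have e: "0 \<le> \<epsilon>" using G(1) by linarith
    have "\<bar>?P * (?D - q)\<bar> \<le> B * \<epsilon>" "\<bar>(?P - p) * q\<bar> \<le> \<epsilon> * B"
      unfolding abs_mult using G bd e B_nonneg by (intro mult_mono; simp)+
    then show "\<bar>?P * (?D - q) + (?P - p) * q\<bar> \<le> B * \<epsilon> + \<epsilon> * B" by linarith
    show "\<bar>v\<^sub>c / r\<^sup>2\<bar> \<le> \<bar>v\<^sub>c\<bar> / r0\<^sup>2"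
      using r r0 by (auto simp: abs_divide intro!: divide_left_mono power_mono)
  qed auto
  finally show ?thesis by (simp add: mult_ac)
qed

text \<open>The linear contribution from \<open>mid_residual_bound\<close> plus
  \<open>Q_consistent\<close> with an error of \<open>2 * B\<close> times the order term.\<close>

definition C\<tau> where "C\<tau> = B * (1 + 2 * a1 + 2 * C1) + \<bar>v\<^sub>c\<bar> / r0\<^sup>2 * (4 * B\<^sup>2)"

lemma C\<tau>_split:
  "C\<tau> * X = B * (1 + 2 * a1 + 2 * C1) * X + \<bar>v\<^sub>c\<bar> / r0\<^sup>2 * (2 * B * (2 * B * X))"
proof -
  have "\<bar>v\<^sub>c\<bar> / r0\<^sup>2 * (4 * B\<^sup>2) * X = \<bar>v\<^sub>c\<bar> / r0\<^sup>2 * (2 * B * (2 * B * X))"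
    by (simp add: power2_eq_square[of B])
  then show ?thesis by (simp only: C\<tau>_def distrib_right)
qed

lemma sol_avg_bound:
  assumes J: "J \<ge> 1" and i: "i \<in> {1..int J}" and t: "t \<in> {0..T}"
  shows "\<bar>(sol J t (i - 1) + sol J t i + sol J t (i + 1)) / 3\<bar> \<le> B"
proof -
  have "\<bar>sol J t (i - 1)\<bar> \<le> B" "\<bar>sol J t i\<bar> \<le> B" "\<bar>sol J t (i + 1)\<bar> \<le> B"
    unfolding sol_stencil unfolding sol_def
    using stencil_mem[OF J i] D_bound[of 0 0 _ t] t by auto
  then show ?thesis unfolding abs_le_iff by argo
qed

lemma truncation_bound:
  fixes J k t
  defines "r \<equiv> R (t + k / 2)" and "s \<equiv> \<lambda>i. sol J t i + sol J (t + k) i"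
  assumes J: "J \<ge> 1" and i: "i \<in> {1..int J}" and k: "k > 0" and t: "t \<in> {0..T}" "t + k \<in> {0..T}"
  shows "\<bar>(sol J (t + k) i - sol J t i) / k + Lh \<delta> \<alpha> (mesh J) r (\<lambda>i. s i / 2) i - Q J r s s i / 2\<bar>
     \<le> C\<tau> * (k\<^sup>2 + (mesh J)\<^sup>2)"
proof -
  let ?x = "node J i" and ?m = "t + k / 2" and ?h = "mesh J"
  have m: "?m \<in> {0..T}" using t k by auto
  have x: "?x \<in> {-20..40}" using stencil_mem(1)[OF J i] .
  define G where "G i = s i / 2" for i
  have Bk: "B * k\<^sup>2 \<ge> 0" "B * ?h\<^sup>2 \<ge> 0" using B_nonneg by auto
  have g: "\<bar>(G (i - 1) + G i + G (i + 1)) / 3 - D 0 0 ?x ?m\<bar> \<le> 2 * B * (k\<^sup>2 + ?h\<^sup>2)"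
  proof -
    have "\<bar>(D 0 0 ?x t + D 0 0 ?x (t + k)) / 2 - D 0 0 ?x ?m\<bar> \<le> B * k\<^sup>2"
      using time_average[of 0 0 ?x k t] x k t by simp
    then have "\<bar>(sol J t i + sol J (t + k) i) / 2 - D 0 0 ?x ?m\<bar> \<le> B * k\<^sup>2" by (simp add: sol_def)
    moreover note space_bounds(1)[OF J i t(1)] space_bounds(1)[OF J i t(2)]
    ultimately show ?thesis using Bk unfolding G_def s_def abs_le_iff by (simp add: field_simps)
  qed
  have g': "\<bar>(G (i + 1) - G (i - 1)) / (2 * mesh J) - D 1 0 ?x ?m\<bar> \<le> 2 * B * (k\<^sup>2 + ?h\<^sup>2)"
  proof -
    have "\<bar>(D 1 0 ?x t + D 1 0 ?x (t + k)) / 2 - D 1 0 ?x ?m\<bar> \<le> B * k\<^sup>2"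
      using time_average[of 1 0 ?x k t] x k t by simp
    moreover have "(G (i + 1) - G (i - 1)) / (2 * mesh J) = ((sol J t (i + 1) - sol J t (i - 1)) / (2 * mesh J)
        + (sol J (t + k) (i + 1) - sol J (t + k) (i - 1)) / (2 * mesh J)) / 2"
      unfolding G_def s_def by (simp add: add_divide_distrib diff_divide_distrib)
    moreover note space_bounds(2)[OF J i t(1)] space_bounds(2)[OF J i t(2)]
    ultimately show ?thesis using Bk unfolding abs_le_iff distrib_left[of "2 * B"] by argo
  qed
  have g'': "\<bar>(G (i - 1) + G i + G (i + 1)) / 3\<bar> \<le> B"
    using sol_avg_bound[OF J i t(1)] sol_avg_bound[OF J i t(2)] unfolding G_def s_def abs_le_iff
    by (simp add: field_simps)
  have "\<bar>Q J r s s i / 2 - v\<^sub>c / r\<^sup>2 * (D 0 0 ?x ?m * D 1 0 ?x ?m)\<bar>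
      \<le> \<bar>v\<^sub>c\<bar> / r0\<^sup>2 * (2 * B * (2 * B * (k\<^sup>2 + ?h\<^sup>2)))"
    unfolding s_def
    by (rule Q_consistent) (use g g' g'' R[OF m] D_bound[of 0 0 ?x ?m] D_bound[of 1 0 ?x ?m] x m
        in \<open>auto simp: r_def G_def s_def\<close>)
  moreover have "\<bar>mid_residual J k t i\<bar> \<le> B * (1 + 2 * a1 + 2 * C1) * (k\<^sup>2 + ?h\<^sup>2)"
    by (rule mid_residual_bound[OF J i k t])
  moreover have "(sol J (t + k) i - sol J t i) / k + Lh \<delta> \<alpha> ?h r (\<lambda>i. s i / 2) i - Q J r s s i / 2
     = mid_residual J k t i - (Q J r s s i / 2 - v\<^sub>c / r\<^sup>2 * (D 0 0 ?x ?m * D 1 0 ?x ?m))"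
    by (simp add: mid_residual_def r_def s_def)
  ultimately show ?thesis
    unfolding C\<tau>_split by (simp only: order_trans[OF abs_triangle_ineq4 add_mono])
qed

text \<open>Freezing the nonlinearity at time zero shifts it by \<open>k / 2\<close> from the
  midpoint and costs one order in \<open>k\<close>; the assumption that \<open>k\<close> is at most
  1 merges the second order terms into this bound.\<close>

lemma first_truncation_bound:
  fixes J k
  defines "r \<equiv> R (k / 2)" and "s \<equiv> \<lambda>i. sol J 0 i + sol J k i"
  assumes J: "J \<ge> 1" and i: "i \<in> {1..int J}" and k: "0 < k" "k \<le> T" "k \<le> 1"
  shows "\<bar>(sol J k i - sol J 0 i) / k + Lh \<delta> \<alpha> (mesh J) r (\<lambda>i. s i / 2) i - 2 * Q J r (sol J 0) (sol J 0) i\<bar>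
     \<le> C\<tau> * (k + (mesh J)\<^sup>2)"
proof -
  let ?x = "node J i" and ?m = "k / 2" and ?h = "mesh J"
  have t: "(0::real) \<in> {0..T}" "0 + k \<in> {0..T}" and m: "?m \<in> {0..T}" using k by auto
  have x: "?x \<in> {-20..40}" using stencil_mem(1)[OF J i] .
  define G where "G i = sol J 0 i" for i
  have Bk: "B * k \<ge> 0" "B * ?h\<^sup>2 \<ge> 0" using B_nonneg k by auto
  have inc: "\<bar>D p 0 ?x ?m - D p 0 ?x 0\<bar> \<le> B * k" if "p \<le> 5" for p
  proof -
    have "\<bar>D p 0 ?x ?m - D p 0 ?x 0\<bar> \<le> B * (k / 2)" using time_increment[of p 0 ?x "k / 2" 0] x k m that by simp
    then show ?thesis using Bk by simp
  qed
  have g: "\<bar>(G (i - 1) + G i + G (i + 1)) / 3 - D 0 0 ?x ?m\<bar> \<le> 2 * B * (k + ?h\<^sup>2)"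
    using inc[of 0] space_bounds(1)[OF J i t(1)] Bk unfolding G_def abs_le_iff by (simp add: field_simps sol_def)
  have g': "\<bar>(G (i + 1) - G (i - 1)) / (2 * mesh J) - D 1 0 ?x ?m\<bar> \<le> 2 * B * (k + ?h\<^sup>2)"
  proof -
    have "\<bar>D 1 0 ?x ?m - D 1 0 ?x 0\<bar> \<le> B * k" by (rule inc) simp
    then show ?thesis
      using space_bounds(2)[OF J i t(1)] Bk unfolding G_def abs_le_iff distrib_left[of "2 * B"] by argo
  qed
  have "\<bar>QQ J r (sol J 0) (sol J 0) i
        - v\<^sub>c / r\<^sup>2 * (D 0 0 ?x ?m * D 1 0 ?x ?m)\<bar> \<le> \<bar>v\<^sub>c\<bar> / r0\<^sup>2 * (2 * B * (2 * B * (k + ?h\<^sup>2)))"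
    by (rule Q_consistent) (use g g' sol_avg_bound[OF J i t(1)] R[OF m] D_bound[of 0 0 ?x ?m] D_bound[of 1 0 ?x ?m] x m
        in \<open>auto simp: r_def G_def\<close>)
  also have "QQ J r (sol J 0) (sol J 0) i = 2 * Q J r (sol J 0) (sol J 0) i"
  proof -
    have "psi (\<lambda>i. X i + X i) (\<lambda>i. X i + X i) i = 4 * psi X X i" for X
      by (simp add: psi_def algebra_simps)
    then show ?thesis by (simp add: Q_def)
  qed
  finally have q: "\<bar>2 * Q J r (sol J 0) (sol J 0) i - v\<^sub>c / r\<^sup>2 * (D 0 0 ?x ?m * D 1 0 ?x ?m)\<bar>
      \<le> \<bar>v\<^sub>c\<bar> / r0\<^sup>2 * (2 * B * (2 * B * (k + ?h\<^sup>2)))" .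
  have "\<bar>mid_residual J k 0 i\<bar> \<le> B * (1 + 2 * a1 + 2 * C1) * (k\<^sup>2 + ?h\<^sup>2)"
    by (rule mid_residual_bound[OF J i k(1) t])
  also have "\<dots> \<le> B * (1 + 2 * a1 + 2 * C1) * (k + ?h\<^sup>2)"
  proof (rule mult_left_mono)
    show "k\<^sup>2 + ?h\<^sup>2 \<le> k + ?h\<^sup>2" using k by (simp add: power2_eq_square mult_left_le)
    have "a1 \<ge> 0" using \<delta> r0 by (simp add: a1_def)
    then show "0 \<le> B * (1 + 2 * a1 + 2 * C1)" using B_nonneg C1_nonneg by simp
  qed
  finally have mr: "\<bar>mid_residual J k 0 i\<bar> \<le> B * (1 + 2 * a1 + 2 * C1) * (k + ?h\<^sup>2)" .
  have "(sol J k i - sol J 0 i) / k + Lh \<delta> \<alpha> ?h r (\<lambda>i. s i / 2) i - 2 * Q J r (sol J 0) (sol J 0) i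
     = mid_residual J k 0 i - (2 * Q J r (sol J 0) (sol J 0) i - v\<^sub>c / r\<^sup>2 * (D 0 0 ?x ?m * D 1 0 ?x ?m))"
    by (simp add: mid_residual_def r_def s_def)
  then show ?thesis
    unfolding C\<tau>_split using mr q by (simp only: order_trans[OF abs_triangle_ineq4 add_mono])
qed

end

section \<open>Convergence of the schemes\<close>

context radius_bounds
begin

lemma Lh_half: "Lh \<delta> \<alpha> h r (\<lambda>i. (X i + Y i) / 2) i = 1 / 2 * Lh \<delta> \<alpha> h r (\<lambda>i. Y i + X i) i"
proof -
  have "(\<lambda>i. (X i + Y i) / 2) = (\<lambda>i. (1 / 2) * (Y i + X i))" by auto
  then show ?thesis by (simp only: Lh_scale)
qed

section \<open>The two schemes rewritten in terms of \<open>step\<close> and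
  \<open>Q\<close>\<close>

lemma crank_nicolson_start:
  assumes "crank_nicolson \<delta> \<alpha> v\<^sub>c T R J N v0 V"
  shows "V 0 = v0" and "n \<le> N \<Longrightarrow> per J (V n)"
  using assms[unfolded crank_nicolson_def Let_def, THEN conjunct2, THEN conjunct1]
    assms[unfolded crank_nicolson_def Let_def, THEN conjunct1, rule_format] by auto

lemma crank_nicolson_step:
  assumes "crank_nicolson \<delta> \<alpha> v\<^sub>c T R J N v0 V" and n: "n < N" and k: "k = tstep T N"
  shows "step J k (R (real n * k + k / 2)) (V n) (V (Suc n)) (\<lambda>i. QQ J (R (real n * k + k / 2)) (V n) (V (Suc n)) i)"
  unfolding step_def
proof
  fix i
  have r: "(real n + 1 / 2) * k = real n * k + k / 2" by (simp add: algebra_simps)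
  let ?r = "R (real n * k + k / 2)" and ?G = "\<lambda>i. (V n i + V (Suc n) i) / 2"
  have "(V (Suc n) i - V n i) / k + Lh \<delta> \<alpha> (mesh J) ?r ?G i = v\<^sub>c / (6 * mesh J * ?r\<^sup>2) * phi ?G ?G i"
    using assms(1)[unfolded crank_nicolson_def Let_def k[symmetric], THEN conjunct2, THEN conjunct2,
        rule_format, OF n, of i, unfolded r] .
  also have "phi ?G ?G i = psi (\<lambda>i. V n i + V (Suc n) i) (\<lambda>i. V n i + V (Suc n) i) i / 8"
    by (simp add: phi_def psi_def field_simps)
  finally show "(V (Suc n) i - V n i) / k + Lh \<delta> \<alpha> (mesh J) ?r ?G i =
      QQ J ?r (V n) (V (Suc n)) i"
    by (simp add: Q_def)
qed

lemma newton_start: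
  assumes "newton \<delta> \<alpha> v\<^sub>c T R J N its v0 V"
  shows "V 0 = v0"
  using assms[unfolded newton_def Let_def, THEN conjunct2, THEN conjunct1] .

lemma newton_newton_scheme:
  assumes V: "newton \<delta> \<alpha> v\<^sub>c T R J N its v0 V" and k: "k = tstep T N"
  shows "newton_scheme J N k (\<lambda>n. R (real n * k + k / 2)) V"
  unfolding newton_scheme_def
proof (intro conjI ballI)
  show "\<forall>n\<le>N. per J (V n)" using V by (simp add: newton_def Let_def)
  have V0: "V 0 = v0" using V by (simp add: newton_def Let_def)
  show "step J k (R (real 0 * k + k / 2)) (V 0) (V 1) (\<lambda>i. 2 * Q J (R (real 0 * k + k / 2)) (V 0) (V 0) i)"
    unfolding step_def
  proof
    fix i
    have "(V 1 i - V 0 i) / k + 1 / 2 * Lh \<delta> \<alpha> (mesh J) (R (k / 2)) (\<lambda>i. V 1 i + V 0 i) i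
          = v\<^sub>c / (6 * mesh J * (R (k / 2))\<^sup>2) * phi (V 0) (V 0) i"
      using V unfolding newton_def Let_def k[symmetric] V0 by blast
    then show "(V 1 i - V 0 i) / k + Lh \<delta> \<alpha> (mesh J) (R (real 0 * k + k / 2)) (\<lambda>i. (V 0 i + V 1 i) / 2) i =
         2 * Q J (R (real 0 * k + k / 2)) (V 0) (V 0) i"
      unfolding Lh_half by (simp add: Q_def phi_eq_psi)
  qed
  obtain W where W: "\<And>n. n \<in> {1..<N} \<Longrightarrow>
          (let r = R ((real n + 1/2) * k);
              Vhat = (\<lambda>i. 2 * V n i - V (n - 1) i);
              A = (\<lambda>i. V n i + Vhat i)
          in (\<forall>j\<le>its (n + 1). per J (W (n + 1) j)) \<and>
             W (n + 1) 0 = Vhat \<and>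
             (\<forall>j<its (n + 1). \<forall>i.
                (W (n + 1) (Suc j) i - V n i) / k
                + 1/2 * Lh \<delta> \<alpha> (mesh J) r (\<lambda>i. W (n + 1) (Suc j) i + V n i) i
                = v\<^sub>c / (24 * mesh J * r\<^sup>2)
                  * (psi A (\<lambda>i. W (n + 1) j i - Vhat i) i + phi A A i)) \<and>
             V (n + 1) = W (n + 1) (its (n + 1)))"
    using V unfolding newton_def Let_def[of "mesh J"] k[symmetric] Let_def[of k] by blast
  fix n assume n: "n \<in> {1..<N}"
  have r: "(real n + 1 / 2) * k = real n * k + k / 2" by (simp add: algebra_simps)
  note Wn = W[OF n, unfolded Let_def r]
  have its: "1 \<le> its (n + 1)" using V n unfolding newton_def Let_def by auto
  let ?r = "R (real n * k + k / 2)"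
  have W0: "W (n + 1) 0 = (\<lambda>i. 2 * V n i - V (n - 1) i)" using Wn by blast
  have "newton_iterates J k ?r (V (n - 1)) (V n) (its (n + 1)) (W (n + 1))"
    unfolding newton_iterates_def step_def
  proof (intro conjI allI impI ballI)
    show "W (n + 1) 0 = (\<lambda>i. 2 * V n i - V (n - 1) i)" by (rule W0)
    show "per J (W (n + 1) j)" if "j \<le> its (n + 1)" for j using Wn that by blast
    fix j i assume j: "j < its (n + 1)"
    have "(W (n + 1) (Suc j) i - V n i) / k
                + 1/2 * Lh \<delta> \<alpha> (mesh J) ?r (\<lambda>i. W (n + 1) (Suc j) i + V n i) i
                = v\<^sub>c / (24 * mesh J * ?r\<^sup>2)
                  * (psi (\<lambda>i. V n i + W (n + 1) 0 i) (\<lambda>i. W (n + 1) j i - W (n + 1) 0 i) i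
                     + phi (\<lambda>i. V n i + W (n + 1) 0 i) (\<lambda>i. V n i + W (n + 1) 0 i) i)"
      using Wn j unfolding W0 by blast
    then show "(W (n + 1) (Suc j) i - V n i) / k + Lh \<delta> \<alpha> (mesh J) ?r (\<lambda>i. (V n i + W (n + 1) (Suc j) i) / 2) i
      = Q J ?r (\<lambda>i. V n i + W (n + 1) 0 i) (\<lambda>i. W (n + 1) j i - W (n + 1) 0 i) i
        + QQ J ?r (V n) (W (n + 1) 0) i"
      unfolding Lh_half by (simp add: Q_def phi_eq_psi distrib_left)
  qed
  moreover have "V (Suc n) = W (n + 1) (its (n + 1))" using Wn by simp
  ultimately show "\<exists>m W. 1 \<le> m \<and> newton_iterates J k ?r (V (n - 1)) (V n) m W \<and> V (Suc n) = W m"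
    using its by blast
qed

end

section \<open>The exact solution on the grid, and convergence of \<open>V\<close>\<close>

locale periodic_solution = smooth_solution +
  assumes D_periodic: "\<And>x t. t \<in> {0..T} \<Longrightarrow> D 0 0 (x + 2 * pi) t = D 0 0 x t"
begin

lemma per_sol:
  assumes "t \<in> {0..T}" "J \<ge> 1"
  shows "per J (sol J t)"
proof -
  have "node J (i + int J) = node J i + 2 * pi" for i
    using assms(2) by (simp add: node_add mesh_def)
  then show ?thesis using D_periodic assms by (simp add: per_def sol_def)
qed

lemma sol_norm:
  assumes "t \<in> {0..T}" "J \<ge> 1"
  shows "grid_norm J (sol J t) \<le> sqrt (2 * pi) * B"
proof (rule grid_norm_bound)
  fix i assume "i \<in> {1..int J}"
  then show "\<bar>sol J t i\<bar> \<le> B"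
    unfolding sol_def using D_bound[of 0 0 _ t] stencil_mem(1)[OF assms(2)] assms by auto
qed (rule assms)

text \<open>One constant for both residuals and the second time difference. The summand 1 makes it
  positive, since \<open>newton_convergence\<close> divides by it.\<close>

definition "C' = sqrt (2 * pi) * (C\<tau> + 2 * B) + 1"

lemma C\<tau>_nonneg: "C\<tau> \<ge> 0"
proof -
  have "a1 \<ge> 0" using \<delta> r0 by (simp add: a1_def)
  then show ?thesis using B_nonneg C1_nonneg by (simp add: C\<tau>_def)
qed

lemma C'_pos: "C' > 0"
  using C\<tau>_nonneg B_nonneg by (simp add: C'_def add_nonneg_pos)

lemma exact_step:
  assumes J: "J \<ge> 1" and N: "N \<ge> 1" and k: "k = tstep T N" and n: "n < N"
  shows "\<exists>\<tau>. step J k (R (real n * k + k / 2)) (sol J (real n * k)) (sol J (real (Suc n) * k))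
      (\<lambda>i. Q J (R (real n * k + k / 2)) (\<lambda>i. sol J (real n * k) i + sol J (real (Suc n) * k) i)
          (\<lambda>i. sol J (real n * k) i + sol J (real (Suc n) * k) i) i / 2 + \<tau> i)
    \<and> grid_norm J \<tau> \<le> C' * (k\<^sup>2 + (mesh J)\<^sup>2)"
proof -
  let ?t = "real n * k"
  have k0: "k > 0" using N T_pos by (simp add: k tstep_def)
  have kN: "real N * k = T" using N by (simp add: k tstep_def)
  have S: "real (Suc n) * k = ?t + k" by (simp add: algebra_simps)
  have "real (Suc n) * k \<le> real N * k" using n k0 by (intro mult_right_mono) auto
  then have t: "?t \<in> {0..T}" "?t + k \<in> {0..T}" using k0 kN S by auto
  let ?r = "R (?t + k / 2)" and ?s = "\<lambda>i. sol J ?t i + sol J (?t + k) i"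
  define \<tau> where "\<tau> i = (sol J (?t + k) i - sol J ?t i) / k + Lh \<delta> \<alpha> (mesh J) ?r (\<lambda>i. ?s i / 2) i
      - Q J ?r ?s ?s i / 2" for i
  have "grid_norm J \<tau> \<le> sqrt (2 * pi) * (C\<tau> * (k\<^sup>2 + (mesh J)\<^sup>2))"
    unfolding \<tau>_def using truncation_bound[OF J _ k0 t] by (intro grid_norm_bound J)
  also have "\<dots> = (sqrt (2 * pi) * C\<tau>) * (k\<^sup>2 + (mesh J)\<^sup>2)" by simp
  also have "\<dots> \<le> C' * (k\<^sup>2 + (mesh J)\<^sup>2)"
    using B_nonneg by (intro mult_right_mono) (auto simp: C'_def algebra_simps)
  finally have "grid_norm J \<tau> \<le> C' * (k\<^sup>2 + (mesh J)\<^sup>2)" .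
  moreover have "step J k ?r (sol J ?t) (sol J (?t + k)) (\<lambda>i. Q J ?r ?s ?s i / 2 + \<tau> i)"
    by (simp add: step_def \<tau>_def)
  ultimately show ?thesis unfolding S by blast
qed

lemma exact_first_step:
  assumes J: "J \<ge> 1" and N: "N \<ge> 1" and k: "k = tstep T N" and k1: "k \<le> 1"
  shows "\<exists>\<tau>. step J k (R (k / 2)) (sol J 0) (sol J k)
      (\<lambda>i. 2 * Q J (R (k / 2)) (sol J 0) (sol J 0) i + \<tau> i)
    \<and> grid_norm J \<tau> \<le> C' * (k + (mesh J)\<^sup>2)"
proof -
  have k0: "k > 0" using N T_pos by (simp add: k tstep_def)
  have kT: "k \<le> T" using N T_pos by (simp add: k tstep_def divide_le_eq)
  let ?r = "R (k / 2)" and ?s = "\<lambda>i. sol J 0 i + sol J k i"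
  define \<tau> where "\<tau> i = (sol J k i - sol J 0 i) / k + Lh \<delta> \<alpha> (mesh J) ?r (\<lambda>i. ?s i / 2) i
      - 2 * Q J ?r (sol J 0) (sol J 0) i" for i
  have "grid_norm J \<tau> \<le> sqrt (2 * pi) * (C\<tau> * (k + (mesh J)\<^sup>2))"
    unfolding \<tau>_def using first_truncation_bound[OF J _ k0 kT k1] by (intro grid_norm_bound J)
  also have "\<dots> = (sqrt (2 * pi) * C\<tau>) * (k + (mesh J)\<^sup>2)" by simp
  also have "\<dots> \<le> C' * (k + (mesh J)\<^sup>2)"
    using B_nonneg k0 by (intro mult_right_mono) (auto simp: C'_def algebra_simps)
  finally have "grid_norm J \<tau> \<le> C' * (k + (mesh J)\<^sup>2)" .
  moreover have "step J k ?r (sol J 0) (sol J k) (\<lambda>i. 2 * Q J ?r (sol J 0) (sol J 0) i + \<tau> i)"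
    by (simp add: step_def \<tau>_def)
  ultimately show ?thesis by blast
qed

lemma exact_second_difference:
  assumes J: "J \<ge> 1" and N: "N \<ge> 1" and k: "k = tstep T N" and n: "n \<in> {1..<N}"
  shows "grid_norm J (\<lambda>i. sol J (real (Suc n) * k) i - 2 * sol J (real n * k) i + sol J (real (n - 1) * k) i)
    \<le> C' * k\<^sup>2"
proof -
  have k0: "k > 0" using N T_pos by (simp add: k tstep_def)
  have kN: "real N * k = T" using N by (simp add: k tstep_def)
  let ?t = "real n * k"
  have S: "real (Suc n) * k = ?t + k" "real (n - 1) * k = ?t - k" using n by (auto simp: algebra_simps of_nat_diff)
  have "real (Suc n) * k \<le> real N * k" using n k0 by (intro mult_right_mono) auto
  then have "?t + k \<le> T" using kN S by simp
  moreover have "0 \<le> ?t - k" using S(2) k0 by (metis mult_nonneg_nonneg of_nat_0_le_iff less_imp_le)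
  ultimately have t: "?t - k \<in> {0..T}" "?t + k \<in> {0..T}"
    unfolding atLeastAtMost_iff using k0 by (linarith, linarith)
  have "grid_norm J (\<lambda>i. sol J (?t + k) i - 2 * sol J ?t i + sol J (?t - k) i) \<le> sqrt (2 * pi) * (2 * B * k\<^sup>2)"
    unfolding sol_def
    using time_second_difference[OF stencil_mem(1)[OF J] k0 t] by (intro grid_norm_bound J)
  also have "\<dots> = (sqrt (2 * pi) * (2 * B)) * k\<^sup>2" by simp
  also have "\<dots> \<le> C' * k\<^sup>2"
    using C\<tau>_nonneg by (intro mult_right_mono) (auto simp: C'_def algebra_simps)
  finally show ?thesis unfolding S .
qed

theorem scheme_convergence:
  "\<exists>c>0. \<exists>k0>0. \<forall>J N V. J \<ge> 1 \<longrightarrow> N \<ge> 1 \<longrightarrow> tstep T N \<le> k0 \<longrightarrow>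
     (crank_nicolson \<delta> \<alpha> v\<^sub>c T R J N (sol J 0) V \<or> (\<exists>its. newton \<delta> \<alpha> v\<^sub>c T R J N its (sol J 0) V)) \<longrightarrow>
     (\<forall>n\<le>N. grid_norm J (\<lambda>i. sol J (real n * tstep T N) i - V n i) \<le> c * ((tstep T N)\<^sup>2 + (mesh J)\<^sup>2))"
proof -
  define K where "K = sqrt (2 * pi) * B"
  have K0: "K \<ge> 0" using B_nonneg by (simp add: K_def)
  obtain c1 k1 where c1: "c1 \<ge> 0" and k1: "k1 > 0" and
    newt: "\<forall>J N k rr V v. J \<ge> 1 \<longrightarrow> N \<ge> 1 \<longrightarrow> 0 < k \<longrightarrow> k \<le> k1 \<longrightarrow> real N * k \<le> T \<longrightarrow>
    (\<forall>n<N. rr n \<in> {r0..r1}) \<longrightarrow> newton_scheme J N k rr V \<longrightarrow> V 0 = v 0 \<longrightarrow>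
    consistent J N k rr v K C' \<longrightarrow>
    (\<forall>n\<le>N. grid_norm J (\<lambda>i. v n i - V n i) \<le> c1 * (k\<^sup>2 + (mesh J)\<^sup>2))"
    using newton_convergence[OF T_pos K0 C'_pos] by blast
  define c2 where "c2 = sqrt (exp (4 * T * L (4 * b * K)) * T) * C'"
  have c2: "c2 \<ge> 0" using T_pos C'_pos by (simp add: c2_def)
  \<comment> \<open>The last entry is the condition of the Crank-Nicolson energy estimate, the first
    that of \<open>newton_convergence\<close>; 1 is for the residual of the first step.\<close>
  define k0 where "k0 = min (min k1 1) (1 / (2 * L (4 * b * K)))"
  have L1: "L (4 * b * K) \<ge> 1" by (rule L_ge1)
  have k0: "k0 > 0" using k1 L1 by (simp add: k0_def)
  show ?thesis
  proof (intro exI conjI allI impI)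
    show "c1 + c2 + 1 > 0" using c1 c2 by simp
    show "k0 > 0" by fact
    fix J N V n
    assume J: "J \<ge> 1" and N: "N \<ge> 1" and kk: "tstep T N \<le> k0" and n: "n \<le> N"
      and V: "crank_nicolson \<delta> \<alpha> v\<^sub>c T R J N (sol J 0) V \<or> (\<exists>its. newton \<delta> \<alpha> v\<^sub>c T R J N its (sol J 0) V)"
    define k where "k = tstep T N"
    have kpos: "k > 0" using N T_pos by (simp add: k_def tstep_def)
    have kN: "real N * k = T" using N by (simp add: k_def tstep_def)
    have NT: "real N * k \<le> T" using kN by simp
    have kle: "k \<le> k1" "k \<le> 1" "k \<le> 1 / (2 * L (4 * b * K))" using kk by (auto simp: k0_def k_def)
    define v where "v n = sol J (real n * k)" for n
    define rr where "rr n = R (real n * k + k / 2)" for n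
    have tn: "real n * k \<in> {0..T}" if "n \<le> N" for n
      using that kpos kN mult_right_mono[of "real n" "real N" k] by auto
    have rr: "rr n \<in> {r0..r1}" if "n < N" for n
      using tn[of n] tn[of "Suc n"] that kpos unfolding rr_def by (intro R) (auto simp: algebra_simps)
    have pv: "per J (v n)" "grid_norm J (v n) \<le> K" if "n \<le> N" for n
      using per_sol[OF tn[OF that] J] sol_norm[OF tn[OF that] J] by (simp_all add: v_def K_def)
    have "\<exists>\<tau>. step J k (rr 0) (v 0) (v 1) (\<lambda>i. 2 * Q J (rr 0) (v 0) (v 0) i + \<tau> i)
        \<and> grid_norm J \<tau> \<le> C' * (k + (mesh J)\<^sup>2)"
      using exact_first_step[OF J N k_def kle(2)] by (simp add: rr_def v_def)
    then have cs: "consistent J N k rr v K C'"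
      unfolding consistent_def
      using pv exact_step[OF J N k_def, folded v_def rr_def] exact_second_difference[OF J N k_def, folded v_def]
      by blast
    obtain \<tau> where \<tau>': "\<And>n. n < N \<Longrightarrow> step J k (rr n) (v n) (v (Suc n)) (\<lambda>i. QQ J (rr n) (v n) (v (Suc n)) i + \<tau> n i)"
      "\<And>n. n < N \<Longrightarrow> grid_norm J (\<tau> n) \<le> C' * (k\<^sup>2 + (mesh J)\<^sup>2)"
      using consistent_residuals[OF cs] by blast
    define s where "s = k\<^sup>2 + (mesh J)\<^sup>2"
    have s0: "s \<ge> 0" by (simp add: s_def)
    show "grid_norm J (\<lambda>i. sol J (real n * tstep T N) i - V n i) \<le> (c1 + c2 + 1) * ((tstep T N)\<^sup>2 + (mesh J)\<^sup>2)"
      using V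
    proof
      assume cn: "crank_nicolson \<delta> \<alpha> v\<^sub>c T R J N (sol J 0) V"
      have V0: "V 0 = v 0" using crank_nicolson_start(1)[OF cn] by (simp add: v_def)
      note perV = crank_nicolson_start(2)[OF cn]
      note cn_step = crank_nicolson_step[OF cn _ k_def, folded rr_def]
      have kL: "k * L (4 * b * K) \<le> 1 / 2" using kle(3) L1 by (simp add: field_simps)
      have "(grid_norm J (\<lambda>i. v n i - V n i))\<^sup>2 \<le> exp (4 * T * L (4 * b * K)) * T * (C' * s)\<^sup>2"
        by (rule cn_error[where rr = rr and \<tau> = \<tau> and v = v and V = V and K = K and T = T
            and \<rho> = "C' * s", OF J kpos NT rr perV pv \<tau>'(1) cn_step
            \<tau>'(2)[folded s_def] V0 kL n])
      moreover have "exp (4 * T * L (4 * b * K)) * T * (C' * s)\<^sup>2 = (c2 * s)\<^sup>2"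
        using T_pos by (simp add: c2_def power_mult_distrib)
      moreover have "0 \<le> c2 * s" using c2 s0 by simp
      ultimately have "grid_norm J (\<lambda>i. v n i - V n i) \<le> c2 * s" by (simp only: power2_le_imp_le)
      also have "\<dots> \<le> (c1 + c2 + 1) * s" using s0 c1 by (intro mult_right_mono) auto
      finally show ?thesis by (simp add: v_def s_def k_def)
    next
      assume "\<exists>its. newton \<delta> \<alpha> v\<^sub>c T R J N its (sol J 0) V"
      then obtain its where nw: "newton \<delta> \<alpha> v\<^sub>c T R J N its (sol J 0) V" ..
      have V0: "V 0 = v 0" using newton_start[OF nw] by (simp add: v_def)
      have "grid_norm J (\<lambda>i. v n i - V n i) \<le> c1 * (k\<^sup>2 + (mesh J)\<^sup>2)"
        by (rule newt[rule_format, where rr = rr and v = v and V = V, OF J N kpos kle(1) NT rr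
              newton_newton_scheme[OF nw k_def, folded rr_def] V0 cs n])
      also have "\<dots> = c1 * s" by (simp add: s_def)
      also have "\<dots> \<le> (c1 + c2 + 1) * s" using s0 c2 by (intro mult_right_mono) auto
      finally show ?thesis by (simp add: v_def s_def k_def)
    qed
  qed
qed

end

section \<open>Interpolation\<close>

text \<open>Piecewise linear interpolation in grid units; applying it in space and then in time
  gives the bilinear interpolant.\<close>

definition pl :: "(int \<Rightarrow> real) \<Rightarrow> real \<Rightarrow> real" where
  "pl a y = (1 - frac y) * a \<lfloor>y\<rfloor> + frac y * a (\<lfloor>y\<rfloor> + 1)"

text \<open>One formula valid on both sides of node \<open>j\<close> and free of
  \<open>floor\<close> and \<open>frac\<close>, hence visibly continuous there.\<close>

lemma pl_local:
  assumes "of_int j - 1 < y" "y < of_int j + 1"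
  shows "pl a y = a j + max 0 (y - of_int j) * (a (j + 1) - a j) + min 0 (y - of_int j) * (a j - a (j - 1))"
proof (cases "y \<ge> of_int j")
  case True
  then have "\<lfloor>y\<rfloor> = j" using assms by (simp add: floor_eq_iff)
  then show ?thesis using True by (simp add: pl_def frac_def algebra_simps)
next
  case False
  then have f: "\<lfloor>y\<rfloor> = j - 1" using assms by (simp add: floor_eq_iff)
  show ?thesis unfolding pl_def frac_def f using False by (simp add: algebra_simps)
qed

text \<open>The strips around the nodes form an open cover on which \<open>pl_local\<close> applies.
  The parameter \<open>x\<close> allows interpolated values that are functions themselves, as in the
  bilinear case.\<close>

lemma continuous_pl:
  fixes A :: "int \<Rightarrow> 'a::topological_space \<Rightarrow> real"
  assumes A: "\<And>j. continuous_on UNIV (A j)"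
  shows "continuous_on UNIV (\<lambda>(x, y). pl (\<lambda>j. A j x) y)"
proof -
  define U :: "int \<Rightarrow> ('a \<times> real) set" where "U j = UNIV \<times> {of_int j - 1<..<of_int j + 1}" for j
  have "continuous_on (\<Union>(range U)) (\<lambda>(x, y). pl (\<lambda>j. A j x) y)"
  proof (rule continuous_on_open_Union)
    fix s assume "s \<in> range U"
    then obtain j where s: "s = U j" by auto
    show "open s" unfolding s U_def by (intro open_Times) auto
    have c: "continuous_on s (\<lambda>p. A j (fst p))" for j
      by (rule continuous_on_compose2[OF A]) (auto intro: continuous_intros)
    have "continuous_on s (\<lambda>p. A j (fst p) + max 0 (snd p - of_int j) * (A (j + 1) (fst p) - A j (fst p))
        + min 0 (snd p - of_int j) * (A j (fst p) - A (j - 1) (fst p)))"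
      by (intro continuous_intros c)
    then show "continuous_on s (\<lambda>(x, y). pl (\<lambda>j. A j x) y)"
      by (rule continuous_on_eq) (auto simp: s U_def pl_local[of j])
  qed
  moreover have "p \<in> \<Union>(range U)" for p
  proof
    show "p \<in> U \<lfloor>snd p\<rfloor>" unfolding U_def
      by (cases p) (auto, linarith+)
  qed auto
  ultimately show ?thesis by (metis UNIV_eq_I)
qed

lemma continuous_pl_const: "continuous_on UNIV (pl a)"
proof -
  have "continuous_on UNIV (\<lambda>y. (\<lambda>(x::real, y). pl (\<lambda>j. a j) y) (0, y))"
    by (rule continuous_on_compose2[OF continuous_pl]) (auto intro!: continuous_intros)
  then show ?thesis by simp
qed

text \<open>Convexity of the square, with the defect
  \<open>(1 - \<theta>) * \<theta> * (p - q)\<^sup>2\<close> written out.\<close>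

lemma pl_square_le: "(pl a y)\<^sup>2 \<le> (1 - frac y) * (a \<lfloor>y\<rfloor>)\<^sup>2 + frac y * (a (\<lfloor>y\<rfloor> + 1))\<^sup>2"
proof -
  have f: "0 \<le> frac y" "frac y \<le> 1" using frac_lt_1[of y] by (auto intro: less_imp_le)
  have "(1 - \<theta>) * p\<^sup>2 + \<theta> * q\<^sup>2 - ((1 - \<theta>) * p + \<theta> * q)\<^sup>2 = (1 - \<theta>) * \<theta> * (p - q)\<^sup>2" for \<theta> p q :: real
    by (simp add: power2_eq_square algebra_simps)
  moreover have "0 \<le> (1 - frac y) * frac y * (a \<lfloor>y\<rfloor> - a (\<lfloor>y\<rfloor> + 1))\<^sup>2" using f by simp
  ultimately show ?thesis unfolding pl_def by (metis diff_ge_0_iff_ge)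
qed

lemma pl_square_le_sum: "(pl a y)\<^sup>2 \<le> (a \<lfloor>y\<rfloor>)\<^sup>2 + (a (\<lfloor>y\<rfloor> + 1))\<^sup>2"
proof -
  have f: "0 \<le> frac y" "frac y \<le> 1" using frac_lt_1[of y] by (auto intro: less_imp_le)
  have "(1 - frac y) * (a \<lfloor>y\<rfloor>)\<^sup>2 \<le> 1 * (a \<lfloor>y\<rfloor>)\<^sup>2" "frac y * (a (\<lfloor>y\<rfloor> + 1))\<^sup>2 \<le> 1 * (a (\<lfloor>y\<rfloor> + 1))\<^sup>2"
    using f by (intro mult_right_mono; simp)+
  then show ?thesis using pl_square_le[of a y] by linarith
qed

text \<open>Both nodes are expanded about \<open>x\<close>; in the convex combination the first
  order terms cancel, since \<open>x\<close> is the same combination of the nodes.\<close>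

lemma pl_interpolation_error:
  fixes g :: "nat \<Rightarrow> real \<Rightarrow> real"
  assumes S: "convex S" and g: "\<And>i x. x \<in> S \<Longrightarrow> i \<le> 1 \<Longrightarrow> (g i has_real_derivative g (Suc i) x) (at x within S)"
    and B: "\<And>x. x \<in> S \<Longrightarrow> \<bar>g 2 x\<bar> \<le> B" and h: "h > 0"
    and x: "x \<in> S" "of_int \<lfloor>x / h\<rfloor> * h \<in> S" "of_int (\<lfloor>x / h\<rfloor> + 1) * h \<in> S"
  shows "\<bar>pl (\<lambda>i. g 0 (of_int i * h)) (x / h) - g 0 x\<bar> \<le> B * h\<^sup>2"
proof -
  define i where "i = \<lfloor>x / h\<rfloor>"
  define \<theta> where "\<theta> = frac (x / h)"
  have \<theta>: "0 \<le> \<theta>" "\<theta> \<le> 1" using frac_lt_1[of "x / h"] by (auto simp: \<theta>_def intro: less_imp_le)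
  have B0: "B \<ge> 0" using B[OF x(1)] by simp
  have xh: "x / h = of_int i + \<theta>" by (simp add: i_def \<theta>_def frac_def)
  have xi: "of_int i * h - x = - (\<theta> * h)" "of_int (i + 1) * h - x = (1 - \<theta>) * h"
    using xh h by (auto simp: field_simps)
  have T: "\<bar>g 0 z - (g 0 x + g 1 x * (z - x))\<bar> \<le> B * \<bar>z - x\<bar>\<^sup>2" if "z \<in> S" for z
    using real_Taylor[where f = g and n = 1 and S = S and w = x and z = z and B = B] S g B x(1) that
    by (simp add: numeral_2_eq_2)
  define e1 e2 where "e1 = g 0 (of_int i * h) - (g 0 x + g 1 x * (- (\<theta> * h)))"
    and "e2 = g 0 (of_int (i + 1) * h) - (g 0 x + g 1 x * ((1 - \<theta>) * h))"
  have hh: "(\<theta> * h)\<^sup>2 \<le> h\<^sup>2" "((1 - \<theta>) * h)\<^sup>2 \<le> h\<^sup>2"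
    using \<theta> h by (intro power_mono mult_left_le_one_le; simp)+
  have "\<bar>e1\<bar> \<le> B * (\<theta> * h)\<^sup>2" using T[OF x(2)] unfolding i_def[symmetric] xi e1_def by simp
  also have "\<dots> \<le> B * h\<^sup>2" using hh B0 by (intro mult_left_mono)
  finally have e1: "\<bar>e1\<bar> \<le> B * h\<^sup>2" .
  have "\<bar>e2\<bar> \<le> B * ((1 - \<theta>) * h)\<^sup>2" using T[OF x(3)] unfolding i_def[symmetric] xi e2_def by simp
  also have "\<dots> \<le> B * h\<^sup>2" using hh B0 by (intro mult_left_mono)
  finally have e2: "\<bar>e2\<bar> \<le> B * h\<^sup>2" .
  have "pl (\<lambda>i. g 0 (of_int i * h)) (x / h) - g 0 x = (1 - \<theta>) * e1 + \<theta> * e2"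
    unfolding pl_def i_def[symmetric] \<theta>_def[symmetric] e1_def e2_def by (simp add: algebra_simps)
  also have "\<bar>\<dots>\<bar> \<le> (1 - \<theta>) * (B * h\<^sup>2) + \<theta> * (B * h\<^sup>2)"
    using \<theta> e1 e2 by (intro order_trans[OF abs_triangle_ineq] add_mono) (auto simp: abs_mult intro: mult_left_mono)
  also have "\<dots> = B * h\<^sup>2" by (simp add: algebra_simps)
  finally show ?thesis .
qed

lemma has_integral_step:
  fixes c :: "int \<Rightarrow> real"
  assumes h: "h > 0"
  shows "((\<lambda>x. c \<lfloor>x / h\<rfloor>) has_integral h * (\<Sum>i<m. c (int i))) {0..real m * h}"
proof (induction m)
  case (Suc m)
  have "((\<lambda>x. c (int m)) has_integral (real (Suc m) * h - real m * h) *\<^sub>R c (int m)) {real m * h..real (Suc m) * h}"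
    using has_integral_const_real[of "c (int m)" "real m * h" "real (Suc m) * h"] h by simp
  then have "((\<lambda>x. c (int m)) has_integral h * c (int m)) {real m * h..real (Suc m) * h}"
    by (simp add: algebra_simps)
  then have "((\<lambda>x. c \<lfloor>x / h\<rfloor>) has_integral h * c (int m)) {real m * h..real (Suc m) * h}"
  proof (rule has_integral_spike_finite[rotated 2])
    fix x assume x: "x \<in> {real m * h..real (Suc m) * h} - {real (Suc m) * h}"
    \<comment> \<open>The right end of the cell already rounds to the next index; it is the single
      exceptional point.\<close>
    then have "\<lfloor>x / h\<rfloor> = int m" using h by (auto simp: floor_eq_iff field_simps)
    then show "c \<lfloor>x / h\<rfloor> = c (int m)" by simp
  qed simp
  from has_integral_combine[OF _ _ Suc.IH this] h
  show ?case by (simp add: algebra_simps)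
next
  case 0
  show ?case using has_integral_refl(1)[of _ "0 :: real"] by simp
qed

text \<open>By periodicity the left and the right end values each sum to the squared grid norm,
  whence the factor 2.\<close>

lemma has_integral_cells:
  assumes a: "per J a" and J: "J \<ge> 1"
  shows "((\<lambda>x. (a \<lfloor>x / mesh J\<rfloor>)\<^sup>2 + (a (\<lfloor>x / mesh J\<rfloor> + 1))\<^sup>2) has_integral 2 * (grid_norm J a)\<^sup>2) {0..2 * pi}"
proof -
  have h: "mesh J > 0" using J by (rule mesh_pos)
  have Jh: "real J * mesh J = 2 * pi" using J by (simp add: mesh_def)
  have p: "per J (\<lambda>i. (a i)\<^sup>2)" using a by (simp add: per_def)
  have re: "(\<Sum>i<J. f (int i)) = (\<Sum>i=1..int J. f (i - 1))" for f :: "int \<Rightarrow> real"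
    by (rule sum.reindex_bij_witness[of _ "\<lambda>i. nat (i - 1)" "\<lambda>i. int i + 1"]) auto
  have "(\<Sum>i<J. (a (int i))\<^sup>2) = (\<Sum>i=1..int J. (a i)\<^sup>2)"
    unfolding re[of "\<lambda>i. (a i)\<^sup>2"] using sum_shift_per'[OF p] by simp
  moreover have "(\<Sum>i<J. (a (int i + 1))\<^sup>2) = (\<Sum>i=1..int J. (a i)\<^sup>2)"
    unfolding re[of "\<lambda>i. (a (i + 1))\<^sup>2"] by simp
  moreover have "(grid_norm J a)\<^sup>2 = mesh J * (\<Sum>i=1..int J. (a i)\<^sup>2)"
    unfolding ip_self[symmetric] ip_def by (simp add: power2_eq_square)
  ultimately show ?thesis
    using has_integral_step[OF h, of "\<lambda>i. (a i)\<^sup>2 + (a (i + 1))\<^sup>2" J] unfolding Jh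
    by (simp add: sum.distrib algebra_simps)
qed

section \<open>The interpolant in space and time\<close>

lemma bilinear_pl:
  assumes "t \<ge> 0" "tstep T N > 0"
  shows "bilinear T J N V x t = pl (\<lambda>j. pl (V (nat j)) (x / mesh J)) (t / tstep T N)"
proof -
  have "0 \<le> \<lfloor>t / tstep T N\<rfloor>" using assms by simp
  then have "nat (\<lfloor>t / tstep T N\<rfloor> + 1) = Suc (nat \<lfloor>t / tstep T N\<rfloor>)" by linarith
  then show ?thesis by (simp add: bilinear_def Let_def pl_def algebra_simps)
qed

lemma continuous_bilinear:
  assumes "tstep T N > 0"
  shows "continuous_on (UNIV \<times> {0..}) (\<lambda>(x, t). bilinear T J N V x t)"
proof -
  have c: "continuous_on UNIV (\<lambda>x. pl (V (nat j)) (x / mesh J))" for j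
    by (rule continuous_on_compose2[OF continuous_pl_const]) (auto simp: divide_inverse intro!: continuous_intros)
  have "continuous_on (UNIV \<times> {0..}) (\<lambda>p. (\<lambda>(x, y). pl (\<lambda>j. pl (V (nat j)) (x / mesh J)) y) (fst p, snd p / tstep T N))"
    using assms by (intro continuous_on_compose2[OF continuous_pl[OF c]]) (auto intro!: continuous_intros)
  then show ?thesis
    by (rule continuous_on_eq) (use assms in \<open>auto simp: bilinear_pl\<close>)
qed

lemma continuous_bilinear_space:
  assumes "tstep T N > 0" "t \<ge> 0"
  shows "continuous_on S (\<lambda>x. bilinear T J N V x t)"
proof -
  have "continuous_on S (\<lambda>x. (\<lambda>(x, t). bilinear T J N V x t) (x, t))"
    using assms by (intro continuous_on_compose2[OF continuous_bilinear]) (auto intro!: continuous_intros)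
  then show ?thesis by simp
qed

text \<open>At \<open>t = T\<close> the cell index is \<open>N\<close>, and the interpolant formally
  reads level \<open>N + 1\<close> outside the grid; the second fact ensures weight zero in that
  case.\<close>

lemma time_cell:
  assumes t: "t \<in> {0..T}" and N: "N \<ge> 1" and T: "T > 0"
  defines "n \<equiv> nat \<lfloor>t / tstep T N\<rfloor>"
  shows "n \<le> N" "frac (t / tstep T N) = 0 \<or> Suc n \<le> N" "int n = \<lfloor>t / tstep T N\<rfloor>"
proof -
  have k: "tstep T N > 0" using N T by (simp add: tstep_def)
  have tk: "t / tstep T N \<le> real N" "0 \<le> t / tstep T N" using t N T by (auto simp: tstep_def field_simps)
  show i: "int n = \<lfloor>t / tstep T N\<rfloor>" using tk by (simp add: n_def)
  have "\<lfloor>t / tstep T N\<rfloor> \<le> int N" using tk by (simp add: floor_le_iff)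
  then show n: "n \<le> N" using i by linarith
  show "frac (t / tstep T N) = 0 \<or> Suc n \<le> N"
  proof (cases "n = N")
    case True
    then have "t / tstep T N = real N" using i tk by linarith
    then show ?thesis by (simp add: frac_def)
  qed (use n in simp)
qed

context periodic_solution
begin

lemma D00_continuous: "t \<in> {0..T} \<Longrightarrow> continuous_on S (\<lambda>x. D 0 0 x t)"
  by (rule DERIV_continuous_on) (use D_space[of 0 0 t] in \<open>auto intro: has_field_derivative_at_within\<close>)

text \<open>The first summand is \<open>2 * B\<close> times the constant of \<open>L1_error\<close>.
  The second collects terms of order \<open>s\<^sup>2\<close>, reduced to order \<open>s\<close> by
  \<open>s_le\<close>.\<close>

definition "C2 c = 2 * B * (2 * pi * B + pi + c\<^sup>2) + (4 * pi * B\<^sup>2 + 4 * c\<^sup>2) * (T\<^sup>2 + (2 * pi)\<^sup>2)"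

section \<open>Distance between the interpolant and the exact solution\<close>

context
  fixes J N :: nat and V :: "nat \<Rightarrow> int \<Rightarrow> real" and c k s :: real
  assumes J: "J \<ge> 1" and N: "N \<ge> 1" and k: "k = tstep T N" and s: "s = k\<^sup>2 + (mesh J)\<^sup>2" and c: "c \<ge> 0"
    and perV: "\<And>n. n \<le> N \<Longrightarrow> per J (V n)"
    and err: "\<And>n. n \<le> N \<Longrightarrow> grid_norm J (\<lambda>i. sol J (real n * k) i - V n i) \<le> c * s"
begin

lemma k_pos: "k > 0" and kN: "real N * k = T" and h_pos: "mesh J > 0" and s_pos: "s > 0"
proof -
  show k0: "k > 0" using N T_pos by (simp add: k tstep_def)
  show "real N * k = T" using N by (simp add: k tstep_def)
  show "mesh J > 0" using J by (rule mesh_pos)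
  show "s > 0" unfolding s using k0 by (simp add: add_pos_nonneg)
qed

lemma k_nodes: "n \<le> N \<Longrightarrow> real n * k \<in> {0..T}"
  using k_pos kN mult_right_mono[of "real n" "real N" k] by auto

lemma s_le: "s \<le> T\<^sup>2 + (2 * pi)\<^sup>2"
proof -
  have "k \<le> T" using kN k_pos N mult_right_mono[of 1 "real N" k] by simp
  then have "k\<^sup>2 \<le> T\<^sup>2" using k_pos by (intro power_mono) auto
  moreover have "(mesh J)\<^sup>2 \<le> (2 * pi)\<^sup>2" using mesh_le[OF J] by (intro power_mono) auto
  ultimately show ?thesis unfolding s by simp
qed

lemma space_interpolation:
  assumes x: "x \<in> {0..2 * pi}" and t: "t \<in> {0..T}"
  shows "\<bar>pl (sol J t) (x / mesh J) - D 0 0 x t\<bar> \<le> B * (mesh J)\<^sup>2"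
proof -
  let ?i = "\<lfloor>x / mesh J\<rfloor>"
  have "of_int ?i \<le> x / mesh J" "x / mesh J < of_int (?i + 1)" by linarith+
  then have b: "of_int ?i * mesh J \<le> x" "x < of_int (?i + 1) * mesh J"
    by (simp_all only: pos_le_divide_eq[OF h_pos] pos_divide_less_eq[OF h_pos])
  have "0 \<le> ?i" using x h_pos by simp
  then have b0: "0 \<le> of_int ?i * mesh J" by simp
  have e: "of_int (?i + 1) * mesh J = of_int ?i * mesh J + mesh J" by (simp add: algebra_simps)
  have m: "x \<in> {-20..40}" "of_int ?i * mesh J \<in> {-20..40}" "of_int (?i + 1) * mesh J \<in> {-20..40}"
    using b b0 x mesh_le[OF J] e h_pos pi_less_4 by auto
  have "\<bar>pl (\<lambda>i. (\<lambda>j y. D j 0 y t) 0 (of_int i * mesh J)) (x / mesh J) - (\<lambda>j y. D j 0 y t) 0 x\<bar> \<le> B * (mesh J)\<^sup>2"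
    by (rule pl_interpolation_error[where S = "{-20..40}"])
      (use m h_pos D_space_within[OF _ t] D_bound[OF _ _ t] in auto)
  then show ?thesis by (simp add: sol_def[abs_def] node_def)
qed

text \<open>The space error is taken at the two time levels, where a convex combination does not
  enlarge it, and the time error along the exact solution. Grid times are separate, as the upper
  level may then lie beyond \<open>N\<close>.\<close>

lemma exact_interpolation:
  assumes x: "x \<in> {0..2 * pi}" and t: "t \<in> {0..T}"
  shows "\<bar>bilinear T J N (\<lambda>n. sol J (real n * k)) x t - D 0 0 x t\<bar> \<le> B * s"
proof -
  define n where "n = nat \<lfloor>t / k\<rfloor>"
  define \<eta> where "\<eta> = frac (t / k)"
  have \<eta>: "0 \<le> \<eta>" "\<eta> \<le> 1" using frac_lt_1[of "t / k"] by (auto simp: \<eta>_def intro: less_imp_le)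
  note cell = time_cell[OF t N T_pos, folded k, folded n_def \<eta>_def]
  define P where "P m = pl (sol J (real m * k)) (x / mesh J)" for m
  have b: "bilinear T J N (\<lambda>n. sol J (real n * k)) x t = (1 - \<eta>) * P n + \<eta> * P (Suc n)"
    unfolding bilinear_def Let_def k[symmetric] n_def[symmetric] \<eta>_def[symmetric] P_def pl_def
    by (simp add: algebra_simps)
  have P: "\<bar>P m - D 0 0 x (real m * k)\<bar> \<le> B * (mesh J)\<^sup>2" if "m \<le> N" for m
    unfolding P_def by (rule space_interpolation[OF x k_nodes[OF that]])
  have xm: "x \<in> {-20..40}" using x pi_less_4 by auto
  show ?thesis
  proof (cases "\<eta> = 0")
    case True
    then have "t / k = of_int \<lfloor>t / k\<rfloor>" by (simp add: \<eta>_def frac_def)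
    then have "t / k = real n" using cell(3) by (metis of_int_of_nat_eq)
    then have tn: "t = real n * k" using k_pos by (simp add: field_simps)
    have "B * (mesh J)\<^sup>2 \<le> B * s" unfolding s using B_nonneg by (simp add: algebra_simps)
    then show ?thesis unfolding b using P[OF cell(1)] True tn by simp
  next
    case False
    then have n1: "Suc n \<le> N" using cell by simp
    have "\<bar>pl (\<lambda>i. (\<lambda>j y. D 0 j x y) 0 (of_int i * k)) (t / k) - (\<lambda>j y. D 0 j x y) 0 t\<bar> \<le> B * k\<^sup>2"
    proof (rule pl_interpolation_error[where S = "{0..T}" and g = "\<lambda>j y. D 0 j x y"])
      have "of_int \<lfloor>t / k\<rfloor> = real n" using cell(3) by (metis of_int_of_nat_eq)
      moreover have "of_int (\<lfloor>t / k\<rfloor> + 1) = real (Suc n)" using cell(3) by simp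
      ultimately show "of_int \<lfloor>t / k\<rfloor> * k \<in> {0..T}" "of_int (\<lfloor>t / k\<rfloor> + 1) * k \<in> {0..T}"
        using k_nodes[of n] k_nodes[of "Suc n"] n1 by (auto simp: add.commute)
    qed (use t k_pos D_time D_bound[OF _ xm] in auto)
    moreover have "pl (\<lambda>i. (\<lambda>j y. D 0 j x y) 0 (of_int i * k)) (t / k)
        = (1 - \<eta>) * D 0 0 x (real n * k) + \<eta> * D 0 0 x (real (Suc n) * k)"
    proof -
      have "of_int \<lfloor>t / k\<rfloor> = real n" using cell(3) by (metis of_int_of_nat_eq)
      then show ?thesis unfolding pl_def \<eta>_def by (simp add: add.commute)
    qed
    ultimately have 1: "\<bar>(1 - \<eta>) * D 0 0 x (real n * k) + \<eta> * D 0 0 x (real (Suc n) * k) - D 0 0 x t\<bar> \<le> B * k\<^sup>2"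
      by simp
    have "(1 - \<eta>) * \<bar>P n - D 0 0 x (real n * k)\<bar> + \<eta> * \<bar>P (Suc n) - D 0 0 x (real (Suc n) * k)\<bar>
        \<le> (1 - \<eta>) * (B * (mesh J)\<^sup>2) + \<eta> * (B * (mesh J)\<^sup>2)"
      using \<eta> P[OF cell(1)] P[OF n1] by (intro add_mono mult_left_mono) auto
    also have "\<dots> = B * (mesh J)\<^sup>2" by (simp add: algebra_simps)
    finally have 2: "\<bar>(1 - \<eta>) * (P n - D 0 0 x (real n * k)) + \<eta> * (P (Suc n) - D 0 0 x (real (Suc n) * k))\<bar>
        \<le> B * (mesh J)\<^sup>2"
      using \<eta> abs_triangle_ineq[of "(1 - \<eta>) * (P n - D 0 0 x (real n * k))" "\<eta> * (P (Suc n) - D 0 0 x (real (Suc n) * k))"]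
      by (simp add: abs_mult)
    have "(1 - \<eta>) * P n + \<eta> * P (Suc n) - D 0 0 x t
      = ((1 - \<eta>) * (P n - D 0 0 x (real n * k)) + \<eta> * (P (Suc n) - D 0 0 x (real (Suc n) * k)))
        + ((1 - \<eta>) * D 0 0 x (real n * k) + \<eta> * D 0 0 x (real (Suc n) * k) - D 0 0 x t)"
      by (simp add: algebra_simps)
    then have "\<bar>(1 - \<eta>) * P n + \<eta> * P (Suc n) - D 0 0 x t\<bar> \<le> B * (mesh J)\<^sup>2 + B * k\<^sup>2"
      using 1 2 by (simp only: order_trans[OF abs_triangle_ineq add_mono])
    then show ?thesis unfolding b s by (simp add: algebra_simps)
  qed
qed

abbreviation "Vb \<equiv> bilinear T J N V"

text \<open>Here \<open>e\<close> is the value of the interpolant of the nodal errors, and \<open>g\<close> is a step function.\<close>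

lemma error_majorant:
  assumes t: "t \<in> {0..T}"
  shows "\<exists>g I. (g has_integral I) {0..2 * pi} \<and> I \<le> 2 * (c * s)\<^sup>2 \<and>
    (\<forall>x\<in>{0..2 * pi}. \<exists>e. \<bar>D 0 0 x t - Vb x t\<bar> \<le> B * s + \<bar>e\<bar> \<and> e\<^sup>2 \<le> g x)"
proof -
  define n where "n = nat \<lfloor>t / k\<rfloor>"
  define \<eta> where "\<eta> = frac (t / k)"
  have \<eta>: "0 \<le> \<eta>" "\<eta> \<le> 1" using frac_lt_1[of "t / k"] by (auto simp: \<eta>_def intro: less_imp_le)
  note cell = time_cell[OF t N T_pos, folded k, folded n_def \<eta>_def]
  define E where "E m i = sol J (real m * k) i - V m i" for m i
  \<comment> \<open>Replaces the upper level by \<open>n\<close> when its weight is zero, so that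
    error bounds are used inside the grid only.\<close>
  define m where "m = (if \<eta> = 0 then n else Suc n)"
  have m: "m \<le> N" "\<eta> * f m = \<eta> * f (Suc n)" for f :: "nat \<Rightarrow> real" using cell by (auto simp: m_def)
  define q where "q m x = (E m \<lfloor>x / mesh J\<rfloor>)\<^sup>2 + (E m (\<lfloor>x / mesh J\<rfloor> + 1))\<^sup>2" for m x
  have pE: "per J (E m)" if "m \<le> N" for m
    unfolding E_def[abs_def] using per_sol[OF k_nodes[OF that] J] perV[OF that] by (rule per_diff)
  have nE: "(grid_norm J (E m))\<^sup>2 \<le> (c * s)\<^sup>2" if "m \<le> N" for m
    unfolding E_def[abs_def] by (intro power_mono err that) simp
  \<comment> \<open>The integral of this step function is explicit in the grid norms, and by
    convexity of the square, first in time and then in space, it dominates the squared interpolant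
    of the nodal errors.\<close>
  have "((\<lambda>x. (1 - \<eta>) * q n x + \<eta> * q m x) has_integral
      (1 - \<eta>) * (2 * (grid_norm J (E n))\<^sup>2) + \<eta> * (2 * (grid_norm J (E m))\<^sup>2)) {0..2 * pi}"
    unfolding q_def using has_integral_cells[OF pE[OF cell(1)] J] has_integral_cells[OF pE[OF m(1)] J]
    by (intro has_integral_add has_integral_mult_right)
  moreover have "(1 - \<eta>) * (2 * (grid_norm J (E n))\<^sup>2) + \<eta> * (2 * (grid_norm J (E m))\<^sup>2)
      \<le> (1 - \<eta>) * (2 * (c * s)\<^sup>2) + \<eta> * (2 * (c * s)\<^sup>2)"
    using nE[OF cell(1)] nE[OF m(1)] \<eta> by (intro add_mono mult_left_mono) auto
  moreover have "(1 - \<eta>) * (2 * (c * s)\<^sup>2) + \<eta> * (2 * (c * s)\<^sup>2) = 2 * (c * s)\<^sup>2" by (simp add: algebra_simps)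
  moreover have "\<exists>e. \<bar>D 0 0 x t - Vb x t\<bar> \<le> B * s + \<bar>e\<bar> \<and> e\<^sup>2 \<le> (1 - \<eta>) * q n x + \<eta> * q m x"
    if x: "x \<in> {0..2 * pi}" for x
  proof (intro exI conjI)
    define P where "P m = pl (E m) (x / mesh J)" for m
    let ?e = "bilinear T J N E x t"
    have lin: "bilinear T J N (\<lambda>n. sol J (real n * k)) x t = ?e + Vb x t"
      unfolding bilinear_def Let_def E_def by (simp add: algebra_simps)
    show "\<bar>D 0 0 x t - Vb x t\<bar> \<le> B * s + \<bar>?e\<bar>"
      using exact_interpolation[OF x t] unfolding lin by linarith
    have tk: "t \<ge> 0" "tstep T N > 0" using t k_pos k by auto
    have nn: "nat \<lfloor>t / k\<rfloor> = n" "nat (\<lfloor>t / k\<rfloor> + 1) = Suc n"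
      using cell(3) by (simp add: n_def, linarith)
    have "?e\<^sup>2 \<le> (1 - \<eta>) * (P n)\<^sup>2 + \<eta> * (P (Suc n))\<^sup>2"
      using pl_square_le[of "\<lambda>j. pl (E (nat j)) (x / mesh J)" "t / k"]
      unfolding bilinear_pl[OF tk] k[symmetric] nn \<eta>_def[symmetric] P_def .
    also have "\<dots> = (1 - \<eta>) * (P n)\<^sup>2 + \<eta> * (P m)\<^sup>2" by (simp only: m(2)[of "\<lambda>m. (P m)\<^sup>2"])
    also have "\<dots> \<le> (1 - \<eta>) * q n x + \<eta> * q m x"
      unfolding P_def q_def using \<eta> pl_square_le_sum by (intro add_mono mult_left_mono) auto
    finally show "?e\<^sup>2 \<le> (1 - \<eta>) * q n x + \<eta> * q m x" .
  qed
  ultimately show ?thesis by (metis (no_types, lifting))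
qed

lemma Vb_continuous: "t \<in> {0..T} \<Longrightarrow> continuous_on S (\<lambda>x. Vb x t)"
  by (rule continuous_bilinear_space) (use k_pos k in auto)

text \<open>Young's inequality with weight \<open>s\<close>, namely
  \<open>\<bar>e\<bar> \<le> s / 2 + e\<^sup>2 / (2 * s)\<close>, turns the bound of order
  \<open>s\<^sup>2\<close> on the integral of the squares into one of order
  \<open>s\<close>.\<close>

lemma L1_error:
  assumes t: "t \<in> {0..T}"
  shows "integral {0..2 * pi} (\<lambda>x. \<bar>D 0 0 x t - Vb x t\<bar>) \<le> (2 * pi * B + pi + c\<^sup>2) * s"
proof -
  obtain g I where g: "(g has_integral I) {0..2 * pi}" and I: "I \<le> 2 * (c * s)\<^sup>2" and
    ge: "\<forall>x\<in>{0..2 * pi}. \<exists>e. \<bar>D 0 0 x t - Vb x t\<bar> \<le> B * s + \<bar>e\<bar> \<and> e\<^sup>2 \<le> g x"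
    using error_majorant[OF t] by blast
  let ?f = "\<lambda>x. \<bar>D 0 0 x t - Vb x t\<bar>"
  have "continuous_on {0..2 * pi} ?f"
    by (intro continuous_intros D00_continuous Vb_continuous t)
  then have f: "(?f has_integral integral {0..2 * pi} ?f) {0..2 * pi}"
    by (intro integrable_integral integrable_continuous_real)
  have "((\<lambda>x. (B * s + s / 2) + g x / (2 * s)) has_integral (B * s + s / 2) * (2 * pi - 0) + I / (2 * s)) {0..2 * pi}"
    using g has_integral_const_real[of "B * s + s / 2" 0 "2 * pi"]
    by (intro has_integral_add has_integral_divide) (auto simp: mult.commute)
  note dom = this
  have "?f x \<le> (B * s + s / 2) + g x / (2 * s)" if x: "x \<in> {0..2 * pi}" for x
  proof -
    obtain e where e: "\<bar>D 0 0 x t - Vb x t\<bar> \<le> B * s + \<bar>e\<bar>" "e\<^sup>2 \<le> g x" using ge x by blast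
    have "\<bar>e\<bar> \<le> s / 2 + e\<^sup>2 / (2 * s)"
      using young[OF s_pos, of 1 "\<bar>e\<bar>"] by simp
    also have "e\<^sup>2 / (2 * s) \<le> g x / (2 * s)" using e s_pos by (intro divide_right_mono) auto
    finally show ?thesis using e by simp
  qed
  from has_integral_le[OF f dom this]
  have "integral {0..2 * pi} ?f \<le> (B * s + s / 2) * (2 * pi - 0) + I / (2 * s)" .
  also have "I / (2 * s) \<le> 2 * (c * s)\<^sup>2 / (2 * s)" using I s_pos by (intro divide_right_mono) auto
  also have "2 * (c * s)\<^sup>2 / (2 * s) = c\<^sup>2 * s" using s_pos by (simp add: power2_eq_square)
  finally show ?thesis by (simp add: algebra_simps)
qed

text \<open>Written as \<open>2 * D * d - d\<^sup>2\<close> with \<open>d\<close> the pointwise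
  error: the linear part needs only \<open>L1_error\<close> and the bound for the exact solution,
  the square is covered by the majorant. No pointwise bound for the interpolant enters.\<close>

lemma squares_error:
  assumes t: "t \<in> {0..T}"
  shows "\<bar>integral {0..2 * pi} (\<lambda>x. (D 0 0 x t)\<^sup>2) - integral {0..2 * pi} (\<lambda>x. (Vb x t)\<^sup>2)\<bar> \<le> C2 c * s"
proof -
  obtain g I where g: "(g has_integral I) {0..2 * pi}" and I: "I \<le> 2 * (c * s)\<^sup>2" and
    ge: "\<forall>x\<in>{0..2 * pi}. \<exists>e. \<bar>D 0 0 x t - Vb x t\<bar> \<le> B * s + \<bar>e\<bar> \<and> e\<^sup>2 \<le> g x"
    using error_majorant[OF t] by blast
  let ?f = "\<lambda>x. \<bar>D 0 0 x t - Vb x t\<bar>"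
  have c1: "continuous_on {0..2 * pi} (\<lambda>x. D 0 0 x t)" and c2: "continuous_on {0..2 * pi} (\<lambda>x. Vb x t)"
    by (intro D00_continuous Vb_continuous t)+
  have int: "(\<lambda>x. (D 0 0 x t)\<^sup>2) integrable_on {0..2 * pi}" "(\<lambda>x. (Vb x t)\<^sup>2) integrable_on {0..2 * pi}"
     "?f integrable_on {0..2 * pi}"
    by (intro integrable_continuous_real continuous_intros c1 c2)+
  have dom: "((\<lambda>x. 2 * B * ?f x + (2 * (B * s)\<^sup>2 + 2 * g x)) has_integral
      2 * B * integral {0..2 * pi} ?f + (2 * (B * s)\<^sup>2 * (2 * pi - 0) + 2 * I)) {0..2 * pi}"
    using g integrable_integral[OF int(3)] has_integral_const_real[of "2 * (B * s)\<^sup>2" 0 "2 * pi"]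
    by (intro has_integral_add has_integral_mult_right) (auto simp: mult_ac)
  have "\<bar>integral {0..2 * pi} (\<lambda>x. (D 0 0 x t)\<^sup>2) - integral {0..2 * pi} (\<lambda>x. (Vb x t)\<^sup>2)\<bar>
      = norm (integral {0..2 * pi} (\<lambda>x. (D 0 0 x t)\<^sup>2 - (Vb x t)\<^sup>2))"
    using int by (simp add: integral_diff)
  also have "\<dots> \<le> integral {0..2 * pi} (\<lambda>x. 2 * B * ?f x + (2 * (B * s)\<^sup>2 + 2 * g x))"
  proof (rule integral_norm_bound_integral)
    show "(\<lambda>x. (D 0 0 x t)\<^sup>2 - (Vb x t)\<^sup>2) integrable_on {0..2 * pi}" using int by (intro integrable_diff)
    show "(\<lambda>x. 2 * B * ?f x + (2 * (B * s)\<^sup>2 + 2 * g x)) integrable_on {0..2 * pi}"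
      using dom by blast
    fix x assume x: "x \<in> {0..2 * pi}"
    then obtain e where e: "\<bar>D 0 0 x t - Vb x t\<bar> \<le> B * s + \<bar>e\<bar>" "e\<^sup>2 \<le> g x" using ge by blast
    define d where "d = D 0 0 x t - Vb x t"
    have "x \<in> {-20..40}" using x pi_less_4 by auto
    then have Db: "\<bar>D 0 0 x t\<bar> \<le> B" using D_bound[of 0 0 x t] t by simp
    have "(D 0 0 x t)\<^sup>2 - (Vb x t)\<^sup>2 = 2 * D 0 0 x t * d - d\<^sup>2"
      by (simp add: d_def power2_eq_square algebra_simps)
    then have "\<bar>(D 0 0 x t)\<^sup>2 - (Vb x t)\<^sup>2\<bar> \<le> \<bar>2 * D 0 0 x t * d\<bar> + d\<^sup>2"
      using abs_triangle_ineq4[of "2 * D 0 0 x t * d" "d\<^sup>2"] by simp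
    also have "\<bar>2 * D 0 0 x t * d\<bar> \<le> 2 * B * \<bar>d\<bar>" unfolding abs_mult using Db by (intro mult_right_mono) auto
    also have "d\<^sup>2 \<le> 2 * (B * s)\<^sup>2 + 2 * g x"
    proof -
      have "\<bar>d\<bar>\<^sup>2 \<le> (B * s + \<bar>e\<bar>)\<^sup>2" using e by (intro power_mono) (auto simp: d_def)
      also have "\<dots> \<le> 2 * (B * s)\<^sup>2 + 2 * \<bar>e\<bar>\<^sup>2"
      proof -
        have "(p + r)\<^sup>2 \<le> 2 * p\<^sup>2 + 2 * r\<^sup>2" for p r :: real
          using zero_le_power2[of "p - r"] by (simp add: power2_eq_square algebra_simps)
        then show ?thesis .
      qed
      finally show ?thesis using e(2) by simp
    qed
    finally show "norm ((D 0 0 x t)\<^sup>2 - (Vb x t)\<^sup>2) \<le> 2 * B * ?f x + (2 * (B * s)\<^sup>2 + 2 * g x)"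
      by (simp add: d_def)
  qed
  also have "\<dots> = 2 * B * integral {0..2 * pi} ?f + (2 * (B * s)\<^sup>2 * (2 * pi - 0) + 2 * I)"
    using dom by (rule integral_unique)
  also have "\<dots> \<le> 2 * B * ((2 * pi * B + pi + c\<^sup>2) * s) + (2 * (B * s)\<^sup>2 * (2 * pi - 0) + 2 * (2 * (c * s)\<^sup>2))"
    using L1_error[OF t] I B_nonneg by (intro add_mono mult_left_mono order_refl) auto
  also have "\<dots> = 2 * B * (2 * pi * B + pi + c\<^sup>2) * s + (4 * pi * B\<^sup>2 + 4 * c\<^sup>2) * s * s"
    by (simp add: power2_eq_square algebra_simps)
  also have "\<dots> \<le> 2 * B * (2 * pi * B + pi + c\<^sup>2) * s + (4 * pi * B\<^sup>2 + 4 * c\<^sup>2) * (T\<^sup>2 + (2 * pi)\<^sup>2) * s"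
    using s_le s_pos by (intro add_left_mono mult_right_mono mult_left_mono) auto
  also have "\<dots> = C2 c * s" by (simp add: C2_def algebra_simps)
  finally show ?thesis .
qed

end

end

section \<open>Reconstruction\<close>

text \<open>Since \<open>D\<close> holds the derivatives of \<open>v\<close>, the equation for
  \<open>u\<close> is stated with \<open>D 3 0\<close> for the fourth and \<open>D 1 0\<close> for
  the second space derivative of \<open>u\<close>.\<close>

locale reconstructible_solution = periodic_solution +
  fixes u ut :: "real \<Rightarrow> real \<Rightarrow> real" and R' :: "real \<Rightarrow> real"
  assumes R_deriv: "\<And>t. t \<in> {0..T} \<Longrightarrow> (R has_real_derivative R' t) (at t within {0..T})"
    and R_ode: "\<And>t. t \<in> {0..T} \<Longrightarrow> R' t = v\<^sub>c + (\<alpha> - 1) / R t"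
    and R'_pos: "\<And>t. t \<in> {0..T} \<Longrightarrow> R' t > 0"
    and u_space: "\<And>x t. t \<in> {0..T} \<Longrightarrow> ((\<lambda>s. u s t) has_real_derivative D 0 0 x t) (at x)"
    and u_time: "\<And>x t. t \<in> {0..T} \<Longrightarrow> ((\<lambda>s. u x s) has_real_derivative ut x t) (at t within {0..T})"
    and u_per: "\<And>x t. t \<in> {0..T} \<Longrightarrow> u (x + 2 * pi) t = u x t"
    and ut_cont: "continuous_on (UNIV \<times> {0..T}) (\<lambda>(x, t). ut x t)"
    and D00_cont: "continuous_on (UNIV \<times> {0..T}) (\<lambda>(x, t). D 0 0 x t)"
    and u_pde: "\<And>x t. t \<in> {0..T} \<Longrightarrow> ut x t + \<delta> / R t ^ 4 * D 3 0 x t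
      + 1 / (R t)\<^sup>2 * (\<alpha> - 1 + \<delta> / (R t)\<^sup>2) * D 1 0 x t + (\<alpha> - 1) / (R t)\<^sup>2 * u x t
      - v\<^sub>c / (2 * (R t)\<^sup>2) * (D 0 0 x t)\<^sup>2 = 0"
begin

section \<open>Evolution of the mean, and recovery of \<open>u\<close> from \<open>v\<close>\<close>

definition mean :: "real \<Rightarrow> real" where
  "mean t = 1 / (2 * pi) * integral {0..2 * pi} (\<lambda>x. u x t)"

definition energy :: "real \<Rightarrow> real" where
  "energy t = integral {0..2 * pi} (\<lambda>x. (D 0 0 x t)\<^sup>2)"

lemma R_pos: "t \<in> {0..T} \<Longrightarrow> R t > 0"
  using R[of t] r0 by auto

text \<open>Periodicity is inherited by derivatives through their uniqueness.\<close>

lemma D_space_periodic: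
  assumes t: "t \<in> {0..T}" and p: "p \<le> 5"
  shows "D p 0 (x + 2 * pi) t = D p 0 x t"
  using p
proof (induction p arbitrary: x)
  case 0
  then show ?case using D_periodic[OF t] by simp
next
  case (Suc p)
  have "((\<lambda>s. D p 0 s t) has_real_derivative D (Suc p) 0 (x + 2 * pi) t) (at (x + 2 * pi))"
    using Suc D_space[of p 0 t] t by simp
  then have "((\<lambda>s. D p 0 (s + 2 * pi) t) has_real_derivative D (Suc p) 0 (x + 2 * pi) t) (at x)"
    by (simp only: DERIV_shift)
  moreover have "(\<lambda>s. D p 0 (s + 2 * pi) t) = (\<lambda>s. D p 0 s t)" using Suc by auto
  moreover have "((\<lambda>s. D p 0 s t) has_real_derivative D (Suc p) 0 x t) (at x)"
    using Suc D_space[of p 0 t] t by simp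
  ultimately show ?case using DERIV_unique by metis
qed

lemma has_integral_D_period:
  assumes t: "t \<in> {0..T}" and p: "p \<le> 4"
  shows "((\<lambda>x. D (Suc p) 0 x t) has_integral 0) {0..2 * pi}"
proof -
  have "((\<lambda>x. D (Suc p) 0 x t) has_integral D p 0 (2 * pi) t - D p 0 0 t) {0..2 * pi}"
    using D_space[of p 0 t] t p
    by (intro fundamental_theorem_of_calculus)
      (auto simp: has_real_derivative_iff_has_vector_derivative[symmetric] intro: has_field_derivative_at_within)
  then show ?thesis using D_space_periodic[OF t, of p 0] p by simp
qed

lemma u_continuous: "t \<in> {0..T} \<Longrightarrow> continuous_on S (\<lambda>x. u x t)"
  by (rule DERIV_continuous_on) (use u_space in \<open>auto intro: has_field_derivative_at_within\<close>)

text \<open>Integrating the equation over a period removes the terms that are space derivatives of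
  periodic functions; only the zeroth order term and the square remain.\<close>

lemma mean_deriv:
  assumes t: "t \<in> {0..T}"
  shows "(mean has_real_derivative - ((\<alpha> - 1) / (R t)\<^sup>2) * mean t + v\<^sub>c / (4 * pi * (R t)\<^sup>2) * energy t)
    (at t within {0..T})"
proof -
  have "((\<lambda>s. integral (cbox 0 (2 * pi)) (\<lambda>x. u x s)) has_real_derivative
      integral (cbox 0 (2 * pi)) (\<lambda>x. ut x t)) (at t within {0..T})"
  proof (rule leibniz_rule_field_derivative[where f = "\<lambda>s x. u x s" and fx = "\<lambda>s x. ut x s"])
    show "continuous_on ({0..T} \<times> cbox 0 (2 * pi)) (\<lambda>(s, x). ut x s)"
    proof -
      have "continuous_on ({0..T} \<times> cbox 0 (2 * pi)) (\<lambda>p. (\<lambda>(x, t). ut x t) (snd p, fst p))"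
        by (intro continuous_intros continuous_on_compose2[OF ut_cont]) auto
      then show ?thesis by (simp add: split_beta)
    qed
  qed (use t u_time u_continuous in \<open>auto intro: integrable_continuous_real\<close>)
  then have deriv: "(mean has_real_derivative 1 / (2 * pi) * integral {0..2 * pi} (\<lambda>x. ut x t)) (at t within {0..T})"
    unfolding mean_def[abs_def] by (intro DERIV_cmult) simp
  have "((\<lambda>x. v\<^sub>c / (2 * (R t)\<^sup>2) * (D 0 0 x t)\<^sup>2 - (\<alpha> - 1) / (R t)\<^sup>2 * u x t
        - \<delta> / R t ^ 4 * D (Suc 2) 0 x t - 1 / (R t)\<^sup>2 * (\<alpha> - 1 + \<delta> / (R t)\<^sup>2) * D (Suc 0) 0 x t) has_integral
      v\<^sub>c / (2 * (R t)\<^sup>2) * energy t - (\<alpha> - 1) / (R t)\<^sup>2 * (2 * pi * mean t)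
        - \<delta> / R t ^ 4 * 0 - 1 / (R t)\<^sup>2 * (\<alpha> - 1 + \<delta> / (R t)\<^sup>2) * 0) {0..2 * pi}"
  proof (intro has_integral_diff has_integral_mult_right)
    show "((\<lambda>x. (D 0 0 x t)\<^sup>2) has_integral energy t) {0..2 * pi}"
      unfolding energy_def
      by (intro integrable_integral integrable_continuous_real continuous_intros D00_continuous t)
    have "((\<lambda>x. u x t) has_integral integral {0..2 * pi} (\<lambda>x. u x t)) {0..2 * pi}"
      by (intro integrable_integral integrable_continuous_real u_continuous t)
    then show "((\<lambda>x. u x t) has_integral 2 * pi * mean t) {0..2 * pi}" by (simp add: mean_def)
  qed (use has_integral_D_period[OF t, of 2] has_integral_D_period[OF t, of 0] in auto)
  moreover have "v\<^sub>c / (2 * (R t)\<^sup>2) * (D 0 0 x t)\<^sup>2 - (\<alpha> - 1) / (R t)\<^sup>2 * u x t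
        - \<delta> / R t ^ 4 * D (Suc 2) 0 x t - 1 / (R t)\<^sup>2 * (\<alpha> - 1 + \<delta> / (R t)\<^sup>2) * D (Suc 0) 0 x t = ut x t" for x
    using u_pde[OF t, of x] unfolding One_nat_def numeral_3_eq_3 numeral_2_eq_2 by linarith
  ultimately have "((\<lambda>x. ut x t) has_integral
      v\<^sub>c / (2 * (R t)\<^sup>2) * energy t - (\<alpha> - 1) / (R t)\<^sup>2 * (2 * pi * mean t)) {0..2 * pi}"
    by simp
  note ut_integral = integral_unique[OF this]
  have "1 / (2 * pi) * (v\<^sub>c / (2 * (R t)\<^sup>2) * energy t - (\<alpha> - 1) / (R t)\<^sup>2 * (2 * pi * mean t))
      = - ((\<alpha> - 1) / (R t)\<^sup>2) * mean t + v\<^sub>c / (4 * pi * (R t)\<^sup>2) * energy t"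
    using R_pos[OF t] by (simp add: field_simps)
  then show ?thesis using deriv unfolding ut_integral by simp
qed

definition weight :: "real \<Rightarrow> real" where
  "weight t = 1 / (R' t * (R t)\<^sup>2)"

lemma R_continuous: "continuous_on {0..T} R"
  by (rule DERIV_continuous_on) (rule R_deriv)

lemma R'_continuous: "continuous_on {0..T} R'"
proof -
  have "continuous_on {0..T} (\<lambda>t. v\<^sub>c + (\<alpha> - 1) / R t)"
    using R_pos by (intro continuous_intros R_continuous) fastforce
  then show ?thesis by (rule continuous_on_eq) (simp add: R_ode)
qed

lemma weight_continuous: "continuous_on {0..T} weight"
  unfolding weight_def[abs_def]
  using R_pos R'_pos by (intro continuous_intros R_continuous R'_continuous) fastforce

lemma energy_continuous: "continuous_on {0..T} energy"
proof -
  have "continuous_on ({0..T} \<times> cbox 0 (2 * pi)) (\<lambda>p. ((\<lambda>(x, t). D 0 0 x t) (snd p, fst p))\<^sup>2)"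
    by (intro continuous_intros continuous_on_compose2[OF D00_cont]) auto
  then have "continuous_on ({0..T} \<times> cbox 0 (2 * pi)) (\<lambda>(t, x). (D 0 0 x t)\<^sup>2)"
    by (simp add: split_beta)
  from integral_continuous_on_param[OF this] show ?thesis
    by (simp add: energy_def[abs_def])
qed

text \<open>By \<open>mean_integrating_factor\<close> the quotient \<open>mean / R'\<close> has a
  derivative that involves only \<open>weight\<close> and \<open>energy\<close>, and is recovered by
  one integration. The result has the shape of \<open>I_tilde\<close> with the exact energy.\<close>

lemma mean_formula:
  assumes t: "t \<in> {0..T}"
  shows "mean t = R' t / R' 0 * (mean 0 + v\<^sub>c * R' 0 / (4 * pi) * integral {0..t} (\<lambda>\<tau>. weight \<tau> * energy \<tau>))"
proof -
  have deriv: "((\<lambda>s. mean s / R' s) has_real_derivative v\<^sub>c / (4 * pi) * (weight s * energy s)) (at s within {0..t})"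
    if s: "s \<in> {0..t}" for s
  proof -
    have sT: "s \<in> {0..T}" using s t by auto
    have "((\<lambda>s. mean s / R' s) has_real_derivative v\<^sub>c / (4 * pi * (R s)\<^sup>2) * energy s / R' s) (at s within {0..T})"
      by (rule mean_integrating_factor[where R = R and \<alpha> = \<alpha> and v\<^sub>c = v\<^sub>c])
        (use R_deriv[OF sT] R_ode R_pos[OF sT] R'_pos[OF sT] sT mean_deriv[OF sT] in auto)
    then have "((\<lambda>s. mean s / R' s) has_real_derivative v\<^sub>c / (4 * pi * (R s)\<^sup>2) * energy s / R' s) (at s within {0..t})"
      by (rule DERIV_subset) (use t in auto)
    then show ?thesis by (simp add: weight_def mult_ac)
  qed
  have "((\<lambda>\<tau>. v\<^sub>c / (4 * pi) * (weight \<tau> * energy \<tau>)) has_integral mean t / R' t - mean 0 / R' 0) {0..t}"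
    using t deriv by (intro fundamental_theorem_of_calculus)
      (auto simp: has_real_derivative_iff_has_vector_derivative[symmetric])
  moreover have "((\<lambda>\<tau>. v\<^sub>c / (4 * pi) * (weight \<tau> * energy \<tau>)) has_integral
      v\<^sub>c / (4 * pi) * integral {0..t} (\<lambda>\<tau>. weight \<tau> * energy \<tau>)) {0..t}"
    using t by (intro has_integral_mult_right integrable_integral integrable_continuous_real continuous_intros
        continuous_on_subset[OF weight_continuous] continuous_on_subset[OF energy_continuous]) auto
  ultimately have "mean t / R' t - mean 0 / R' 0 = v\<^sub>c / (4 * pi) * integral {0..t} (\<lambda>\<tau>. weight \<tau> * energy \<tau>)"
    by (rule has_integral_unique)
  then have "mean t / R' t = mean 0 / R' 0 + v\<^sub>c / (4 * pi) * integral {0..t} (\<lambda>\<tau>. weight \<tau> * energy \<tau>)"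
    by simp
  then have "R' t * (mean t / R' t) = R' t * (mean 0 / R' 0 + v\<^sub>c / (4 * pi) * integral {0..t} (\<lambda>\<tau>. weight \<tau> * energy \<tau>))"
    by simp
  moreover have "R' t * (mean t / R' t) = mean t" using R'_pos[OF t] by simp
  moreover have "R' 0 > 0" using R'_pos[of 0] T_pos by simp
  ultimately show ?thesis by (simp add: field_simps)
qed

text \<open>The integral of \<open>v\<close> gives \<open>u\<close> up to the constant
  \<open>u 0 t\<close>, and averaging over a period expresses this constant by the mean. The
  reconstruction is the same formula with the interpolant and \<open>I_tilde\<close>
  inserted.\<close>

lemma u_formula:
  assumes t: "t \<in> {0..T}" and x: "x \<ge> 0"
  shows "u x t = mean t - 1 / (2 * pi) * integral {0..2 * pi} (\<lambda>s. integral {0..s} (\<lambda>y. D 0 0 y t))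
    + integral {0..x} (\<lambda>y. D 0 0 y t)"
proof -
  have int: "integral {0..s} (\<lambda>y. D 0 0 y t) = u s t - u 0 t" if "s \<ge> 0" for s
    by (rule integral_unique, rule fundamental_theorem_of_calculus)
      (use that u_space[OF t] in \<open>auto simp: has_real_derivative_iff_has_vector_derivative[symmetric]
        intro: has_field_derivative_at_within\<close>)
  have "integral {0..2 * pi} (\<lambda>s. integral {0..s} (\<lambda>y. D 0 0 y t)) = integral {0..2 * pi} (\<lambda>s. u s t - u 0 t)"
    by (rule integral_cong) (simp add: int)
  also have "\<dots> = integral {0..2 * pi} (\<lambda>s. u s t) - integral {0..2 * pi} (\<lambda>s. u 0 t)"
    by (intro integral_diff integrable_continuous_real u_continuous t continuous_on_const)
  also have "\<dots> = 2 * pi * mean t - 2 * pi * u 0 t" by (simp add: mean_def)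
  finally have e: "integral {0..2 * pi} (\<lambda>s. integral {0..s} (\<lambda>y. D 0 0 y t)) = 2 * pi * (mean t - u 0 t)"
    by (simp add: algebra_simps)
  show ?thesis unfolding e int[OF x] by simp
qed

lemma bounds_exist: "\<exists>K\<ge>0. \<forall>t\<in>{0..T}. \<bar>R' t\<bar> \<le> K \<and> \<bar>weight t\<bar> \<le> K"
proof -
  have "bounded (R' ` {0..T})" "bounded (weight ` {0..T})"
    by (intro compact_imp_bounded compact_continuous_image R'_continuous weight_continuous compact_Icc)+
  then obtain K1 K2 where "\<forall>t\<in>{0..T}. \<bar>R' t\<bar> \<le> K1" "\<forall>t\<in>{0..T}. \<bar>weight t\<bar> \<le> K2"
    unfolding bounded_iff by auto
  then have "\<forall>t\<in>{0..T}. \<bar>R' t\<bar> \<le> \<bar>K1\<bar> + \<bar>K2\<bar> \<and> \<bar>weight t\<bar> \<le> \<bar>K1\<bar> + \<bar>K2\<bar>" by fastforce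
  then show ?thesis by (intro exI[of _ "\<bar>K1\<bar> + \<bar>K2\<bar>"]) auto
qed

text \<open>Subtracting \<open>u_formula\<close> from the reconstruction leaves three differences:
  the means, controlled by \<open>squares_error\<close> under the time integral, and two terms
  linear in the interpolant, each controlled by \<open>L1_error\<close>.\<close>

lemma reconstruction_error:
  assumes J: "J \<ge> 1" and N: "N \<ge> 1" and k: "k = tstep T N" and s: "s = k\<^sup>2 + (mesh J)\<^sup>2" and c: "c \<ge> 0"
    and perV: "\<And>n. n \<le> N \<Longrightarrow> per J (V n)"
    and err: "\<And>n. n \<le> N \<Longrightarrow> grid_norm J (\<lambda>i. sol J (real n * k) i - V n i) \<le> c * s"
    and K: "K \<ge> 0" "\<forall>t\<in>{0..T}. \<bar>R' t\<bar> \<le> K \<and> \<bar>weight t\<bar> \<le> K"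
    and n: "n \<le> N" and i: "i \<in> {1..int J}"
  shows "\<bar>u (node J i) (real n * k) - reconstruction v\<^sub>c T R R' (\<lambda>x. u x 0) J N V n i\<bar>
    \<le> (K * (\<bar>v\<^sub>c\<bar> / (4 * pi) * (T * (K * C2 c))) + 2 * (2 * pi * B + pi + c\<^sup>2)) * s"
proof (cases "n = 0")
  note ctx = J N k s c perV err
  have s0: "s > 0" by (rule s_pos[OF ctx])
  have C20: "C2 c \<ge> 0" unfolding C2_def using B_nonneg c by simp
  case True
  have "0 \<le> (K * (\<bar>v\<^sub>c\<bar> / (4 * pi) * (T * (K * C2 c))) + 2 * (2 * pi * B + pi + c\<^sup>2)) * s"
    using s0 C20 K T_pos B_nonneg by (intro mult_nonneg_nonneg add_nonneg_nonneg) auto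
  then show ?thesis using True by (simp add: reconstruction_def restrict_grid_def)
next
  case False
  note ctx = J N k s c perV err
  have s0: "s > 0" by (rule s_pos[OF ctx])
  have C20: "C2 c \<ge> 0" unfolding C2_def using B_nonneg c by simp
  define C1' where "C1' = 2 * pi * B + pi + c\<^sup>2"
  define t where "t = real n * k"
  have t: "t \<in> {0..T}" unfolding t_def by (rule k_nodes[OF ctx n])
  let ?V = "bilinear T J N V"
  define energy' where "energy' \<tau> = integral {0..2 * pi} (\<lambda>x. (?V x \<tau>)\<^sup>2)" for \<tau>
  have e'c: "continuous_on {0..T} energy'"
  proof -
    have k0: "tstep T N > 0" using k_pos[OF ctx] k by simp
    have "continuous_on ({0..T} \<times> cbox 0 (2 * pi)) (\<lambda>p. ((\<lambda>(x, t). ?V x t) (snd p, fst p))\<^sup>2)"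
      by (intro continuous_intros continuous_on_compose2[OF continuous_bilinear[OF k0]]) auto
    then have "continuous_on ({0..T} \<times> cbox 0 (2 * pi)) (\<lambda>(t, x). (?V x t)\<^sup>2)"
      by (simp add: split_beta)
    from integral_continuous_on_param[OF this] show ?thesis by (simp add: energy'_def[abs_def])
  qed
  define I' where "I' = I_tilde v\<^sub>c T R R' (\<lambda>x. u x 0) J N V t"
  have mean: "\<bar>mean t - I'\<bar> \<le> K * (\<bar>v\<^sub>c\<bar> / (4 * pi) * (T * (K * C2 c))) * s"
  proof -
    have R0: "R' 0 > 0" using R'_pos[of 0] T_pos by simp
    have sub: "{0..t} \<subseteq> {0..T}" using t by auto
    have i1: "(\<lambda>\<tau>. weight \<tau> * energy \<tau>) integrable_on {0..t}" "(\<lambda>\<tau>. weight \<tau> * energy' \<tau>) integrable_on {0..t}"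
      by (intro integrable_continuous_real continuous_intros continuous_on_subset[OF weight_continuous sub]
          continuous_on_subset[OF energy_continuous sub] continuous_on_subset[OF e'c sub])+
    have I': "I' = R' t / R' 0 * (mean 0 + v\<^sub>c * R' 0 / (4 * pi) * integral {0..t} (\<lambda>\<tau>. weight \<tau> * energy' \<tau>))"
      unfolding I'_def I_tilde_def mean_def weight_def energy'_def ..
    have "mean t - I' = R' t * (v\<^sub>c / (4 * pi) * (integral {0..t} (\<lambda>\<tau>. weight \<tau> * energy \<tau>)
        - integral {0..t} (\<lambda>\<tau>. weight \<tau> * energy' \<tau>)))"
      unfolding mean_formula[OF t] I' using R0 by (simp add: field_simps)
    also have "integral {0..t} (\<lambda>\<tau>. weight \<tau> * energy \<tau>) - integral {0..t} (\<lambda>\<tau>. weight \<tau> * energy' \<tau>)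
      = integral {0..t} (\<lambda>\<tau>. weight \<tau> * (energy \<tau> - energy' \<tau>))"
      using i1 by (simp add: right_diff_distrib integral_diff)
    also have "\<bar>R' t * (v\<^sub>c / (4 * pi) * integral {0..t} (\<lambda>\<tau>. weight \<tau> * (energy \<tau> - energy' \<tau>)))\<bar>
        \<le> K * (\<bar>v\<^sub>c\<bar> / (4 * pi) * (T * (K * (C2 c * s))))"
      unfolding abs_mult
    proof (intro mult_mono)
      show "\<bar>R' t\<bar> \<le> K" using K t by blast
      show "\<bar>v\<^sub>c / (4 * pi)\<bar> \<le> \<bar>v\<^sub>c\<bar> / (4 * pi)" by simp
      have "norm (integral {0..t} (\<lambda>\<tau>. weight \<tau> * (energy \<tau> - energy' \<tau>))) \<le> integral {0..t} (\<lambda>\<tau>. K * (C2 c * s))"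
      proof (rule integral_norm_bound_integral)
        show "(\<lambda>\<tau>. weight \<tau> * (energy \<tau> - energy' \<tau>)) integrable_on {0..t}"
          using integrable_diff[OF i1] by (simp add: right_diff_distrib)
        fix \<tau> assume "\<tau> \<in> {0..t}"
        then have \<tau>: "\<tau> \<in> {0..T}" using sub by auto
        have "\<bar>energy \<tau> - energy' \<tau>\<bar> \<le> C2 c * s"
          unfolding energy_def energy'_def by (rule squares_error[OF ctx \<tau>])
        then show "norm (weight \<tau> * (energy \<tau> - energy' \<tau>)) \<le> K * (C2 c * s)"
          unfolding real_norm_def abs_mult using K \<tau> by (intro mult_mono) auto
      qed auto
      also have "\<dots> = t * (K * (C2 c * s))" using t by simp
      also have "\<dots> \<le> T * (K * (C2 c * s))" using t K C20 s0 by (intro mult_right_mono) auto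
      finally show "\<bar>integral {0..t} (\<lambda>\<tau>. weight \<tau> * (energy \<tau> - energy' \<tau>))\<bar> \<le> T * (K * (C2 c * s))" by simp
    qed (use K C20 s0 T_pos in auto)
    finally show ?thesis by (simp add: mult_ac)
  qed
  have Dint: "(\<lambda>y. D 0 0 y t) integrable_on {a..b}" "(\<lambda>y. ?V y t) integrable_on {a..b}" for a b
    by (intro integrable_continuous_real D00_continuous Vb_continuous[OF ctx] t)+
  have diff: "\<bar>integral {0..x} (\<lambda>y. D 0 0 y t) - integral {0..x} (\<lambda>y. ?V y t)\<bar> \<le> C1' * s"
    if x: "x \<in> {0..2 * pi}" for x
  proof -
    have ab: "(\<lambda>y. \<bar>D 0 0 y t - ?V y t\<bar>) integrable_on {a..b}" for a b
      by (intro integrable_continuous_real continuous_intros D00_continuous Vb_continuous[OF ctx] t)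
    have "integral {0..x} (\<lambda>y. D 0 0 y t) - integral {0..x} (\<lambda>y. ?V y t)
        = integral {0..x} (\<lambda>y. D 0 0 y t - ?V y t)"
      by (intro integral_diff[symmetric] Dint)
    also have "norm \<dots> \<le> integral {0..x} (\<lambda>y. \<bar>D 0 0 y t - ?V y t\<bar>)"
      by (rule integral_norm_bound_integral) (use ab integrable_diff[OF Dint] in auto)
    \<comment> \<open>Enlarging the interval makes the bound uniform in \<open>x\<close>, so that it
      also survives the outer average.\<close>
    also have "\<dots> \<le> integral {0..2 * pi} (\<lambda>y. \<bar>D 0 0 y t - ?V y t\<bar>)"
      by (rule integral_subset_le) (use x ab in auto)
    also have "\<dots> \<le> C1' * s" unfolding C1'_def by (rule L1_error[OF ctx t])
    finally show ?thesis by simp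
  qed
  define P where "P = integral {0..2 * pi} (\<lambda>x. integral {0..x} (\<lambda>y. D 0 0 y t))"
  define P' where "P' = integral {0..2 * pi} (\<lambda>x. integral {0..x} (\<lambda>y. ?V y t))"
  have "norm (P - P') \<le> integral {0..2 * pi} (\<lambda>x. C1' * s)"
  proof -
    have i: "(\<lambda>x. integral {0..x} (\<lambda>y. D 0 0 y t)) integrable_on {0..2 * pi}"
      "(\<lambda>x. integral {0..x} (\<lambda>y. ?V y t)) integrable_on {0..2 * pi}"
      by (intro integrable_continuous_real indefinite_integral_continuous_1 Dint)+
    have "P - P' = integral {0..2 * pi} (\<lambda>x. integral {0..x} (\<lambda>y. D 0 0 y t) - integral {0..x} (\<lambda>y. ?V y t))"
      unfolding P_def P'_def by (rule integral_diff[symmetric]) (rule i)+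
    also have "norm \<dots> \<le> integral {0..2 * pi} (\<lambda>x. C1' * s)"
      by (rule integral_norm_bound_integral) (use integrable_diff[OF i] diff in auto)
    finally show ?thesis .
  qed
  then have PP: "\<bar>1 / (2 * pi) * P - 1 / (2 * pi) * P'\<bar> \<le> C1' * s"
    by (simp add: right_diff_distrib[symmetric] abs_mult field_simps flip: diff_divide_distrib)
  define i' where "i' = i mod int J"
  have i': "i' \<in> {0..int J}" using J by (simp add: i'_def less_imp_le)
  have x: "node J i' \<in> {0..2 * pi}" using node_range[OF i' J] by simp
  \<comment> \<open>The reduction of the index matters only at \<open>i = int J\<close>, where it
    returns to node 0; there the periodicity of \<open>u\<close> compensates.\<close>
  have u_node: "u (node J i) t = u (node J i') t"
  proof (cases "i = int J")
    case True
    have "node J i = node J i' + 2 * pi" using True J by (simp add: i'_def node_def mesh_def)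
    then show ?thesis using u_per[OF t] by simp
  next
    case False
    then show ?thesis using i by (simp add: i'_def)
  qed
  have U: "reconstruction v\<^sub>c T R R' (\<lambda>x. u x 0) J N V n i = I' - 1 / (2 * pi) * P' + integral {0..node J i'} (\<lambda>y. ?V y t)"
    using False unfolding reconstruction_def Let_def I'_def P'_def i'_def t_def k by simp
  have "node J i' \<ge> 0" using x by simp
  have "u (node J i) t - reconstruction v\<^sub>c T R R' (\<lambda>x. u x 0) J N V n i
    = (mean t - I') - (1 / (2 * pi) * P - 1 / (2 * pi) * P')
      + (integral {0..node J i'} (\<lambda>y. D 0 0 y t) - integral {0..node J i'} (\<lambda>y. ?V y t))"
    unfolding u_node U u_formula[OF t \<open>node J i' \<ge> 0\<close>] P_def by simp
  also have "\<bar>\<dots>\<bar> \<le> K * (\<bar>v\<^sub>c\<bar> / (4 * pi) * (T * (K * C2 c))) * s + C1' * s + C1' * s"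
    using mean PP diff[OF x] by linarith
  also have "\<dots> = (K * (\<bar>v\<^sub>c\<bar> / (4 * pi) * (T * (K * C2 c))) + 2 * (2 * pi * B + pi + c\<^sup>2)) * s"
    unfolding C1'_def[symmetric] by (simp only: distrib_right)
  finally show ?thesis unfolding t_def .
qed

theorem reconstruction_convergence:
  "\<exists>c>0. \<exists>k0>0. \<forall>J N V. J \<ge> 1 \<longrightarrow> N \<ge> 1 \<longrightarrow> tstep T N \<le> k0 \<longrightarrow>
     (crank_nicolson \<delta> \<alpha> v\<^sub>c T R J N (sol J 0) V \<or> (\<exists>its. newton \<delta> \<alpha> v\<^sub>c T R J N its (sol J 0) V)) \<longrightarrow>
     (\<forall>n\<le>N. grid_norm J (\<lambda>i. u (node J i) (real n * tstep T N)
         - reconstruction v\<^sub>c T R R' (\<lambda>x. u x 0) J N V n i) \<le> c * ((tstep T N)\<^sup>2 + (mesh J)\<^sup>2))"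
proof -
  obtain c k0 where c: "c > 0" and k0: "k0 > 0" and conv:
    "\<And>J N V n. J \<ge> 1 \<Longrightarrow> N \<ge> 1 \<Longrightarrow> tstep T N \<le> k0 \<Longrightarrow>
     crank_nicolson \<delta> \<alpha> v\<^sub>c T R J N (sol J 0) V \<or> (\<exists>its. newton \<delta> \<alpha> v\<^sub>c T R J N its (sol J 0) V) \<Longrightarrow>
     n \<le> N \<Longrightarrow> grid_norm J (\<lambda>i. sol J (real n * tstep T N) i - V n i) \<le> c * ((tstep T N)\<^sup>2 + (mesh J)\<^sup>2)"
    using scheme_convergence by blast
  obtain K where K: "K \<ge> 0" "\<forall>t\<in>{0..T}. \<bar>R' t\<bar> \<le> K \<and> \<bar>weight t\<bar> \<le> K" using bounds_exist by blast
  define C where "C = K * (\<bar>v\<^sub>c\<bar> / (4 * pi) * (T * (K * C2 c))) + 2 * (2 * pi * B + pi + c\<^sup>2)"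
  have C20: "C2 c \<ge> 0" unfolding C2_def using B_nonneg c by simp
  have C: "C \<ge> 0" unfolding C_def using C20 K T_pos B_nonneg by (intro add_nonneg_nonneg mult_nonneg_nonneg) auto
  show ?thesis
  proof (intro exI conjI allI impI)
    show "sqrt (2 * pi) * C + 1 > 0" using C by (simp add: add_nonneg_pos)
    show "k0 > 0" by fact
    fix J N V n
    assume J: "J \<ge> 1" and N: "N \<ge> 1" and kk: "tstep T N \<le> k0" and n: "n \<le> N"
      and V: "crank_nicolson \<delta> \<alpha> v\<^sub>c T R J N (sol J 0) V \<or> (\<exists>its. newton \<delta> \<alpha> v\<^sub>c T R J N its (sol J 0) V)"
    define s where "s = (tstep T N)\<^sup>2 + (mesh J)\<^sup>2"
    have s0: "s \<ge> 0" by (simp add: s_def)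
    have perV: "per J (V n)" if "n \<le> N" for n
      using V
    proof
      assume "crank_nicolson \<delta> \<alpha> v\<^sub>c T R J N (sol J 0) V"
      then show ?thesis by (rule crank_nicolson_start(2)) (rule that)
    next
      assume "\<exists>its. newton \<delta> \<alpha> v\<^sub>c T R J N its (sol J 0) V"
      then show ?thesis using newton_newton_scheme[OF _ refl] that unfolding newton_scheme_def by blast
    qed
    have "grid_norm J (\<lambda>i. u (node J i) (real n * tstep T N) - reconstruction v\<^sub>c T R R' (\<lambda>x. u x 0) J N V n i)
        \<le> sqrt (2 * pi) * (C * s)"
    proof (rule grid_norm_bound)
      fix i assume i: "i \<in> {1..int J}"
      show "\<bar>u (node J i) (real n * tstep T N) - reconstruction v\<^sub>c T R R' (\<lambda>x. u x 0) J N V n i\<bar> \<le> C * s"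
        unfolding C_def
        by (rule reconstruction_error[OF J N refl s_def less_imp_le[OF c] perV conv[OF J N kk V, folded s_def] K n i])
    qed (rule J)
    also have "\<dots> \<le> (sqrt (2 * pi) * C + 1) * s" using s0 by (simp add: algebra_simps)
    finally show "grid_norm J (\<lambda>i. u (node J i) (real n * tstep T N) - reconstruction v\<^sub>c T R R' (\<lambda>x. u x 0) J N V n i)
        \<le> (sqrt (2 * pi) * C + 1) * ((tstep T N)\<^sup>2 + (mesh J)\<^sup>2)" by (simp add: s_def)
  qed
qed

end

section \<open>The derivatives of the solution\<close>

text \<open>The body of \<open>smooth_strip\<close> with its witness exposed, so that the families
  of \<open>u\<close> and \<open>v\<close> can be compared.\<close>

definition derivative_family :: "nat \<Rightarrow> real \<Rightarrow> (real \<Rightarrow> real \<Rightarrow> real) \<Rightarrow> (nat \<Rightarrow> nat \<Rightarrow> real \<Rightarrow> real \<Rightarrow> real) \<Rightarrow> bool" where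
  "derivative_family m T f D \<longleftrightarrow>
     (\<forall>x. \<forall>t\<in>{0..T}. D 0 0 x t = f x t) \<and>
     (\<forall>a b. a + b \<le> m \<longrightarrow> continuous_on (UNIV \<times> {0..T}) (\<lambda>(x, t). D a b x t)) \<and>
     (\<forall>a b. a + b < m \<longrightarrow> (\<forall>x. \<forall>t\<in>{0..T}.
        ((\<lambda>s. D a b s t) has_real_derivative D (Suc a) b x t) (at x) \<and>
        ((\<lambda>\<tau>. D a b x \<tau>) has_real_derivative D a (Suc b) x t) (at t within {0..T})))"

lemma smooth_strip_iff: "smooth_strip m T f \<longleftrightarrow> (\<exists>D. derivative_family m T f D)"
  by (simp add: smooth_strip_def derivative_family_def)

lemma derivative_familyD:
  assumes "derivative_family m T f D" and "t \<in> {0..T}"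
  shows "D 0 0 x t = f x t"
    and "a + b < m \<Longrightarrow> ((\<lambda>s. D a b s t) has_real_derivative D (Suc a) b x t) (at x)"
    and "a + b < m \<Longrightarrow> ((\<lambda>\<tau>. D a b x \<tau>) has_real_derivative D a (Suc b) x t) (at t within {0..T})"
  using assms unfolding derivative_family_def by blast+

text \<open>Iterated \<open>deriv\<close> is a total operator whose value is meaningful only where
  derivatives exist; up to order \<open>m\<close> the family supplies them.\<close>

lemma dsigma_eq:
  assumes D: "derivative_family m T f D" and t: "t \<in> {0..T}"
  shows "a \<le> m \<Longrightarrow> dsigma a f x t = D a 0 x t"
proof (induction a arbitrary: x)
  case 0
  then show ?case using derivative_familyD(1)[OF D t] by (simp add: dsigma_def)
next
  case (Suc a)
  then have "(deriv ^^ a) (\<lambda>s. f s t) = (\<lambda>s. D a 0 s t)" by (auto simp: dsigma_def)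
  then have "dsigma (Suc a) f x t = deriv (\<lambda>s. D a 0 s t) x" by (simp add: dsigma_def)
  also have "\<dots> = D (Suc a) 0 x t"
    using derivative_familyD(2)[OF D t, of a 0] Suc by (intro DERIV_imp_deriv) simp
  finally show ?case .
qed

lemma derivative_family_time:
  assumes D: "derivative_family m T f D" and t: "t \<in> {0..T}" and m: "m > 0"
  shows "((\<lambda>\<tau>. f x \<tau>) has_real_derivative D 0 1 x t) (at t within {0..T})"
proof -
  have "((\<lambda>\<tau>. D 0 0 x \<tau>) has_real_derivative D 0 (Suc 0) x t) (at t within {0..T})"
    by (rule derivative_familyD(3)[OF D t]) (use m in simp)
  then show ?thesis
    unfolding has_field_derivative_def One_nat_def
    by (rule has_derivative_transform[OF t, rotated]) (use derivative_familyD(1)[OF D] in simp)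
qed

lemma dtime_eq:
  assumes D: "derivative_family m T f D" and t: "t \<in> {0..T}" and m: "m > 0" and T: "T > 0"
  shows "dtime T f x t = D 0 1 x t"
  unfolding dtime_def
  using derivative_family_time[OF D t m, of x] T t
  by (intro vector_derivative_within_closed_interval)
    (auto simp: has_real_derivative_iff_has_vector_derivative)

text \<open>Positivity of \<open>T\<close> makes the interval nondegenerate, so one-sided
  derivatives at its ends are unique too.\<close>

lemma has_real_derivative_within_unique:
  fixes f :: "real \<Rightarrow> real"
  assumes "(f has_real_derivative d) (at t within {0..T})" "(f has_real_derivative e) (at t within {0..T})"
    and "T > 0" "t \<in> {0..T}"
  shows "d = e"
  using assms vector_derivative_within_closed_interval[of 0 T t f]
  unfolding has_real_derivative_iff_has_vector_derivative by metis

text \<open>Compactness bounds each derivative on the window, and summing over the finitely many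
  orders gives a single constant.\<close>

lemma derivative_family_bounded:
  assumes D: "derivative_family m T f D"
  shows "\<exists>B. \<forall>a b x t. a + b \<le> m \<longrightarrow> x \<in> {-20..40} \<longrightarrow> t \<in> {0..T} \<longrightarrow> \<bar>D a b x t\<bar> \<le> B"
proof -
  have "\<exists>B. \<forall>x\<in>{-20..40}. \<forall>t\<in>{0..T}. \<bar>D a b x t\<bar> \<le> B" if "a + b \<le> m" for a b
  proof -
    have "continuous_on (UNIV \<times> {0..T}) (\<lambda>(x, t). D a b x t)"
      using D that unfolding derivative_family_def by blast
    then have "continuous_on ({-20..40} \<times> {0..T}) (\<lambda>(x, t). D a b x t)"
      by (rule continuous_on_subset) auto
    then have "bounded ((\<lambda>(x, t). D a b x t) ` ({-20..40} \<times> {0..T}))"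
      by (intro compact_imp_bounded compact_continuous_image compact_Times) auto
    then obtain B where "\<forall>y\<in>(\<lambda>(x, t). D a b x t) ` ({-20..40} \<times> {0..T}). norm y \<le> B"
      unfolding bounded_iff by blast
    then show ?thesis by fastforce
  qed
  then obtain B where B: "\<And>a b x t. a + b \<le> m \<Longrightarrow> x \<in> {-20..40} \<Longrightarrow> t \<in> {0..T} \<Longrightarrow> \<bar>D a b x t\<bar> \<le> B a b"
    by metis
  have "\<bar>D a b x t\<bar> \<le> (\<Sum>(a, b)\<in>{..m} \<times> {..m}. \<bar>B a b\<bar>)"
    if "a + b \<le> m" "x \<in> {-20..40}" "t \<in> {0..T}" for a b x t
  proof -
    have "\<bar>D a b x t\<bar> \<le> (\<lambda>(a, b). \<bar>B a b\<bar>) (a, b)" using B[OF that] by simp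
    also have "\<dots> \<le> (\<Sum>(a, b)\<in>{..m} \<times> {..m}. \<bar>B a b\<bar>)"
      using that by (intro member_le_sum) auto
    finally show ?thesis .
  qed
  then show ?thesis by blast
qed

theorem theorem3:
  fixes \<delta> \<alpha> v\<^sub>c T R\<^sub>0 M :: real
    and R R' :: "real \<Rightarrow> real"
    and u v :: "real \<Rightarrow> real \<Rightarrow> real"
  assumes "\<delta> > 0" and "\<alpha> > 0" and "T > 0"
    and "R\<^sub>0 > 0" and "R 0 = R\<^sub>0"
    and R_pos: "\<forall>t\<in>{0..T}. R t > 0"
    and R_deriv: "\<forall>t\<in>{0..T}. (R has_real_derivative R' t) (at t within {0..T})"
    and R_ode: "\<forall>t\<in>{0..T}. R' t = v\<^sub>c + (\<alpha> - 1) / R t"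
    and R_expanding: "\<forall>t\<in>{0..T}. R' t > 0"
    and u_smooth: "smooth_strip 4 T u"
    and u_periodic: "\<forall>\<sigma>. \<forall>t\<in>{0..T}. u (\<sigma> + 2 * pi) t = u \<sigma> t"
    and u_pde: "\<forall>\<sigma>. \<forall>t\<in>{0..T}.
          dtime T u \<sigma> t
          + \<delta> / (R t) ^ 4 * dsigma 4 u \<sigma> t
          + 1 / (R t)\<^sup>2 * (\<alpha> - 1 + \<delta> / (R t)\<^sup>2) * dsigma 2 u \<sigma> t
          + (\<alpha> - 1) / (R t)\<^sup>2 * u \<sigma> t
          - v\<^sub>c / (2 * (R t)\<^sup>2) * (dsigma 1 u \<sigma> t)\<^sup>2 = 0"
    and v_def: "\<forall>\<sigma>. \<forall>t\<in>{0..T}. v \<sigma> t = dsigma 1 u \<sigma> t"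
    and v_smooth: "smooth_strip 6 T v"
    and "M > 0"
    and v_bound: "\<forall>\<sigma>. \<forall>t\<in>{0..T}. \<bar>dsigma 1 v \<sigma> t\<bar> \<le> M"
  shows "\<exists>c>0. \<exists>k\<^sub>0>0. \<forall>(J::nat) (N::nat) (V :: nat \<Rightarrow> int \<Rightarrow> real).
     J \<ge> 1 \<longrightarrow> N \<ge> 1 \<longrightarrow> tstep T N \<le> k\<^sub>0 \<longrightarrow>
     (crank_nicolson \<delta> \<alpha> v\<^sub>c T R J N (restrict_grid J (\<lambda>\<sigma>. v \<sigma> 0)) V
      \<or> (\<exists>its. newton \<delta> \<alpha> v\<^sub>c T R J N its (restrict_grid J (\<lambda>\<sigma>. v \<sigma> 0)) V)) \<longrightarrow>
     (\<forall>n\<le>N. mesh J * (\<Sum>i=1..int J. V n i) = 0) \<longrightarrow>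
     (MAX n\<in>{0..N}. grid_norm J (\<lambda>i.
        restrict_grid J (\<lambda>\<sigma>. u \<sigma> (real n * tstep T N)) i
        - reconstruction v\<^sub>c T R R' (\<lambda>\<sigma>. u \<sigma> 0) J N V n i))
     \<le> c * ((tstep T N)\<^sup>2 + (mesh J)\<^sup>2)"
proof -
  obtain Du where Du: "derivative_family 4 T u Du" using u_smooth smooth_strip_iff by blast
  obtain D where D: "derivative_family 6 T v D" using v_smooth smooth_strip_iff by blast
  obtain B where B: "\<forall>a b x t. a + b \<le> 6 \<longrightarrow> x \<in> {-20..40} \<longrightarrow> t \<in> {0..T} \<longrightarrow> \<bar>D a b x t\<bar> \<le> B"
    using derivative_family_bounded[OF D] by blast
  have "continuous_on {0..T} R"
    by (rule DERIV_continuous_on) (use R_deriv in blast)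
  then obtain r0 r1 where r: "r0 > 0" "\<And>t. t \<in> {0..T} \<Longrightarrow> R t \<in> {r0..r1}"
  proof -
    have ne: "{0..T} \<noteq> {}" using \<open>T > 0\<close> by simp
    obtain s where s: "s \<in> {0..T}" "\<forall>t\<in>{0..T}. R s \<le> R t"
      using continuous_attains_inf[OF compact_Icc ne \<open>continuous_on {0..T} R\<close>] by blast
    obtain s' where s': "s' \<in> {0..T}" "\<forall>t\<in>{0..T}. R t \<le> R s'"
      using continuous_attains_sup[OF compact_Icc ne \<open>continuous_on {0..T} R\<close>] by blast
    show ?thesis by (rule that[of "R s" "R s'"]) (use s s' R_pos in auto)
  qed
  have "r0 \<le> r1" using r(2)[of 0] \<open>T > 0\<close> by auto
  \<comment> \<open>The two families come from separate existence statements; they are matched by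
    uniqueness of derivatives as far as the equation for \<open>v\<close> requires.\<close>
  have v_eq: "D 0 0 x t = Du 1 0 x t" if "t \<in> {0..T}" for x t
    using derivative_familyD(1)[OF D that] v_def dsigma_eq[OF Du that, of 1] that by simp
  have D_eq: "D a 0 x t = Du (Suc a) 0 x t" if t: "t \<in> {0..T}" and a: "a \<le> 3" for a x t
    using a
  proof (induction a arbitrary: x)
    case 0
    then show ?case using v_eq[OF t] by simp
  next
    case (Suc a)
    have "(\<lambda>s. D a 0 s t) = (\<lambda>s. Du (Suc a) 0 s t)" using Suc by auto
    moreover have "((\<lambda>s. D a 0 s t) has_real_derivative D (Suc a) 0 x t) (at x)"
      using derivative_familyD(2)[OF D t, of a 0] Suc by simp
    moreover have "((\<lambda>s. Du (Suc a) 0 s t) has_real_derivative Du (Suc (Suc a)) 0 x t) (at x)"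
      using derivative_familyD(2)[OF Du t, of "Suc a" 0] Suc by simp
    ultimately show ?case using DERIV_unique by metis
  qed
  \<comment> \<open>Differentiating the equation for \<open>u\<close> in space produces the mixed
    derivative \<open>Du 1 1\<close>; this identifies it with the time derivative of
    \<open>v\<close>.\<close>
  have Dt_eq: "D 0 1 x t = Du 1 1 x t" if t: "t \<in> {0..T}" for x t
  proof (rule has_real_derivative_within_unique[OF _ _ \<open>T > 0\<close> t])
    show "((\<lambda>s. D 0 0 x s) has_real_derivative D 0 1 x t) (at t within {0..T})"
      using derivative_familyD(3)[OF D t, of 0 0] by simp
    have "((\<lambda>s. Du 1 0 x s) has_real_derivative Du 1 1 x t) (at t within {0..T})"
      using derivative_familyD(3)[OF Du t, of 1 0] by simp
    then show "((\<lambda>s. D 0 0 x s) has_real_derivative Du 1 1 x t) (at t within {0..T})"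
      unfolding has_field_derivative_def by (rule has_derivative_transform[OF t, rotated]) (rule v_eq)
  qed
  have u_eq: "Du 0 0 x t = u x t" if "t \<in> {0..T}" for x t
    by (rule derivative_familyD(1)[OF Du that])
  have pde: "Du 0 1 x t + \<delta> / R t ^ 4 * D 3 0 x t
      + 1 / (R t)\<^sup>2 * (\<alpha> - 1 + \<delta> / (R t)\<^sup>2) * D 1 0 x t + (\<alpha> - 1) / (R t)\<^sup>2 * u x t
      - v\<^sub>c / (2 * (R t)\<^sup>2) * (D 0 0 x t)\<^sup>2 = 0" if t: "t \<in> {0..T}" for x t
  proof -
    have ds: "dsigma 4 u x t = D 3 0 x t" "dsigma 2 u x t = D 1 0 x t" "dsigma 1 u x t = D 0 0 x t"
      using dsigma_eq[OF Du t] D_eq[OF t, of 3] D_eq[OF t, of 1] D_eq[OF t, of 0]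
      by (simp_all add: eval_nat_numeral)
    have dt: "dtime T u x t = Du 0 1 x t" by (rule dtime_eq[OF Du t _ \<open>T > 0\<close>]) simp
    show ?thesis using u_pde[rule_format, OF t, of x] unfolding ds dt .
  qed
  \<comment> \<open>The left side of the equation for \<open>u\<close> vanishes identically in
    \<open>x\<close>, hence so does its space derivative. The square yields twice the product, which
    removes the 2 in the denominator.\<close>
  have v_pde: "D 0 1 x t + \<delta> / R t ^ 4 * D 4 0 x t
      + 1 / (R t)\<^sup>2 * (\<alpha> - 1 + \<delta> / (R t)\<^sup>2) * D 2 0 x t + (\<alpha> - 1) / (R t)\<^sup>2 * D 0 0 x t
      - v\<^sub>c / (R t)\<^sup>2 * (D 0 0 x t * D 1 0 x t) = 0" if t: "t \<in> {0..T}" for x t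
  proof -
    define a c d e where "a = \<delta> / R t ^ 4" and "c = 1 / (R t)\<^sup>2 * (\<alpha> - 1 + \<delta> / (R t)\<^sup>2)"
      and "d = (\<alpha> - 1) / (R t)\<^sup>2" and "e = v\<^sub>c / (2 * (R t)\<^sup>2)"
    have D1: "((\<lambda>s. D p 0 s t) has_real_derivative D (Suc p) 0 x t) (at x)" if "p < 6" for p
      using derivative_familyD(2)[OF D t, of p 0] that by simp
    have "((\<lambda>s. Du 0 1 s t) has_real_derivative Du (Suc 0) 1 x t) (at x)"
      by (rule derivative_familyD(2)[OF Du t]) simp
    moreover have "((\<lambda>s. u s t) has_real_derivative D 0 0 x t) (at x)"
      using derivative_familyD(2)[OF Du t, of 0 0 x] v_eq[OF t] u_eq[OF t] by simp
    moreover have "((\<lambda>s. D 3 0 s t) has_real_derivative D 4 0 x t) (at x)"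
      "((\<lambda>s. D 1 0 s t) has_real_derivative D 2 0 x t) (at x)"
      "((\<lambda>s. D 0 0 s t) has_real_derivative D 1 0 x t) (at x)"
      using D1[of 3] D1[of 1] D1[of 0] by (simp_all add: eval_nat_numeral)
    ultimately have "((\<lambda>s. Du 0 1 s t + a * D 3 0 s t + c * D 1 0 s t + d * u s t - e * (D 0 0 s t)\<^sup>2)
        has_real_derivative (Du (Suc 0) 1 x t + a * D 4 0 x t + c * D 2 0 x t + d * D 0 0 x t
          - e * (2 * D 0 0 x t * D 1 0 x t))) (at x)"
      by (auto intro!: derivative_eq_intros)
    moreover have "(\<lambda>s. Du 0 1 s t + a * D 3 0 s t + c * D 1 0 s t + d * u s t - e * (D 0 0 s t)\<^sup>2) = (\<lambda>s. 0)"
      using pde[OF t] by (simp add: a_def c_def d_def e_def)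
    ultimately have "((\<lambda>s. 0) has_real_derivative (Du (Suc 0) 1 x t + a * D 4 0 x t + c * D 2 0 x t + d * D 0 0 x t
          - e * (2 * D 0 0 x t * D 1 0 x t))) (at x)" by simp
    then have "Du (Suc 0) 1 x t + a * D 4 0 x t + c * D 2 0 x t + d * D 0 0 x t
          - e * (2 * D 0 0 x t * D 1 0 x t) = 0"
      using DERIV_unique DERIV_const by blast
    moreover have "e * (2 * D 0 0 x t * D 1 0 x t) = v\<^sub>c / (R t)\<^sup>2 * (D 0 0 x t * D 1 0 x t)"
      by (simp add: e_def)
    ultimately show ?thesis using Dt_eq[OF t, of x] by (simp add: a_def c_def d_def)
  qed
  have v_per: "D 0 0 (x + 2 * pi) t = D 0 0 x t" if t: "t \<in> {0..T}" for x t
  proof -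
    have d: "((\<lambda>s. u s t) has_real_derivative D 0 0 x t) (at x)" for x
      using derivative_familyD(2)[OF Du t, of 0 0 x] v_eq[OF t] u_eq[OF t] by simp
    have "((\<lambda>s. u (s + 2 * pi) t) has_real_derivative D 0 0 (x + 2 * pi) t) (at x)"
      using d[of "x + 2 * pi"] by (simp only: DERIV_shift)
    moreover have "(\<lambda>s. u (s + 2 * pi) t) = (\<lambda>s. u s t)" using u_periodic t by auto
    ultimately show ?thesis using d DERIV_unique by metis
  qed
  interpret reconstructible_solution \<delta> \<alpha> v\<^sub>c r0 r1 R D T B u "Du 0 1" R'
  proof
    show "continuous_on (UNIV \<times> {0..T}) (\<lambda>(x, t). Du 0 1 x t)"
      using Du unfolding derivative_family_def by simp
    show "continuous_on (UNIV \<times> {0..T}) (\<lambda>(x, t). D 0 0 x t)"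
      using D unfolding derivative_family_def by simp
    show "((\<lambda>s. u s t) has_real_derivative D 0 0 x t) (at x)" if t: "t \<in> {0..T}" for x t
      using derivative_familyD(2)[OF Du t, of 0 0 x] v_eq[OF t] u_eq[OF t] by simp
    show "((\<lambda>s. u x s) has_real_derivative Du 0 1 x t) (at t within {0..T})" if "t \<in> {0..T}" for x t
      by (rule derivative_family_time[OF Du that]) simp
    show "((\<lambda>s. D p q s t) has_real_derivative D (Suc p) q x t) (at x)"
      "((\<lambda>s. D p q x s) has_real_derivative D p (Suc q) x t) (at t within {0..T})"
      if "p + q < 6" "t \<in> {0..T}" for p q x t
      using derivative_familyD(2,3)[OF D that(2) that(1)] by auto
    show "\<bar>D p q x t\<bar> \<le> B" if "p + q \<le> 6" "x \<in> {-20..40}" "t \<in> {0..T}" for p q x t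
      using B that by blast
    show "(R has_real_derivative R' t) (at t within {0..T})" "R' t = v\<^sub>c + (\<alpha> - 1) / R t" "R' t > 0"
      if "t \<in> {0..T}" for t
      using R_deriv R_ode R_expanding that by auto
    show "u (x + 2 * pi) t = u x t" if "t \<in> {0..T}" for x t
      using u_periodic that by auto
  qed (fact \<open>\<delta> > 0\<close> \<open>T > 0\<close> r \<open>r0 \<le> r1\<close> v_pde v_per pde)+
  have sol0: "restrict_grid J (\<lambda>\<sigma>. v \<sigma> 0) = sol J 0" for J
    using derivative_familyD(1)[OF D, of 0] \<open>T > 0\<close> by (auto simp: restrict_grid_def sol_def)
  obtain c k0 where c: "c > 0" and k0: "k0 > 0" and conv: "\<forall>J N V. J \<ge> 1 \<longrightarrow> N \<ge> 1 \<longrightarrow> tstep T N \<le> k0 \<longrightarrow>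
     (crank_nicolson \<delta> \<alpha> v\<^sub>c T R J N (sol J 0) V \<or> (\<exists>its. newton \<delta> \<alpha> v\<^sub>c T R J N its (sol J 0) V)) \<longrightarrow>
     (\<forall>n\<le>N. grid_norm J (\<lambda>i. u (node J i) (real n * tstep T N)
         - reconstruction v\<^sub>c T R R' (\<lambda>x. u x 0) J N V n i) \<le> c * ((tstep T N)\<^sup>2 + (mesh J)\<^sup>2))"
    using reconstruction_convergence by blast
  show ?thesis
  proof (rule exI[of _ c], rule conjI[OF c], rule exI[of _ k0], rule conjI[OF k0], intro allI impI)
    fix J N V
    assume "J \<ge> 1" "N \<ge> 1" "tstep T N \<le> k0"
      "crank_nicolson \<delta> \<alpha> v\<^sub>c T R J N (restrict_grid J (\<lambda>\<sigma>. v \<sigma> 0)) V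
      \<or> (\<exists>its. newton \<delta> \<alpha> v\<^sub>c T R J N its (restrict_grid J (\<lambda>\<sigma>. v \<sigma> 0)) V)"
    then have bound: "\<forall>n\<le>N. grid_norm J (\<lambda>i. u (node J i) (real n * tstep T N)
         - reconstruction v\<^sub>c T R R' (\<lambda>x. u x 0) J N V n i) \<le> c * ((tstep T N)\<^sup>2 + (mesh J)\<^sup>2)"
      using conv unfolding sol0 by blast
    show "(MAX n\<in>{0..N}. grid_norm J (\<lambda>i. restrict_grid J (\<lambda>\<sigma>. u \<sigma> (real n * tstep T N)) i
        - reconstruction v\<^sub>c T R R' (\<lambda>\<sigma>. u \<sigma> 0) J N V n i)) \<le> c * ((tstep T N)\<^sup>2 + (mesh J)\<^sup>2)"
      using bound by (intro Max.boundedI) (auto simp: restrict_grid_def)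
  qed
qed

end
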